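(* For any nonabelian finitely generated free group $\Gamma$, there are a null (hence tame) minimal action $\Gamma\curvearrowright \tilde{X}$, an effective strongly proximal action $\Gamma\curvearrowright Y$, and a point-distal non-open extension $\tilde{X}\rightarrow Y$ with a unique RIM.
   Context: All actions are continuous actions of a countably infinite discrete group $\Gamma$ on compact metrizable spaces. For a compact metrizable space $X$, $\mathcal{M}(X)$ denotes the space of Borel probability measures on $X$ with the weak$^*$-topology. An action $\Gamma\curvearrowright X$ is minimal if there is no proper nonempty closed $\Gamma$-invariant subset; it is strongly proximal if for the induced action on $\mathcal{M}(X)$ every nonempty closed $\Gamma$-invariant subset intersects $X$ (viewed as point masses); it is effective if for any distinct $s,t\in\Gamma$ one has $sy\neq ty$ for some $y$. For a sequence $\mathfrak{s}=\{s_n\}$ in $\Gamma$ and a finite open cover $\mathcal{U}$, the sequence entropy is $\limsup_n \frac1n\log N(\bigvee_{i=1}^n s_i^{-1}\mathcal{U})$; the action is null if this is $0$ for all $\mathfrak{s},\mathcal{U}$. Tame means the induced action on $C(X)$ contains no isomorphic dynamical copy of $\ell^1(\Gamma)$; null actions are tame. An extension (factor map) $\pi:X\to Y$ is a $\Gamma$-equivariant continuous surjection. A RIM (relative invariant measure) for $\pi$ is a continuous $\Gamma$-equivariant map $Y\to\mathcal{M}(X)$ such that the image of each $y$ has support in $\pi^{-1}(y)$. $\pi$ is point-distal if there is a point $x\in X$ with dense orbit such that for any $x'\neq x$ with $\pi(x)=\pi(x')$ the orbit closure of $(x,x')$ does not meet the diagonal. *)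

theory Defs
  imports "HOL-Analysis.Analysis" "HOL-Probability.Probability" "HOL-Algebra.Generated_Groups"
begin

text \<open>Words over a set of letters; a letter (a,True) stands for a, (a,False) for a inverse.\<close>

definition reduced_word :: "('g \<times> bool) list \<Rightarrow> bool" where
  "reduced_word w \<longleftrightarrow>
     (\<forall>i. Suc i < length w \<longrightarrow> \<not> (fst (w ! i) = fst (w ! Suc i) \<and> snd (w ! i) \<noteq> snd (w ! Suc i)))"

fun eval_word :: "('g, 'm) monoid_scheme \<Rightarrow> ('g \<times> bool) list \<Rightarrow> 'g" where
  "eval_word G [] = \<one>\<^bsub>G\<^esub>"
| "eval_word G (l # w) = (if snd l then fst l else inv\<^bsub>G\<^esub> (fst l)) \<otimes>\<^bsub>G\<^esub> eval_word G w"

definition free_basis :: "('g, 'm) monoid_scheme \<Rightarrow> 'g set \<Rightarrow> bool" where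
  "free_basis G S \<longleftrightarrow> S \<subseteq> carrier G \<and> generate G S = carrier G \<and>
     (\<forall>w. w \<noteq> [] \<and> set (map fst w) \<subseteq> S \<and> reduced_word w \<longrightarrow> eval_word G w \<noteq> \<one>\<^bsub>G\<^esub>)"

definition cont_action :: "('g, 'm) monoid_scheme \<Rightarrow> 'a::topological_space set \<Rightarrow> ('g \<Rightarrow> 'a \<Rightarrow> 'a) \<Rightarrow> bool" where
  "cont_action G X act \<longleftrightarrow>
     (\<forall>g\<in>carrier G. continuous_on X (act g) \<and> act g ` X \<subseteq> X) \<and>
     (\<forall>x\<in>X. act \<one>\<^bsub>G\<^esub> x = x) \<and>
     (\<forall>g\<in>carrier G. \<forall>h\<in>carrier G. \<forall>x\<in>X. act (g \<otimes>\<^bsub>G\<^esub> h) x = act g (act h x))"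

definition minimal_action :: "('g, 'm) monoid_scheme \<Rightarrow> 'a::topological_space set \<Rightarrow> ('g \<Rightarrow> 'a \<Rightarrow> 'a) \<Rightarrow> bool" where
  "minimal_action G X act \<longleftrightarrow>
     (\<forall>Z. closedin (top_of_set X) Z \<and> Z \<noteq> {} \<and> (\<forall>g\<in>carrier G. act g ` Z \<subseteq> Z) \<longrightarrow> Z = X)"

definition effective_action :: "('g, 'm) monoid_scheme \<Rightarrow> 'a set \<Rightarrow> ('g \<Rightarrow> 'a \<Rightarrow> 'a) \<Rightarrow> bool" where
  "effective_action G X act \<longleftrightarrow>
     (\<forall>s\<in>carrier G. \<forall>t\<in>carrier G. s \<noteq> t \<longrightarrow> (\<exists>y\<in>X. act s y \<noteq> act t y))"

definition prob_measures :: "'a::topological_space set \<Rightarrow> 'a measure set" where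
  "prob_measures X = {\<mu>. sets \<mu> = sets (restrict_space borel X) \<and> prob_space \<mu>}"

definition weak_star_top :: "'a::topological_space set \<Rightarrow> 'a measure topology" where
  "weak_star_top X = topology_generated_by
     {{\<mu> \<in> prob_measures X. (\<integral>x. f x \<partial>\<mu>) \<in> U} | (f :: 'a \<Rightarrow> real) U. continuous_on X f \<and> open U}"

definition point_mass :: "'a::topological_space set \<Rightarrow> 'a \<Rightarrow> 'a measure" where
  "point_mass X x = return (restrict_space borel X) x"

definition push_measure :: "'a::topological_space set \<Rightarrow> ('a \<Rightarrow> 'a) \<Rightarrow> 'a measure \<Rightarrow> 'a measure" where
  "push_measure X f \<mu> = distr \<mu> (restrict_space borel X) f"

definition strongly_proximal :: "('g, 'm) monoid_scheme \<Rightarrow> 'a::topological_space set \<Rightarrow> ('g \<Rightarrow> 'a \<Rightarrow> 'a) \<Rightarrow> bool" where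
  "strongly_proximal G X act \<longleftrightarrow>
     (\<forall>C. C \<noteq> {} \<and> closedin (weak_star_top X) C \<and>
          (\<forall>g\<in>carrier G. \<forall>\<mu>\<in>C. push_measure X (act g) \<mu> \<in> C)
        \<longrightarrow> (\<exists>x\<in>X. point_mass X x \<in> C))"

definition measure_support :: "'a::topological_space set \<Rightarrow> 'a measure \<Rightarrow> 'a set" where
  "measure_support X \<mu> = {x\<in>X. \<forall>U. open U \<and> x \<in> U \<longrightarrow> emeasure \<mu> (U \<inter> X) > 0}"

definition open_cover :: "'a::topological_space set \<Rightarrow> 'a set set \<Rightarrow> bool" where
  "open_cover X \<U> \<longleftrightarrow> finite \<U> \<and> (\<forall>U\<in>\<U>. openin (top_of_set X) U) \<and> \<Union>\<U> = X"

definition cover_number :: "'a set \<Rightarrow> 'a set set \<Rightarrow> nat" where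
  "cover_number X \<V> = (LEAST k. \<exists>\<W>\<subseteq>\<V>. finite \<W> \<and> card \<W> = k \<and> X \<subseteq> \<Union>\<W>)"

definition join_cover :: "'a set \<Rightarrow> ('g \<Rightarrow> 'a \<Rightarrow> 'a) \<Rightarrow> (nat \<Rightarrow> 'g) \<Rightarrow> nat \<Rightarrow> 'a set set \<Rightarrow> 'a set set" where
  "join_cover X act s n \<U> =
     {X \<inter> (\<Inter>i\<in>{1..n}. {x \<in> X. act (s i) x \<in> c i}) | c. \<forall>i\<in>{1..n}. c i \<in> \<U>}"

definition sequence_entropy :: "'a set \<Rightarrow> ('g \<Rightarrow> 'a \<Rightarrow> 'a) \<Rightarrow> (nat \<Rightarrow> 'g) \<Rightarrow> 'a set set \<Rightarrow> ereal" where
  "sequence_entropy X act s \<U> =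
     limsup (\<lambda>n. ereal (ln (real (cover_number X (join_cover X act s n \<U>))) / real n))"

definition null_action :: "('g, 'm) monoid_scheme \<Rightarrow> 'a::topological_space set \<Rightarrow> ('g \<Rightarrow> 'a \<Rightarrow> 'a) \<Rightarrow> bool" where
  "null_action G X act \<longleftrightarrow>
     (\<forall>s \<U>. range s \<subseteq> carrier G \<and> open_cover X \<U> \<longrightarrow> sequence_entropy X act s \<U> = 0)"

definition factor_map :: "('g, 'm) monoid_scheme \<Rightarrow> 'a::topological_space set \<Rightarrow> ('g \<Rightarrow> 'a \<Rightarrow> 'a)
    \<Rightarrow> 'b::topological_space set \<Rightarrow> ('g \<Rightarrow> 'b \<Rightarrow> 'b) \<Rightarrow> ('a \<Rightarrow> 'b) \<Rightarrow> bool" where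
  "factor_map G X actX Y actY \<pi> \<longleftrightarrow> continuous_on X \<pi> \<and> \<pi> ` X = Y \<and>
     (\<forall>g\<in>carrier G. \<forall>x\<in>X. \<pi> (actX g x) = actY g (\<pi> x))"

definition open_extension :: "'a::topological_space set \<Rightarrow> 'b::topological_space set \<Rightarrow> ('a \<Rightarrow> 'b) \<Rightarrow> bool" where
  "open_extension X Y \<pi> \<longleftrightarrow> (\<forall>U. openin (top_of_set X) U \<longrightarrow> openin (top_of_set Y) (\<pi> ` U))"

definition point_distal :: "('g, 'm) monoid_scheme \<Rightarrow> 'a::topological_space set \<Rightarrow> ('g \<Rightarrow> 'a \<Rightarrow> 'a) \<Rightarrow> ('a \<Rightarrow> 'b) \<Rightarrow> bool" where
  "point_distal G X act \<pi> \<longleftrightarrow>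
     (\<exists>x\<in>X. closure {act g x | g. g \<in> carrier G} = X \<and>
        (\<forall>x'\<in>X. x' \<noteq> x \<and> \<pi> x' = \<pi> x \<longrightarrow>
           closure {(act g x, act g x') | g. g \<in> carrier G} \<inter> {(z, z) | z. True} = {}))"

definition is_RIM :: "('g, 'm) monoid_scheme \<Rightarrow> 'a::topological_space set \<Rightarrow> ('g \<Rightarrow> 'a \<Rightarrow> 'a)
    \<Rightarrow> 'b::topological_space set \<Rightarrow> ('g \<Rightarrow> 'b \<Rightarrow> 'b) \<Rightarrow> ('a \<Rightarrow> 'b) \<Rightarrow> ('b \<Rightarrow> 'a measure) \<Rightarrow> bool" where
  "is_RIM G X actX Y actY \<pi> \<rho> \<longleftrightarrow>
     continuous_map (top_of_set Y) (weak_star_top X) \<rho> \<and>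
     (\<forall>g\<in>carrier G. \<forall>y\<in>Y. \<rho> (actY g y) = push_measure X (actX g) (\<rho> y)) \<and>
     (\<forall>y\<in>Y. measure_support X (\<rho> y) \<subseteq> {x \<in> X. \<pi> x = y})"

definition unique_RIM :: "('g, 'm) monoid_scheme \<Rightarrow> 'a::topological_space set \<Rightarrow> ('g \<Rightarrow> 'a \<Rightarrow> 'a)
    \<Rightarrow> 'b::topological_space set \<Rightarrow> ('g \<Rightarrow> 'b \<Rightarrow> 'b) \<Rightarrow> ('a \<Rightarrow> 'b) \<Rightarrow> bool" where
  "unique_RIM G X actX Y actY \<pi> \<longleftrightarrow>
     (\<exists>\<rho>. is_RIM G X actX Y actY \<pi> \<rho> \<and>
        (\<forall>\<rho>'. is_RIM G X actX Y actY \<pi> \<rho>' \<longrightarrow> (\<forall>y\<in>Y. \<rho>' y = \<rho> y)))"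

end

theory Submission
  imports Defs "HOL-Real_Asymp.Real_Asymp"
begin

text \<open>The space \<open>Y\<close> is the boundary of the Cayley tree, an end being encoded by the function that
  assigns to every vertex the first letter of the ray from there to the end.  The group also acts on the
  2-adic integers through the exponent sum \<open>\<sigma>\<close> of a generator \<open>a\<close>, and \<open>X\<close> is obtained from the
  product of \<open>Y\<close> with the 2-adic integers by doubling the orbit of the point formed by the end
  \<open>a a a \<dots>\<close> and \<open>0\<close>: near this point a flag tells whether the end leaves the axis of \<open>a\<close> at a height
  \<open>2 ^ j\<close> while the 2-adic integer is divisible by \<open>2 ^ (j + 1)\<close>.

  Haar measure on the fibres does not see the doubled points, so it lifts to a RIM; it is the only one,
  because powers of the generators contract \<open>Y\<close> and hence the law of the 2-adic coordinate is the
  same on every fibre and invariant under translation.  The ends that leave the axis at a height which is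
  not a power of \<open>2\<close> accumulate at \<open>a a a \<dots>\<close> but have no flagged preimage, so the projection is not open.
  The action is null because finitely many vertices see only polynomially many patterns: at most one
  vertex of each translate of the axis is flagged, and away from the translate closest to the end the
  flags are cut out by 2-adic balls.\<close>

section \<open>Normal forms in a free group\<close>

text \<open>Two demands pull against each other. Minimality needs both values of the flag
  arbitrarily close to each doubled point, while nullness allows only few flag patterns on a finite
  set of vertices. Exit heights \<open>2 ^ j\<close> and all other heights supply the two values.
  The modulus is one power finer than the height, so that two flags on one axis would force
  \<open>2 ^ Suc k\<close> to divide \<open>2 ^ k\<close>. Along an end that stays on an axis, every
  vertex of that axis is a candidate for a free flag; the 2-adic coordinate, compared with the
  exponent sum, singles out at most one. This coordinate also moves isometrically, which gives
  point-distality over an end whose fibre has no doubled point, such as \<open>b b b ...\<close>. A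
  RIM whose measures have full support on all fibres would make the projection open. Here the
  doubled point with raised flag is isolated in its fibre, hence invisible to Haar measure, although
  it is a limit of points over other ends.\<close>

lemma reduced_word_Cons:
  "reduced_word (l # w) \<longleftrightarrow>
     reduced_word w \<and> (w \<noteq> [] \<longrightarrow> \<not> (fst l = fst (hd w) \<and> snd l \<noteq> snd (hd w)))"
  unfolding reduced_word_def by (cases w) (auto simp: All_less_Suc2)

lemma reduced_word_Nil [simp]: "reduced_word []"
  by (simp add: reduced_word_def)

locale free_grp = group G for G (structure) +
  fixes S :: "'a set"
  assumes fb: "free_basis G S"
begin

definition letter :: "'a \<times> bool \<Rightarrow> 'a" where
  "letter l = (if snd l then fst l else inv (fst l))"

definition flip :: "'a \<times> bool \<Rightarrow> 'a \<times> bool" where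
  "flip l = (fst l, \<not> snd l)"

definition reduced :: "('a \<times> bool) list \<Rightarrow> bool" where
  "reduced w \<longleftrightarrow> set (map fst w) \<subseteq> S \<and> reduced_word w"

abbreviation "word_val \<equiv> eval_word G"

lemma S_carrier: "S \<subseteq> carrier G" and gen_S: "generate G S = carrier G"
  and free: "\<lbrakk>w \<noteq> []; reduced w\<rbrakk> \<Longrightarrow> word_val w \<noteq> \<one>"
  using fb unfolding free_basis_def reduced_def by auto

lemma letter_carrier: "fst l \<in> S \<Longrightarrow> letter l \<in> carrier G"
  using S_carrier by (auto simp: letter_def)

lemma word_val_carrier: "set (map fst w) \<subseteq> S \<Longrightarrow> word_val w \<in> carrier G"
proof (induction w)
  case (Cons l w)
  then show ?case using letter_carrier[of l] by (auto simp: letter_def)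
qed auto

lemma word_val_Cons: "word_val (l # w) = letter l \<otimes> word_val w"
  by (simp add: letter_def)

lemma letter_flip: "fst l \<in> S \<Longrightarrow> letter (flip l) = inv (letter l)"
  using S_carrier by (auto simp: letter_def flip_def)

lemma flip_flip [simp]: "flip (flip l) = l" and fst_flip [simp]: "fst (flip l) = fst l"
  and flip_neq [simp]: "flip l \<noteq> l"
  by (auto simp: flip_def prod_eq_iff)

lemma reduced_Cons: "reduced (l # w) \<longleftrightarrow> fst l \<in> S \<and> reduced w \<and> (w \<noteq> [] \<longrightarrow> hd w \<noteq> flip l)"
  unfolding reduced_def reduced_word_Cons by (auto simp: flip_def prod_eq_iff)

lemma reduced_Nil [simp]: "reduced []"
  by (simp add: reduced_def)

text \<open>The letters of \<open>u\<close> are moved one by one, flipped, in front of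
  \<open>v\<close>; since the first letters differ, nothing ever cancels.\<close>

lemma word_val_rev_append:
  "\<lbrakk>reduced u; reduced v; u \<noteq> []; v \<noteq> [] \<Longrightarrow> hd u \<noteq> hd v\<rbrakk>
    \<Longrightarrow> \<exists>w. w \<noteq> [] \<and> reduced w \<and> word_val w = inv (word_val u) \<otimes> word_val v"
proof (induction u arbitrary: v)
  case (Cons l u)
  have l: "fst l \<in> S" and u: "reduced u" and v: "reduced v" and hu: "u \<noteq> [] \<longrightarrow> hd u \<noteq> flip l"
    using Cons.prems by (auto simp: reduced_Cons)
  have w: "reduced (flip l # v)"
    using Cons.prems l v by (auto simp: reduced_Cons)
  have car: "letter l \<in> carrier G" "word_val u \<in> carrier G" "word_val v \<in> carrier G"
    using l u v letter_carrier word_val_carrier reduced_def by auto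
  have eq: "inv (word_val (l # u)) \<otimes> word_val v = inv (word_val u) \<otimes> word_val (flip l # v)"
    unfolding word_val_Cons letter_flip[OF l] using car by (simp add: inv_mult_group m_assoc)
  show ?case
  proof (cases "u = []")
    case True
    then show ?thesis using eq w word_val_carrier[of "flip l # v"] w
      by (intro exI[of _ "flip l # v"]) (auto simp: reduced_def)
  next
    case False
    then have "\<exists>w. w \<noteq> [] \<and> reduced w \<and> word_val w = inv (word_val u) \<otimes> word_val (flip l # v)"
      using u w hu by (intro Cons.IH) auto
    then show ?thesis using eq by simp
  qed
qed auto

text \<open>After the common prefix is removed, the quotient of two different words is a nonempty
  reduced word, which freeness forbids to be trivial.\<close>

lemma word_val_inj: "\<lbrakk>reduced u; reduced v; word_val u = word_val v\<rbrakk> \<Longrightarrow> u = v"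
proof (induction u arbitrary: v)
  case Nil
  then show ?case using free[of v] by auto
next
  case (Cons l u)
  show ?case
  proof (cases v)
    case Nil
    then show ?thesis using Cons.prems free[of "l # u"] by auto
  next
    case (Cons l' v')
    have car: "word_val (l # u) \<in> carrier G" "word_val v \<in> carrier G"
      using Cons.prems word_val_carrier reduced_def by blast+
    show ?thesis
    proof (cases "l = l'")
      case True
      have "word_val u \<in> carrier G" "word_val v' \<in> carrier G" "letter l \<in> carrier G"
        using Cons.prems Cons word_val_carrier letter_carrier by (auto simp: reduced_def)
      moreover have "letter l \<otimes> word_val u = letter l \<otimes> word_val v'"
        using Cons.prems(3) Cons True word_val_Cons by metis
      ultimately have "word_val u = word_val v'"
        by simp
      then show ?thesis
        using Cons.IH[of v'] Cons.prems Cons True by (auto simp: reduced_Cons)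
    next
      case False
      then obtain w where "w \<noteq> []" "reduced w" "word_val w = inv (word_val (l # u)) \<otimes> word_val v"
        using word_val_rev_append[of "l # u" v] Cons.prems Cons by force
      then show ?thesis
        using free car Cons.prems(3) by (metis l_inv)
    qed
  qed
qed

text \<open>Left multiplication by a letter on normal forms: at most one cancellation can occur,
  because the tail is already reduced.\<close>

definition cons_reduced :: "'a \<times> bool \<Rightarrow> ('a \<times> bool) list \<Rightarrow> ('a \<times> bool) list" where
  "cons_reduced l w = (if w \<noteq> [] \<and> hd w = flip l then tl w else l # w)"

lemma reduced_cons_reduced: "\<lbrakk>fst l \<in> S; reduced w\<rbrakk> \<Longrightarrow> reduced (cons_reduced l w)"
  by (cases w) (auto simp: cons_reduced_def reduced_Cons)

lemma word_val_cons_reduced: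
  assumes "fst l \<in> S" "reduced w" shows "word_val (cons_reduced l w) = letter l \<otimes> word_val w"
proof (cases "w \<noteq> [] \<and> hd w = flip l")
  case True
  then obtain v where w: "w = flip l # v" by (cases w) auto
  have "word_val v \<in> carrier G" "letter l \<in> carrier G"
    using assms w word_val_carrier letter_carrier by (auto simp: reduced_def)
  then show ?thesis
    unfolding w word_val_Cons letter_flip[OF assms(1)] by (simp add: cons_reduced_def m_assoc[symmetric])
next
  case False
  then show ?thesis unfolding cons_reduced_def using word_val_Cons by presburger
qed

lemma ex_word: assumes "g \<in> carrier G" shows "\<exists>w. reduced w \<and> word_val w = g"
proof -
  have "g \<in> generate G S" using assms gen_S by simp
  then obtain ws where "set (map fst ws) \<subseteq> S" "word_val ws = g"
  proof (induction arbitrary: thesis rule: generate.induct)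
    case one
    show ?case by (rule one[of "[]"]) auto
  next
    case (incl h)
    then show ?case using incl(2)[of "[(h,True)]"] S_carrier by auto
  next
    case (inv h)
    then show ?case using inv(2)[of "[(h,False)]"] S_carrier by auto
  next
    case (eng h1 h2)
    obtain u v where uv: "set (map fst u) \<subseteq> S" "word_val u = h1" "set (map fst v) \<subseteq> S" "word_val v = h2"
      using eng.IH by metis
    have "word_val (u @ v) = word_val u \<otimes> word_val v" if "set (map fst u) \<subseteq> S" "set (map fst v) \<subseteq> S" for u v
      using that
    proof (induction u)
      case Nil
      then show ?case using word_val_carrier[of v] by auto
    next
      case (Cons l u)
      then show ?case
        using word_val_carrier[of v] word_val_carrier[of u] letter_carrier[of l] m_assoc[of "letter l" "word_val u" "word_val v"]
        by (auto simp: letter_def)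
    qed
    then show ?case using uv eng.prems[of "u @ v"] by auto
  qed
  then show ?thesis
  proof (induction ws arbitrary: g)
    case Nil
    then show ?case by (auto intro!: exI[of _ "[]"])
  next
    case (Cons l ws)
    then obtain w where "reduced w" "word_val w = word_val ws" by auto
    then show ?case using Cons.prems reduced_cons_reduced[of l w] word_val_cons_reduced[of l w] word_val_Cons[of l ws]
      by (intro exI[of _ "cons_reduced l w"]) auto
  qed
qed

definition nf :: "'a \<Rightarrow> ('a \<times> bool) list" where
  "nf g = (THE w. reduced w \<and> word_val w = g)"

lemma nf: assumes "g \<in> carrier G" shows "reduced (nf g)" "word_val (nf g) = g"
proof -
  have "\<exists>!w. reduced w \<and> word_val w = g" using ex_word[OF assms] word_val_inj by blast
  from theI'[OF this] show "reduced (nf g)" "word_val (nf g) = g" unfolding nf_def by auto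
qed

lemma nf_eqI: "\<lbrakk>reduced w; word_val w = g\<rbrakk> \<Longrightarrow> nf g = w"
  unfolding nf_def by (rule the_equality) (auto intro: word_val_inj)

lemma nf_one [simp]: "nf \<one> = []"
  by (rule nf_eqI) auto

lemma nf_mult: "\<lbrakk>fst l \<in> S; g \<in> carrier G\<rbrakk> \<Longrightarrow> nf (letter l \<otimes> g) = cons_reduced l (nf g)"
  using nf[of g] by (intro nf_eqI) (auto simp: reduced_cons_reduced word_val_cons_reduced)

lemma nf_letter: "fst l \<in> S \<Longrightarrow> nf (letter l) = [l]"
  using letter_carrier[of l] by (intro nf_eqI) (auto simp: reduced_Cons letter_def)

lemma letter_inj: "\<lbrakk>fst l \<in> S; fst l' \<in> S; letter l = letter l'\<rbrakk> \<Longrightarrow> l = l'"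
  by (metis nf_letter list.inject)

section \<open>Letters and first letters as group elements\<close>

definition Lt :: "'a set" where "Lt = S \<union> (\<lambda>s. inv s) ` S"

lemma Lt_iff: "x \<in> Lt \<longleftrightarrow> (\<exists>l. fst l \<in> S \<and> x = letter l)"
proof
  assume "x \<in> Lt"
  then consider "x \<in> S" | s where "s \<in> S" "x = inv s" by (auto simp: Lt_def)
  then show "\<exists>l. fst l \<in> S \<and> x = letter l"
  proof cases
    case 1
    then show ?thesis by (intro exI[of _ "(x,True)"]) (auto simp: letter_def)
  next
    case 2
    then show ?thesis by (intro exI[of _ "(s,False)"]) (auto simp: letter_def)
  qed
qed (auto simp: Lt_def letter_def)

lemma Lt_carrier [simp]: "x \<in> Lt \<Longrightarrow> x \<in> carrier G"
  using S_carrier by (auto simp: Lt_def)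

lemma Lt_inv [simp]: "x \<in> Lt \<Longrightarrow> inv x \<in> Lt"
  using S_carrier by (auto simp: Lt_def image_iff subset_iff)

lemma S_Lt: "x \<in> S \<Longrightarrow> x \<in> Lt"
  by (auto simp: Lt_def)

lemma Lt_neq_one: "x \<in> Lt \<Longrightarrow> x \<noteq> \<one>"
  using nf_letter nf_one unfolding Lt_iff by (metis list.distinct(1))

text \<open>The default \<open>\<one>\<close> is not a letter, so a condition such as
  \<open>head g \<noteq> inv x\<close> (no cancellation) holds automatically for the
  identity.\<close>

definition head :: "'a \<Rightarrow> 'a" where
  "head g = (if nf g = [] then \<one> else letter (hd (nf g)))"

lemma nf_eq_Nil: "g \<in> carrier G \<Longrightarrow> nf g = [] \<longleftrightarrow> g = \<one>"
  using nf[of g] by auto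

lemma head_one [simp]: "head \<one> = \<one>"
  by (simp add: head_def)

lemma head_Lt: "\<lbrakk>g \<in> carrier G; g \<noteq> \<one>\<rbrakk> \<Longrightarrow> head g \<in> Lt"
  using nf(1)[of g] nf_eq_Nil[of g] by (cases "nf g") (auto simp: head_def Lt_iff reduced_Cons)

lemma head_carrier [simp]: "g \<in> carrier G \<Longrightarrow> head g \<in> carrier G"
  by (cases "g = \<one>") (auto simp: head_Lt)

text \<open>If the leading \<open>inv x\<close> of \<open>g\<close> cancels, the next letter cannot
  be \<open>x\<close>, because the normal form of \<open>g\<close> is reduced.\<close>

lemma head_mult:
  assumes "x \<in> Lt" "g \<in> carrier G"
  shows "head (x \<otimes> g) = x \<longleftrightarrow> head g \<noteq> inv x"
proof -
  obtain l where l: "fst l \<in> S" "x = letter l" using assms(1) unfolding Lt_iff by blast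
  have n: "nf (x \<otimes> g) = cons_reduced l (nf g)" using l nf_mult assms by simp
  have one: "\<one> \<noteq> inv x" "\<one> \<noteq> x" using Lt_neq_one[OF Lt_inv[OF assms(1)]] Lt_neq_one[OF assms(1)] by metis+
  show ?thesis
  proof (cases "nf g")
    case Nil
    then show ?thesis using n l one by (auto simp: head_def cons_reduced_def)
  next
    case (Cons l' w)
    then have rw': "fst l' \<in> S" "reduced w" "w \<noteq> [] \<longrightarrow> hd w \<noteq> flip l'"
      using nf(1)[OF assms(2)] by (auto simp: reduced_Cons)
    have hg: "head g = letter l'" using Cons by (simp add: head_def)
    have hi: "head g = inv x \<longleftrightarrow> l' = flip l"
      using hg l letter_flip[of l] letter_inj[of l' "flip l"] rw' by auto
    show ?thesis
    proof (cases "l' = flip l")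
      case False
      then show ?thesis using hi n Cons l by (simp add: cons_reduced_def head_def)
    next
      case True
      then have "nf (x \<otimes> g) = w" using n Cons by (simp add: cons_reduced_def)
      moreover have "w \<noteq> [] \<Longrightarrow> letter (hd w) \<noteq> x"
        using rw' True l letter_inj[of "hd w" l] by (cases w) (auto simp: reduced_Cons)
      ultimately show ?thesis using hi True one by (auto simp: head_def)
    qed
  qed
qed

lemma head_letter: "x \<in> Lt \<Longrightarrow> head x = x"
  using head_mult[of x \<one>] Lt_neq_one[OF Lt_inv, of x] by (metis Lt_carrier head_one one_closed r_one)

lemma Lt_neq_inv: "x \<in> Lt \<Longrightarrow> inv x \<noteq> x"
  unfolding Lt_iff by (metis flip_neq fst_flip letter_flip letter_inj)

definition len :: "'a \<Rightarrow> nat" where "len g = length (nf g)"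

lemma len_mult:
  assumes "x \<in> Lt" "g \<in> carrier G" "head g \<noteq> inv x"
  shows "len (x \<otimes> g) = Suc (len g)"
proof -
  obtain l where l: "fst l \<in> S" "x = letter l" using assms(1) unfolding Lt_iff by blast
  have "\<not> (nf g \<noteq> [] \<and> hd (nf g) = flip l)"
    using assms(3) l letter_flip[of l] by (auto simp: head_def)
  then have "cons_reduced l (nf g) = l # nf g" by (auto simp: cons_reduced_def)
  then show ?thesis using l nf_mult[of l g] assms by (simp add: len_def)
qed

lemma head_decomp:
  assumes "g \<in> carrier G" "g \<noteq> \<one>"
  obtains h where "h \<in> carrier G" "g = head g \<otimes> h" "head h \<noteq> inv (head g)" "len g = Suc (len h)"
proof -
  have L: "head g \<in> Lt" using assms head_Lt by simp
  define h where "h = inv (head g) \<otimes> g"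
  have h: "h \<in> carrier G" "head g \<otimes> h = g"
    using assms L by (auto simp: h_def m_assoc[symmetric])
  then have "head h \<noteq> inv (head g)" using head_mult[OF L h(1)] by simp
  then show thesis using that[of h] h len_mult[OF L h(1)] by simp
qed

lemma word_induct [consumes 1, case_names one mult]:
  assumes "g \<in> carrier G" and "P \<one>"
    and step: "\<And>x h. \<lbrakk>x \<in> Lt; h \<in> carrier G; head h \<noteq> inv x; P h\<rbrakk> \<Longrightarrow> P (x \<otimes> h)"
  shows "P g"
  using assms(1)
proof (induction "len g" arbitrary: g rule: less_induct)
  case less
  show ?case
  proof (cases "g = \<one>")
    case False
    then obtain h where "h \<in> carrier G" "g = head g \<otimes> h" "head h \<noteq> inv (head g)" "len g = Suc (len h)"
      using less.prems head_decomp by blast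
    then show ?thesis using less step[of "head g" h] head_Lt[of g] False by auto
  qed (use assms in auto)
qed

lemma hom_ext:
  assumes f: "f \<one> = (0::int)" and m: "\<And>x h. \<lbrakk>x \<in> Lt; h \<in> carrier G\<rbrakk> \<Longrightarrow> f (x \<otimes> h) = c x + f h"
    and g: "g \<in> carrier G" and h: "h \<in> carrier G"
  shows "f (g \<otimes> h) = f g + f h"
  using g
proof (induction rule: word_induct)
  case one
  then show ?case using f h by simp
next
  case (mult x g)
  then show ?case using m[of x "g \<otimes> h"] m[of x g] h by (simp add: m_assoc)
qed

text \<open>Each leading \<open>c\<close> that is stripped shortens the word, so this must
  stop.\<close>

lemma not_always_letter:
  assumes c: "c \<in> Lt"
  shows "u \<in> carrier G \<Longrightarrow> \<exists>i::nat. head (inv c [^] i \<otimes> u) \<noteq> c"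
proof (induction "len u" arbitrary: u rule: less_induct)
  case less
  have cc: "c \<in> carrier G" using c by simp
  show ?case
  proof (cases "head u = c")
    case False
    then show ?thesis using less.prems by (intro exI[of _ 0]) simp
  next
    case True
    then have "u \<noteq> \<one>" using Lt_neq_one[OF c] by auto
    then obtain h where h: "h \<in> carrier G" "u = c \<otimes> h" "len u = Suc (len h)"
      using head_decomp[OF less.prems] True by metis
    then obtain i :: nat where i: "head (inv c [^] i \<otimes> h) \<noteq> c" using less.hyps[of h] by auto
    have "inv c [^] Suc i \<otimes> u = inv c [^] i \<otimes> h"
      using h cc by (simp add: m_assoc m_assoc[symmetric, of "inv c" c h])
    then show ?thesis using i by (intro exI[of _ "Suc i"]) simp
  qed
qed

text \<open>The exponent sum of a generator is computed on normal forms, so no universal property is needed.\<close>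

lemma ex_exponent_sum:
  assumes "s \<in> S"
  obtains \<sigma> :: "'a \<Rightarrow> int" where "\<sigma> s = 1"
    "\<And>g h. \<lbrakk>g \<in> carrier G; h \<in> carrier G\<rbrakk> \<Longrightarrow> \<sigma> (g \<otimes> h) = \<sigma> g + \<sigma> h"
proof -
  define c where "c l = (if fst l = s then if snd l then 1 else -1 else (0::int))" for l :: "'a \<times> bool"
  define f where "f g = sum_list (map c (nf g))" for g
  have fl: "c (flip l) = - c l" for l by (simp add: c_def flip_def)
  have cons_reduced: "sum_list (map c (cons_reduced l w)) = c l + sum_list (map c w)" for l w
    using fl[of l] by (cases w) (auto simp: cons_reduced_def)
  have m: "f (x \<otimes> h) = f x + f h" if x: "x \<in> Lt" and h: "h \<in> carrier G" for x h
  proof -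
    obtain l where l: "fst l \<in> S" "x = letter l" using x unfolding Lt_iff by blast
    then show ?thesis
      using nf_letter[OF l(1)] nf_mult[OF l(1) h] cons_reduced[of l "nf h"] by (simp add: f_def)
  qed
  have "letter (s, True) = s" by (simp add: letter_def)
  then have "f s = 1" using nf_letter[of "(s,True)"] assms by (simp add: f_def c_def)
  moreover have "f \<one> = 0" by (simp add: f_def)
  ultimately show thesis using that[of f] hom_ext[of f f] m by blast
qed

lemma countable_carrier: "finite S \<Longrightarrow> countable (carrier G)"
proof -
  assume "finite S"
  then have "countable (lists (S \<times> (UNIV :: bool set)))"
    by (intro countable_lists countable_SIGMA) (auto intro: countable_finite)
  moreover have "carrier G \<subseteq> word_val ` lists (S \<times> UNIV)"
  proof
    fix g assume "g \<in> carrier G"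
    then show "g \<in> word_val ` lists (S \<times> UNIV)"
      using nf[of g] by (intro image_eqI[of _ _ "nf g"]) (auto simp: reduced_def)
  qed
  ultimately show ?thesis by (meson countable_image countable_subset)
qed

lemma finite_Lt: "finite S \<Longrightarrow> finite Lt"
  by (simp add: Lt_def)

lemma two_generators:
  assumes "\<not> comm_group G"
  obtains a b where "a \<in> S" "b \<in> S" "a \<noteq> b"
proof (rule ccontr)
  assume "\<not> thesis"
  then have *: "\<And>a b. \<lbrakk>a \<in> S; b \<in> S\<rbrakk> \<Longrightarrow> a = b" using that by blast
  have "\<exists>c\<in>carrier G. S \<subseteq> {c}"
  proof (cases "S = {}")
    case False
    then obtain c where "c \<in> S" by blast
    then show ?thesis using * S_carrier by blast
  qed auto
  then obtain c where c: "c \<in> carrier G" "S \<subseteq> {c}" by blast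
  have "carrier G \<subseteq> generate G {c}"
    using mono_generate[OF c(2)] gen_S by simp
  then have p: "\<And>g. g \<in> carrier G \<Longrightarrow> \<exists>k::int. g = c [^] k"
    unfolding generate_pow[OF c(1)] by auto
  have "comm_group G"
  proof (rule group_comm_groupI)
    fix x y assume "x \<in> carrier G" "y \<in> carrier G"
    then obtain i j :: int where "x = c [^] i" "y = c [^] j" using p by metis
    then show "x \<otimes> y = y \<otimes> x"
      using c int_pow_mult[of c i j] int_pow_mult[of c j i] by (simp add: add.commute)
  qed
  then show False using assms by simp
qed

end

section \<open>Directions in the Cayley tree\<close>

text \<open>The residue of a 2-adic integer, given by its binary digits, modulo \<open>2 ^ j\<close>.\<close>

definition kap :: "nat \<Rightarrow> (nat \<Rightarrow> bool) \<Rightarrow> int" where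
  "kap j w = (\<Sum>i<j. of_bool (w i) * 2 ^ i)"

lemma kap_0 [simp]: "kap 0 w = 0"
  and kap_Suc: "kap (Suc j) w = kap j w + of_bool (w j) * 2 ^ j"
  by (simp_all add: kap_def)

lemma kap_dvd: "j \<le> k \<Longrightarrow> 2 ^ j dvd kap k w - kap j w"
proof (induction k rule: dec_induct)
  case (step k)
  have "kap (Suc k) w - kap j w = (kap k w - kap j w) + of_bool (w k) * 2 ^ k"
    by (simp add: kap_Suc)
  moreover have "2 ^ j dvd of_bool (w k) * (2::int) ^ k"
    using step le_imp_power_dvd[of j k "2::int"] by simp
  ultimately show ?case using step.IH by (simp only: dvd_add)
qed simp

lemma kap_dvd_mono:
  assumes "j \<le> k" "2 ^ k dvd kap k w - s" shows "2 ^ j dvd kap j w - s"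
proof -
  have "2 ^ j dvd kap k w - s" using assms le_imp_power_dvd dvd_trans by blast
  then have "2 ^ j dvd (kap k w - s) - (kap k w - kap j w)" by (rule dvd_diff[OF _ kap_dvd[OF assms(1)]])
  then show ?thesis by simp
qed

lemma kap_bounds: "0 \<le> kap j w \<and> kap j w < 2 ^ j"
  by (induction j) (auto simp: kap_Suc of_bool_def)

text \<open>Abstract form of the following fact about trees: among finitely many pairwise disjoint subtrees
  (the classes of \<open>sim\<close>) there is one such that all others look at it in the same direction as at \<open>D\<close>.\<close>

lemma ex_closest:
  assumes W: "finite W" "W \<noteq> {}" "W \<subseteq> C" and D: "D \<in> A"
    and dA: "\<And>g. g \<in> C \<Longrightarrow> d g \<in> A"
    and refl: "\<And>g. g \<in> C \<Longrightarrow> sim g g"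
    and cong: "\<And>g h w. \<lbrakk>g \<in> C; h \<in> C; w \<in> C; sim h g; \<not> sim w g\<rbrakk> \<Longrightarrow> f (d h) w = f (d g) w"
    and sep: "\<And>D g h. \<lbrakk>D \<in> A; g \<in> C; h \<in> C; \<not> sim h g\<rbrakk> \<Longrightarrow> f D g = f (d h) g \<or> f D h = f (d g) h"
  shows "\<exists>g\<in>W. \<forall>h\<in>W. \<not> sim h g \<longrightarrow> f D h = f (d g) h"
  using W
proof (induction rule: finite_ne_induct)
  case (singleton x)
  then show ?case using refl by auto
next
  case (insert w W)
  then obtain g where g: "g \<in> W" "\<And>h. \<lbrakk>h \<in> W; \<not> sim h g\<rbrakk> \<Longrightarrow> f D h = f (d g) h" by auto
  have car: "w \<in> C" "g \<in> C" using insert g by auto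
  show ?case
  proof (cases "sim w g \<or> f D w = f (d g) w")
    case True
    then show ?thesis using g by (intro bexI[of _ g]) auto
  next
    case False
    \<comment> \<open>As \<open>D\<close> does not look at \<open>w\<close> the way \<open>g\<close>
      does, \<open>w\<close> takes over the role of \<open>g\<close>. Either \<open>sep\<close>
      applies to \<open>D\<close> directly, or \<open>D\<close> and \<open>d h\<close> agree at
      \<open>w\<close>; then \<open>cong\<close> separates \<open>h\<close> from \<open>g\<close>,
      and \<open>sep\<close> is applied to \<open>d g\<close> in place of \<open>D\<close>.\<close>
    have "f D h = f (d w) h" if h: "h \<in> W" and hw: "\<not> sim h w" for h
    proof (cases "f D w = f (d h) w")
      case True
      have hc: "h \<in> C" using insert.prems h by auto
      have "\<not> sim h g" using cong[OF car(2) hc car(1)] False True by auto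
      then show ?thesis using sep[OF dA[OF car(2)] car(1) hc hw] g(2)[OF h] False True by auto
    next
      case False
      then show ?thesis using sep[OF D car(1) _ hw] insert.prems h by auto
    qed
    then show ?thesis using refl car by (intro bexI[of _ w]) auto
  qed
qed

locale free_grp2 = free_grp G S for G (structure) and S +
  fixes a b :: 'a and \<sigma> :: "'a \<Rightarrow> int"
  assumes finS: "finite S" and aS: "a \<in> S" and bS: "b \<in> S" and ab: "a \<noteq> b"
    and \<sigma>_a: "\<sigma> a = 1"
    and \<sigma>_mult: "\<And>g h. \<lbrakk>g \<in> carrier G; h \<in> carrier G\<rbrakk> \<Longrightarrow> \<sigma> (g \<otimes> h) = \<sigma> g + \<sigma> h"
begin

lemma a_Lt [simp]: "a \<in> Lt" and b_Lt [simp]: "b \<in> Lt"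
  and a_car [simp]: "a \<in> carrier G" and b_car [simp]: "b \<in> carrier G"
  using aS bS S_Lt Lt_carrier by auto

lemma b_neq_inv_a: "b \<noteq> inv a"
  using letter_inj[of "(b,True)" "(a,False)"] aS bS by (auto simp: letter_def)

lemma \<sigma>_one [simp]: "\<sigma> \<one> = 0"
  using \<sigma>_mult[of \<one> \<one>] by simp

lemma \<sigma>_inv: "g \<in> carrier G \<Longrightarrow> \<sigma> (inv g) = - \<sigma> g"
  using \<sigma>_mult[of g "inv g"] by simp

abbreviation ap :: "int \<Rightarrow> 'a" where "ap i \<equiv> a [^] i"

lemma ap_add: "ap (i + j) = ap i \<otimes> ap j"
  by (simp add: int_pow_mult)

lemma ap_m1: "ap (-1) = inv a"
  by (simp add: int_pow_neg)

lemma \<sigma>_ap: "\<sigma> (ap i) = i"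
proof (induction i rule: int_induct[where k = 0])
  case (step1 i)
  then show ?case using \<sigma>_mult[of "ap i" a] ap_add[of i 1] \<sigma>_a by simp
next
  case (step2 i)
  then show ?case using \<sigma>_mult[of "ap i" "inv a"] ap_add[of i "-1"] \<sigma>_a \<sigma>_inv[of a]
    by (simp add: int_pow_neg)
qed simp

lemma mult_ap_assoc: "g \<in> carrier G \<Longrightarrow> g \<otimes> ap i \<otimes> ap j = g \<otimes> ap (i + j)"
  by (simp add: ap_add m_assoc)

lemma ap_a: "g \<in> carrier G \<Longrightarrow> g \<otimes> ap i \<otimes> a = g \<otimes> ap (i + 1)"
  using mult_ap_assoc[of g i 1] by simp

text \<open>Read \<open>D g\<close> as the direction in which the vertex \<open>g\<close> looks.  The rule says that of the two
  endpoints of an edge exactly one looks along it; its solutions are the ends of the tree and, with the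
  value \<open>\<one>\<close> at \<open>p\<close>, the functions \<open>dir p\<close> for the vertices \<open>p\<close>.\<close>

definition pointing :: "('a \<Rightarrow> 'a) \<Rightarrow> bool" where
  "pointing D \<longleftrightarrow> (\<forall>g\<in>carrier G. \<forall>l\<in>Lt. D (g \<otimes> l) = inv l \<longleftrightarrow> D g \<noteq> l)"

lemma pointingD: "\<lbrakk>pointing D; g \<in> carrier G; l \<in> Lt\<rbrakk> \<Longrightarrow> D (g \<otimes> l) = inv l \<longleftrightarrow> D g \<noteq> l"
  by (simp add: pointing_def)

definition dir :: "'a \<Rightarrow> 'a \<Rightarrow> 'a" where
  "dir p g = head (inv g \<otimes> p)"

lemma pointing_dir: "p \<in> carrier G \<Longrightarrow> pointing (dir p)"
  unfolding pointing_def dir_def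
proof (intro ballI)
  fix g l assume "p \<in> carrier G" "g \<in> carrier G" "l \<in> Lt"
  then show "head (inv (g \<otimes> l) \<otimes> p) = inv l \<longleftrightarrow> head (inv g \<otimes> p) \<noteq> l"
    using head_mult[of "inv l" "inv g \<otimes> p"] by (simp add: inv_mult_group m_assoc)
qed

text \<open>If \<open>D\<close> does not look along the first edge of the path from \<open>g\<close>
  to \<open>g \<otimes> u\<close>, the other endpoint looks back; as the path does not backtrack,
  that endpoint does not look along the second edge either, and so on to the end of the
  path.\<close>

lemma pointing_propagate:
  assumes "u \<in> carrier G"
  shows "\<forall>D g. pointing D \<and> g \<in> carrier G \<and> u \<noteq> \<one> \<and> D g \<noteq> head u \<longrightarrow> D (g \<otimes> u) = head (inv u)"
  using assms
proof (induction rule: word_induct)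
  case (mult x v)
  show ?case
  proof (intro allI impI, elim conjE)
    fix D g
    assume D: "pointing D" and g: "g \<in> carrier G" and n: "D g \<noteq> head (x \<otimes> v)"
    have "head (x \<otimes> v) = x" using head_mult[of x v] mult by simp
    then have Dx: "D (g \<otimes> x) = inv x" using pointingD[OF D g mult(1)] n by simp
    show "D (g \<otimes> (x \<otimes> v)) = head (inv (x \<otimes> v))"
    proof (cases "v = \<one>")
      case True
      then show ?thesis using Dx mult(1) head_letter[of "inv x"] by simp
    next
      case False
      have x: "x \<in> carrier G" using mult by simp
      have "D (g \<otimes> x \<otimes> v) = head (inv v)"
        using mult.IH D g x False Dx mult(3) by auto
      \<comment> \<open>The induction hypothesis for \<open>dir (inv x)\<close> shows that
        \<open>v\<close> and \<open>x \<otimes> v\<close> end with the same letter, which identifies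
        the two heads of inverses.\<close>
      moreover have "dir (inv x) \<one> = inv x"
        using mult(1) head_letter[of "inv x"] by (simp add: dir_def)
      then have "dir (inv x) (\<one> \<otimes> v) = head (inv v)"
        using mult.IH[THEN spec, THEN spec, THEN mp, of "dir (inv x)" \<one>]
          pointing_dir[of "inv x"] False mult(3) x by auto
      ultimately show ?thesis
        using g x mult(2) by (simp add: dir_def m_assoc inv_mult_group)
    qed
  qed
qed simp

text \<open>Two vertices cannot both look away from each other.\<close>

lemma dir_sep:
  assumes "pointing D" "g \<in> carrier G" "h \<in> carrier G" "g \<noteq> h"
  shows "D g = dir h g \<or> D h = dir g h"
proof -
  let ?u = "inv g \<otimes> h"
  have "?u \<noteq> \<one>" using assms by (metis inv_closed inv_equality inv_inv)
  moreover have "g \<otimes> ?u = h" using assms by (simp add: m_assoc[symmetric])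
  moreover have "inv ?u = inv h \<otimes> g" using assms by (simp add: inv_mult_group)
  ultimately show ?thesis using pointing_propagate[of ?u] assms unfolding dir_def by fastforce
qed

text \<open>Crossing the edge from \<open>g\<close> to \<open>g \<otimes> l\<close> can change the
  view only at its endpoints: otherwise \<open>dir_sep\<close> makes \<open>dir h\<close> look along
  this edge from both ends.\<close>

lemma dir_step:
  assumes "g \<in> carrier G" "l \<in> Lt" "h \<in> carrier G" "h \<noteq> g" "h \<noteq> g \<otimes> l"
  shows "dir (g \<otimes> l) h = dir g h"
proof (rule ccontr)
  assume n: "dir (g \<otimes> l) h \<noteq> dir g h"
  have l: "l \<in> carrier G" using assms by simp
  have "dir (g \<otimes> l) g = l" using assms l by (simp add: dir_def m_assoc[symmetric] head_letter)
  then have 1: "dir h g = l"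
    using dir_sep[OF pointing_dir, of "g \<otimes> l" g h] n assms l by auto
  have "dir g (g \<otimes> l) = inv l"
    using assms l head_letter[of "inv l"] by (simp add: dir_def m_assoc inv_mult_group)
  then have "dir h (g \<otimes> l) = inv l"
    using dir_sep[OF pointing_dir, of g "g \<otimes> l" h] n assms l by auto
  then show False using pointingD[OF pointing_dir, of h g l] assms 1 by simp
qed

section \<open>Translates of the axis of \<open>a\<close>\<close>

definition line :: "'a \<Rightarrow> 'a set" where "line g = {g \<otimes> ap i | i. True}"

lemma line_self: "g \<in> carrier G \<Longrightarrow> g \<in> line g"
  unfolding line_def by (auto intro: exI[of _ 0])

lemma line_ap: "g \<in> carrier G \<Longrightarrow> h \<otimes> ap i \<in> line g \<longleftrightarrow> h \<in> line g" if "h \<in> carrier G"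
proof -
  have *: "h \<otimes> ap i \<in> line g" if "h \<in> line g" "g \<in> carrier G" for h i
    using that mult_ap_assoc[of g] by (auto simp: line_def)
  assume g: "g \<in> carrier G"
  have "h \<otimes> ap i \<otimes> ap (-i) = h" using that mult_ap_assoc[of h i "-i"] by simp
  then show ?thesis using *[OF _ g] by metis
qed

lemma line_sym:
  assumes "g \<in> carrier G" "h \<in> carrier G" shows "h \<in> line g \<longleftrightarrow> g \<in> line h"
proof -
  have "g \<in> line h" if gh: "h \<in> line g" "g \<in> carrier G" for g h
  proof -
    obtain i where "h = g \<otimes> ap i" using gh by (auto simp: line_def)
    then have "g = h \<otimes> ap (-i)" using gh mult_ap_assoc[of g i "-i"] by simp
    then show ?thesis unfolding line_def by blast
  qed
  then show ?thesis using assms by blast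
qed

lemma line_carrier: "g \<in> carrier G \<Longrightarrow> h \<in> line g \<Longrightarrow> h \<in> carrier G"
  by (auto simp: line_def)

text \<open>From a vertex off the line, the line is a connected set lying in a single direction;
  walk along it with \<open>dir_step\<close>.\<close>

lemma dir_line:
  assumes "g \<in> carrier G" "h \<in> carrier G" "h \<notin> line g"
  shows "dir (g \<otimes> ap i) h = dir g h"
proof (induction i rule: int_induct[where k = 0])
  case base
  then show ?case using assms by simp
next
  case (step1 i)
  have "h \<noteq> g \<otimes> ap i" "h \<noteq> g \<otimes> ap (i + 1)" using assms by (auto simp: line_def)
  then show ?case using dir_step[of "g \<otimes> ap i" a h] assms step1 by (simp add: ap_a)
next
  case (step2 i)
  have "h \<noteq> g \<otimes> ap i" "h \<noteq> g \<otimes> ap (i - 1)" using assms by (auto simp: line_def)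
  then show ?case using dir_step[of "g \<otimes> ap (i - 1)" a h] assms step2 by (simp add: ap_a)
qed

text \<open>The version of \<open>dir_sep\<close> for two disjoint lines, needed as the hypothesis
  \<open>sep\<close> of \<open>ex_closest\<close>: by \<open>dir_line\<close>, the directions from
  one line to the other may be computed with any of their vertices.\<close>

lemma line_sep:
  assumes D: "pointing D" and w: "w \<in> carrier G" and h: "h \<in> carrier G" and n: "h \<notin> line w"
    and i: "D (w \<otimes> ap i) \<noteq> dir h (w \<otimes> ap i)"
  shows "D (h \<otimes> ap j) = dir w (h \<otimes> ap j)"
proof -
  have n': "h \<otimes> ap j \<notin> line w" "w \<otimes> ap i \<notin> line h" "w \<notin> line h"
    using n line_ap line_sym w h by simp_all
  have "w \<otimes> ap i \<noteq> h \<otimes> ap j" using n' w by (auto simp: line_def)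
  moreover have "dir (h \<otimes> ap j) (w \<otimes> ap i) = dir h (w \<otimes> ap i)"
    using dir_line n' w h by simp
  moreover have "dir (w \<otimes> ap i) (h \<otimes> ap j) = dir w (h \<otimes> ap j)"
    using dir_line n' w h by simp
  ultimately show ?thesis using dir_sep[OF D, of "w \<otimes> ap i" "h \<otimes> ap j"] w h i by auto
qed

text \<open>The path from \<open>g\<close> leaves the axis through \<open>g\<close> at height \<open>m\<close>, or never leaves it upwards.\<close>

definition exits :: "('a \<Rightarrow> 'a) \<Rightarrow> 'a \<Rightarrow> int \<Rightarrow> bool" where
  "exits D g m \<longleftrightarrow> D (g \<otimes> ap (m - 1)) = a \<and> D (g \<otimes> ap m) \<noteq> a"

definition stays :: "('a \<Rightarrow> 'a) \<Rightarrow> 'a \<Rightarrow> bool" where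
  "stays D g \<longleftrightarrow> (\<forall>i\<ge>0. D (g \<otimes> ap i) = a)"

text \<open>A vertex that does not look up along the axis forces its upper neighbour to look down,
  by the edge rule.\<close>

lemma not_a_mono:
  assumes D: "pointing D" and g: "g \<in> carrier G" and "i \<le> j" "D (g \<otimes> ap i) \<noteq> a"
  shows "D (g \<otimes> ap j) \<noteq> a"
  using assms(3,4)
proof (induction j rule: int_ge_induct)
  case (step j)
  then have "D (g \<otimes> ap j \<otimes> a) = inv a" using pointingD[OF D, of "g \<otimes> ap j" a] g by simp
  then show ?case using Lt_neq_inv[of a] ap_a[OF g, of j] by simp
qed

lemma exits_unique: "\<lbrakk>pointing D; g \<in> carrier G; exits D g m; exits D g m'\<rbrakk> \<Longrightarrow> m = m'"
  using not_a_mono[of D g m "m' - 1"] not_a_mono[of D g m' "m - 1"] unfolding exits_def by force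

lemma exits_ap: "g \<in> carrier G \<Longrightarrow> exits D (g \<otimes> ap i) m \<longleftrightarrow> exits D g (i + m)"
  by (simp add: exits_def mult_ap_assoc algebra_simps)

lemma stays_ap:
  assumes "pointing D" "g \<in> carrier G" shows "stays D (g \<otimes> ap i) \<longleftrightarrow> stays D g"
proof -
  have *: "stays D (g \<otimes> ap i)" if "stays D g" "g \<in> carrier G" for g i
    unfolding stays_def
  proof (intro allI impI)
    fix j :: int assume "0 \<le> j"
    have "D (g \<otimes> ap (max 0 (i + j))) = a" using that by (simp add: stays_def)
    then show "D (g \<otimes> ap i \<otimes> ap j) = a"
      using not_a_mono[OF assms(1) that(2), of "i + j" "max 0 (i + j)"] that mult_ap_assoc by auto
  qed
  show ?thesis using *[of g i] *[of "g \<otimes> ap i" "-i"] assms(2) mult_ap_assoc[of g i "-i"] by auto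
qed

lemma exits_not_stays: "\<lbrakk>exits D g m; 0 \<le> m\<rbrakk> \<Longrightarrow> \<not> stays D g"
  by (auto simp: exits_def stays_def)

lemma inv_a_pow: "inv a [^] (n::nat) = ap (- int n)"
  by (simp add: int_pow_neg int_pow_int nat_pow_inv)

text \<open>The path to a vertex \<open>p\<close> is finite, so it cannot follow \<open>a\<close>
  forever.\<close>

lemma not_stays_dir:
  assumes "p \<in> carrier G" "g \<in> carrier G" shows "\<not> stays (dir p) g"
proof -
  obtain n :: nat where n: "head (inv a [^] n \<otimes> (inv g \<otimes> p)) \<noteq> a"
    using not_always_letter[of a "inv g \<otimes> p"] assms by auto
  have "inv (g \<otimes> ap (int n)) \<otimes> p = inv a [^] n \<otimes> (inv g \<otimes> p)"
    using assms by (simp add: inv_mult_group inv_a_pow int_pow_neg m_assoc)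
  then show ?thesis using n unfolding stays_def dir_def by (metis of_nat_0_le_iff)
qed

text \<open>Subtracting \<open>\<sigma> g\<close> makes the condition equivariant. The modulus
  \<open>2 ^ Suc j\<close> instead of \<open>2 ^ j\<close> is what later excludes two flags on one
  line.\<close>

definition flag :: "('a \<Rightarrow> 'a) \<Rightarrow> (nat \<Rightarrow> bool) \<Rightarrow> 'a \<Rightarrow> bool" where
  "flag D w g \<longleftrightarrow> (\<exists>j. exits D g (2 ^ j) \<and> 2 ^ Suc j dvd kap (Suc j) w - \<sigma> g)"

text \<open>The points of the orbit that is doubled; their flag is left free in the definition of \<open>flagged\<close>.\<close>

definition critical :: "('a \<Rightarrow> 'a) \<Rightarrow> (nat \<Rightarrow> bool) \<Rightarrow> 'a \<Rightarrow> bool" where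
  "critical D w g \<longleftrightarrow> stays D g \<and> (\<forall>j. 2 ^ j dvd kap j w - \<sigma> g)"

lemma flag_stays: "stays D g \<Longrightarrow> \<not> flag D w g"
  using exits_not_stays[of D g] by (force simp: flag_def)

text \<open>Since the view of \<open>h\<close> cannot follow the line of \<open>g\<close> upwards
  forever, \<open>D\<close> differs from it somewhere there. By \<open>line_sep\<close> the whole
  line of \<open>h\<close> then looks at the vertex \<open>g\<close>, so it cannot stay
  either.\<close>

lemma stays_same_line:
  assumes D: "pointing D" and g: "g \<in> carrier G" and h: "h \<in> carrier G" and "stays D g" "stays D h"
  shows "h \<in> line g"
proof (rule ccontr)
  assume n: "h \<notin> line g"
  have "\<not> stays (dir h) g" using not_stays_dir g h by simp
  then obtain i where "i \<ge> 0" "D (g \<otimes> ap i) \<noteq> dir h (g \<otimes> ap i)"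
    using assms(4) unfolding stays_def by metis
  then have "\<And>j. D (h \<otimes> ap j) = dir g (h \<otimes> ap j)" using line_sep[OF D g h n] by blast
  then have "stays (dir g) h" using assms(5) by (simp add: stays_def)
  then show False using not_stays_dir g h by simp
qed

lemma dvd_all_pow2: fixes x :: int assumes "\<And>j::nat. 2 ^ j dvd x" shows "x = 0"
proof (rule ccontr)
  assume "x \<noteq> 0"
  then have "2 ^ nat \<bar>x\<bar> \<le> \<bar>x\<bar>" using dvd_imp_le_int[OF _ assms] by force
  moreover have "\<bar>x\<bar> < 2 ^ nat \<bar>x\<bar>" using of_nat_less_two_power[of "nat \<bar>x\<bar>", where 'a = int] by simp
  ultimately show False by simp
qed

text \<open>The end determines the line and the 2-adic coordinate determines the height on it, as no
  nonzero integer is divisible by all powers of \<open>2\<close>.\<close>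

lemma critical_unique:
  assumes "pointing D" "g \<in> carrier G" "h \<in> carrier G" "critical D w g" "critical D w h"
  shows "g = h"
proof -
  have "h \<in> line g" using stays_same_line assms by (simp add: critical_def)
  then obtain i where i: "h = g \<otimes> ap i" by (auto simp: line_def)
  have "2 ^ j dvd \<sigma> h - \<sigma> g" for j
  proof -
    have "2 ^ j dvd (kap j w - \<sigma> g) - (kap j w - \<sigma> h)"
      using assms(4,5) unfolding critical_def by (blast intro: dvd_diff)
    then show ?thesis by simp
  qed
  then have "\<sigma> h - \<sigma> g = 0" by (rule dvd_all_pow2)
  then have "i = 0" using \<sigma>_mult[of g "ap i"] i \<sigma>_ap assms by simp
  then show ?thesis using i assms by simp
qed

text \<open>Functions are normalised outside the carrier, so that an end is a single function.\<close>

definition ends :: "('a \<Rightarrow> 'a) set" where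
  "ends = {y. (\<forall>g\<in>carrier G. y g \<in> Lt) \<and> pointing y \<and> (\<forall>g. g \<notin> carrier G \<longrightarrow> y g = \<one>)}"

type_synonym 'v config = "('v \<Rightarrow> 'v) \<times> (nat \<Rightarrow> bool) \<times> ('v \<Rightarrow> bool)"

text \<open>By \<open>critical_unique\<close> at most one flag is free, so exactly one or two points
  lie over each pair \<open>(y, w)\<close>.\<close>

definition flagged :: "'a config set" where
  "flagged = {(y, w, z). y \<in> ends \<and> (\<forall>g\<in>carrier G. \<not> critical y w g \<longrightarrow> z g = flag y w g) \<and>
     (\<forall>g. g \<notin> carrier G \<longrightarrow> \<not> z g)}"

text \<open>If the end leaves the line, the exit heights satisfy \<open>2 ^ j = i + 2 ^ k\<close>
  with \<open>k < j\<close>, while the two congruences give that \<open>2 ^ Suc k\<close> divides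
  \<open>i\<close>; so it would divide \<open>2 ^ k\<close>. If the end stays, both vertices are
  critical.\<close>

lemma flagged_line_unique_pos:
  assumes x: "(y, w, z) \<in> flagged" and g: "g \<in> carrier G" and z: "z g" "z (g \<otimes> ap i)" and i: "i > 0"
  shows False
proof -
  let ?h = "g \<otimes> ap i"
  have y: "pointing y" and h: "?h \<in> carrier G" using x g by (auto simp: flagged_def ends_def)
  have c: "critical y w k \<or> flag y w k" if "z k" "k \<in> carrier G" for k
    using x that by (auto simp: flagged_def)
  have sh: "\<sigma> ?h = \<sigma> g + i" using \<sigma>_mult \<sigma>_ap g by simp
  show False
  proof (cases "stays y g")
    case True
    then have "stays y ?h" using stays_ap y g by simp
    then have "critical y w g" "critical y w ?h" using c z g h True flag_stays by blast+
    then have "g = ?h" using critical_unique y g h by blast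
    then show False using sh i by simp
  next
    case False
    then have "\<not> stays y ?h" using stays_ap y g by simp
    then have "flag y w g" "flag y w ?h" using c z g h False unfolding critical_def by blast+
    then obtain j k where j: "exits y g (2 ^ j)" "2 ^ Suc j dvd kap (Suc j) w - \<sigma> g"
      and k: "exits y ?h (2 ^ k)" "2 ^ Suc k dvd kap (Suc k) w - \<sigma> ?h"
      unfolding flag_def by blast
    have e: "2 ^ j = i + 2 ^ k" using exits_unique[OF y g j(1)] k(1) exits_ap[OF g] by simp
    then have "(2::int) ^ k < 2 ^ j" using i by simp
    then have kj: "k < j" by simp
    have "2 ^ Suc k dvd kap (Suc k) w - \<sigma> g"
      by (rule kap_dvd_mono[OF _ j(2)]) (use kj in simp)
    then have "2 ^ Suc k dvd (kap (Suc k) w - \<sigma> g) - (kap (Suc k) w - \<sigma> ?h)"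
      using k(2) by (rule dvd_diff)
    then have "2 ^ Suc k dvd i" using sh by simp
    moreover have "2 ^ Suc k dvd (2::int) ^ j" using kj by (intro le_imp_power_dvd) simp
    ultimately have "2 ^ Suc k dvd (2::int) ^ k" using e by (metis add.commute dvd_add_left_iff)
    then show False by (simp add: dvd_imp_le)
  qed
qed

lemma flagged_line_unique:
  assumes x: "(y, w, z) \<in> flagged" and g: "g \<in> carrier G" and z: "z h" "z h'"
    and l: "h \<in> line g" "h' \<in> line g"
  shows "h = h'"
proof -
  have h: "h \<in> carrier G" "h' \<in> carrier G" using l g line_carrier by auto
  obtain i j where ij: "h = g \<otimes> ap i" "h' = g \<otimes> ap j" using l by (auto simp: line_def)
  then have "h' = h \<otimes> ap (j - i)" "h = h' \<otimes> ap (i - j)" using g by (simp_all add: mult_ap_assoc)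
  then have "\<not> j - i > 0" "\<not> i - j > 0" using flagged_line_unique_pos[OF x] z h by metis+
  then show ?thesis using ij by simp
qed

lemma closest_vertex:
  assumes "finite W" "W \<noteq> {}" "W \<subseteq> carrier G" "pointing D"
  shows "\<exists>g\<in>W. \<forall>h\<in>W. h \<noteq> g \<longrightarrow> D h = dir g h"
  using ex_closest[OF assms(1-3), where A = "Collect pointing" and sim = "(=)" and f = "\<lambda>D. D"]
    pointing_dir dir_sep assms(4) by auto

text \<open>Here \<open>ex_closest\<close> compares the whole sequence of directions along a line,
  and being on the same line plays the role of \<open>sim\<close>.\<close>

lemma closest_line:
  assumes "finite W" "W \<noteq> {}" "W \<subseteq> carrier G" "pointing D"
  shows "\<exists>g\<in>W. \<forall>h\<in>W. h \<notin> line g \<longrightarrow> (\<forall>i. D (h \<otimes> ap i) = dir g (h \<otimes> ap i))"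
proof -
  have "\<exists>g\<in>W. \<forall>h\<in>W. \<not> h \<in> line g \<longrightarrow> (\<lambda>i. D (h \<otimes> ap i)) = (\<lambda>i. dir g (h \<otimes> ap i))"
  proof (rule ex_closest[OF assms(1-3), where A = "Collect pointing"])
    fix g h w assume g: "g \<in> carrier G" and w: "w \<in> carrier G" "w \<notin> line g" and "h \<in> line g"
    then obtain k where "h = g \<otimes> ap k" by (auto simp: line_def)
    then show "(\<lambda>i. dir h (w \<otimes> ap i)) = (\<lambda>i. dir g (w \<otimes> ap i))"
      using dir_line[OF g, of "w \<otimes> ap _" k] line_ap g w by simp
  next
    fix D g h assume "D \<in> Collect pointing" "g \<in> carrier G" "h \<in> carrier G" "h \<notin> line g"
    then show "(\<lambda>i. D (g \<otimes> ap i)) = (\<lambda>i. dir h (g \<otimes> ap i)) \<or> (\<lambda>i. D (h \<otimes> ap i)) = (\<lambda>i. dir g (h \<otimes> ap i))"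
      using line_sep[of D g h] by (auto simp: fun_eq_iff)
  qed (use assms(4) pointing_dir line_self line_sym in auto)
  then show ?thesis by (simp add: fun_eq_iff)
qed

section \<open>Counting patterns\<close>

text \<open>The flag of \<open>h\<close> is raised on the 2-adic ball around
  \<open>\<sigma> h\<close> of modulus \<open>2 ^ Suc j\<close>. The condition says that this ball
  contains the ball of \<open>q\<close>; exit heights are those seen from \<open>g\<close>.\<close>

definition hits :: "'a \<Rightarrow> 'a \<Rightarrow> 'a \<Rightarrow> bool" where
  "hits g h q \<longleftrightarrow> (\<exists>j k. exits (dir g) h (2 ^ j) \<and> exits (dir g) q (2 ^ k) \<and> j \<le> k \<and> 2 ^ Suc j dvd \<sigma> q - \<sigma> h)"

text \<open>Decodes a pattern from at most three vertices: \<open>g\<close> spans the line closest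
  to the end, \<open>p\<close> is the only flagged vertex on that line, if any, and \<open>q\<close>
  has the smallest ball among the flagged vertices off it.\<close>

definition zdat :: "'a set \<Rightarrow> 'a \<times> 'a option \<times> 'a option \<Rightarrow> 'a set" where
  "zdat W = (\<lambda>(g, p, q). set_option p \<union> {h\<in>W. h \<notin> line g \<and> (\<exists>q'\<in>set_option q. hits g h q')})"

text \<open>Off the line closest to the end, the pattern is cut out by 2-adic balls, which are nested or
  disjoint; hence it is determined by the smallest ball that is hit.\<close>

lemma z_pattern:
  assumes x: "(y, w, z) \<in> flagged" and W: "finite W" "W \<noteq> {}" "W \<subseteq> carrier G"
  shows "{h\<in>W. z h} \<in> zdat W ` (W \<times> insert None (Some ` W) \<times> insert None (Some ` W))"
proof -
  have y: "pointing y" using x by (auto simp: flagged_def ends_def)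
  obtain g where g: "g \<in> W"
    "\<And>h i. \<lbrakk>h \<in> W; h \<notin> line g\<rbrakk> \<Longrightarrow> y (h \<otimes> ap i) = dir g (h \<otimes> ap i)"
    using closest_line[OF W y] by auto
  have gc: "g \<in> carrier G" using g W by auto
  have rd: "pointing (dir g)" using pointing_dir gc by simp
  have zf: "z h \<longleftrightarrow> (\<exists>j. exits (dir g) h (2 ^ j) \<and> 2 ^ Suc j dvd kap (Suc j) w - \<sigma> h)"
    if h: "h \<in> W" "h \<notin> line g" for h
  proof -
    have hc: "h \<in> carrier G" using h W by auto
    have "\<not> stays y h" using not_stays_dir[OF gc hc] g(2)[OF h] by (simp add: stays_def)
    then have "z h \<longleftrightarrow> flag y w h" using x hc by (auto simp: flagged_def critical_def)
    moreover have "exits y h = exits (dir g) h" using g(2)[OF h] by (auto simp: exits_def fun_eq_iff)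
    ultimately show ?thesis by (simp add: flag_def)
  qed
  define P where "P = {h\<in>W. z h \<and> h \<in> line g}"
  have "\<exists>p\<in>insert None (Some ` W). set_option p = P"
  proof (cases "P = {}")
    case False
    then obtain h where h: "h \<in> P" by auto
    then have "P = {h}" using flagged_line_unique[OF x gc] by (auto simp: P_def)
    then show ?thesis using h by (intro bexI[of _ "Some h"]) (auto simp: P_def)
  qed auto
  then obtain p where p: "p \<in> insert None (Some ` W)" "set_option p = P" by auto
  define Q where "Q = {h\<in>W. z h \<and> h \<notin> line g}"
  define c where "c h = (SOME j. exits (dir g) h (2 ^ j))" for h
  have cE: "c h = j" if "exits (dir g) h (2 ^ j)" "h \<in> W" for h j
  proof -
    have "exits (dir g) h (2 ^ c h)" unfolding c_def by (rule someI[of _ j]) (rule that)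
    moreover have "h \<in> carrier G" using that W by auto
    ultimately have "(2::int) ^ c h = 2 ^ j" using exits_unique[OF rd] that by blast
    then show ?thesis by simp
  qed
  have fin: "finite Q" using W by (simp add: Q_def)
  have "\<exists>q\<in>insert None (Some ` W). \<forall>h\<in>W. h \<notin> line g \<longrightarrow> (z h \<longleftrightarrow> (\<exists>q'\<in>set_option q. hits g h q'))"
  proof (cases "Q = {}")
    case True
    then show ?thesis by (intro bexI[of _ None]) (auto simp: Q_def)
  next
    case False
    \<comment> \<open>A larger exponent means a smaller ball, so the maximum picks the smallest of
      the balls that contain \<open>w\<close>.\<close>
    then have "Max (c ` Q) \<in> c ` Q" using fin by (intro Max_in) auto
    then obtain q where q: "q \<in> Q" "Max (c ` Q) = c q" by auto
    have qmax: "c h \<le> c q" if "h \<in> Q" for h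
      using Max_ge[of "c ` Q" "c h"] fin that q(2) by simp
    from q(1) have qW: "q \<in> W" "z q" "q \<notin> line g" by (auto simp: Q_def)
    then obtain k where k: "exits (dir g) q (2 ^ k)" "2 ^ Suc k dvd kap (Suc k) w - \<sigma> q"
      using zf[of q] by auto
    have cq: "c q = k" using cE k(1) qW(1) by simp
    have key: "2 ^ Suc j dvd kap (Suc j) w - \<sigma> q" if "j \<le> k" for j
      by (rule kap_dvd_mono[OF _ k(2)]) (use that in simp)
    have "z h \<longleftrightarrow> hits g h q"
      if h: "h \<in> W" "h \<notin> line g" for h
    proof
      assume zh: "z h"
      then obtain j where j: "exits (dir g) h (2 ^ j)" "2 ^ Suc j dvd kap (Suc j) w - \<sigma> h"
        using zf[OF h] by auto
      have jk: "j \<le> k" using qmax[of h] cE[OF j(1) h(1)] cq zh h by (simp add: Q_def)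
      have "2 ^ Suc j dvd (kap (Suc j) w - \<sigma> h) - (kap (Suc j) w - \<sigma> q)"
        using j(2) key[OF jk] by (rule dvd_diff)
      then show "hits g h q"
        using j(1) k(1) jk by (auto simp: hits_def)
    next
      assume "hits g h q"
      then obtain j k' where j: "exits (dir g) h (2 ^ j)" "exits (dir g) q (2 ^ k')" "j \<le> k'"
        "2 ^ Suc j dvd \<sigma> q - \<sigma> h" unfolding hits_def by blast
      then have "j \<le> k" using cE[of q k'] cq qW by simp
      then have "2 ^ Suc j dvd (kap (Suc j) w - \<sigma> q) + (\<sigma> q - \<sigma> h)"
        using key j(4) by (intro dvd_add) auto
      then show "z h" using zf[OF h] j(1) by auto
    qed
    then show ?thesis using qW by (intro bexI[of _ "Some q"]) auto
  qed
  then obtain q where q: "q \<in> insert None (Some ` W)"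
    "\<forall>h\<in>W. h \<notin> line g \<longrightarrow> (z h \<longleftrightarrow> (\<exists>q'\<in>set_option q. hits g h q'))"
    by (rule bexE)
  have "{h\<in>W. z h} = P \<union> {h\<in>W. h \<notin> line g \<and> z h}" by (auto simp: P_def)
  also have "{h\<in>W. h \<notin> line g \<and> z h} = {h\<in>W. h \<notin> line g \<and> (\<exists>q'\<in>set_option q. hits g h q')}"
    by (intro Collect_cong conj_cong refl) (rule q(2)[rule_format])
  finally have "{h\<in>W. z h} = zdat W (g, p, q)" using p(2) by (simp add: zdat_def)
  then show ?thesis using g(1) p(1) q(1) by (intro image_eqI[of _ _ "(g, p, q)"]) auto
qed

text \<open>All vertices of \<open>W\<close> other than the closest one \<open>g\<close> look
  towards \<open>g\<close>, so \<open>g\<close> and its own letter \<open>l\<close> determine the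
  pattern.\<close>

definition ydat :: "'a set \<Rightarrow> 'a \<times> 'a \<Rightarrow> 'a \<Rightarrow> 'a" where
  "ydat W = (\<lambda>(g, l). restrict (\<lambda>h. if h = g then l else dir g h) W)"

lemma y_pattern:
  assumes y: "y \<in> ends" and W: "finite W" "W \<noteq> {}" "W \<subseteq> carrier G"
  shows "restrict y W \<in> ydat W ` (W \<times> Lt)"
proof -
  obtain g where g: "g \<in> W" "\<forall>h\<in>W. h \<noteq> g \<longrightarrow> y h = dir g h"
    using closest_vertex[OF W, of y] y by (auto simp: ends_def)
  then have "restrict y W = ydat W (g, y g)" by (auto simp: ydat_def restrict_def)
  then show ?thesis using g y W by (intro image_eqI[of _ _ "(g, y g)"]) (auto simp: ends_def)
qed

text \<open>In the application the number \<open>J\<close> of digits stays fixed while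
  \<open>W\<close> grows, so the bound is a polynomial of degree four in
  \<open>card W\<close>.\<close>

lemma card_patterns:
  assumes W: "finite W" "W \<noteq> {}" "W \<subseteq> carrier G"
  defines "F \<equiv> \<lambda>J. (\<lambda>(y, w, z). (restrict y W, restrict w {..<J :: nat}, {h\<in>W. z h})) ` flagged"
  shows "finite (F J)" "card (F J) \<le> (card W * card Lt) * 2 ^ J * (card W * (Suc (card W) * Suc (card W)))"
proof -
  let ?O = "insert None (Some ` W)"
  let ?A = "ydat W ` (W \<times> Lt)" and ?B = "{..<J} \<rightarrow>\<^sub>E (UNIV :: bool set)"
    and ?C = "zdat W ` (W \<times> ?O \<times> ?O)"
  have "restrict w {..<J} \<in> {..<J} \<rightarrow>\<^sub>E UNIV" for w :: "nat \<Rightarrow> bool"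
    by (rule restrict_PiE_iff[THEN iffD2]) simp
  then have sub: "F J \<subseteq> ?A \<times> ?B \<times> ?C"
    using y_pattern[OF _ W] z_pattern[OF _ W] unfolding F_def
    by (force simp: flagged_def)
  have fin: "finite ?A" "finite ?B" "finite ?C"
    using W finite_Lt[OF finS] by (auto intro!: finite_PiE)
  then show "finite (F J)" using sub finite_subset by blast
  have cO: "card ?O \<le> Suc (card W)"
    using card_insert_le_m1 W(1) card_image_le[of W Some] by (simp add: card_insert_if)
  have A: "card ?A \<le> card W * card Lt"
    using card_image_le[of "W \<times> Lt" "ydat W"] W finite_Lt[OF finS] by (simp add: card_cartesian_product)
  have B: "card ?B = 2 ^ J" by (simp add: card_PiE)
  have "card ?C \<le> card (W \<times> ?O \<times> ?O)" using W by (intro card_image_le) auto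
  also have "\<dots> \<le> card W * (Suc (card W) * Suc (card W))"
    unfolding card_cartesian_product using cO by (intro mult_le_mono) auto
  finally have C: "card ?C \<le> card W * (Suc (card W) * Suc (card W))" .
  have "card (F J) \<le> card (?A \<times> ?B \<times> ?C)" using sub fin by (intro card_mono) auto
  also have "\<dots> = card ?A * (card ?B * card ?C)"
    unfolding card_cartesian_product by simp
  also have "\<dots> \<le> card W * card Lt * (2 ^ J * (card W * (Suc (card W) * Suc (card W))))"
    by (rule mult_le_mono[OF A mult_le_mono[OF eq_imp_le[OF B] C]])
  finally show "card (F J) \<le> (card W * card Lt) * 2 ^ J * (card W * (Suc (card W) * Suc (card W)))"
    by (simp only: mult.assoc)
qed

end

lemma kap_cong: "(\<And>i. i < j \<Longrightarrow> w i = w' i) \<Longrightarrow> kap j w = kap j w'"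
  unfolding kap_def by (intro sum.cong) auto

lemma kap_mod: "j \<le> k \<Longrightarrow> kap k w mod 2 ^ j = kap j w"
  using kap_dvd[of j k w] kap_bounds[of j w] by (metis mod_eq_dvd_iff mod_pos_pos_trivial)

lemma kap_eq_iff: "kap j w = kap j w' \<longleftrightarrow> (\<forall>i<j. w i = w' i)"
proof (induction j)
  case (Suc j)
  have *: "kap (Suc j) w = kap (Suc j) w' \<Longrightarrow> kap j w = kap j w'"
    using kap_mod[of j "Suc j"] by (metis le_SucI order_refl)
  show ?case
  proof
    assume e: "kap (Suc j) w = kap (Suc j) w'"
    then have "kap j w = kap j w'" by (rule *)
    moreover from this have "w j = w' j" using e by (auto simp: kap_Suc of_bool_def split: if_splits)
    ultimately show "\<forall>i<Suc j. w i = w' i" using Suc by (auto simp: less_Suc_eq)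
  qed (auto intro: kap_cong)
qed simp

lemma kap_inj: assumes "\<And>j. kap j w = kap j w'" shows "w = w'"
proof
  fix i
  have "kap (Suc i) w = kap (Suc i) w'" by (rule assms)
  then show "w i = w' i" unfolding kap_eq_iff by simp
qed

section \<open>The action on ends and 2-adic integers\<close>

text \<open>Addition of an integer in the 2-adic integers; the digit \<open>i\<close>, carries
  included, is read off the residue modulo \<open>2 ^ Suc i\<close>.\<close>

definition addK :: "int \<Rightarrow> (nat \<Rightarrow> bool) \<Rightarrow> nat \<Rightarrow> bool" where
  "addK n w i \<longleftrightarrow> odd ((kap (Suc i) w + n) div 2 ^ i)"

lemma kap_addK: "kap j (addK n w) = (kap j w + n) mod 2 ^ j"
proof (induction j)
  case (Suc j)
  define x where "x = kap (Suc j) w + n"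
  have "x mod 2 ^ j = (kap (Suc j) w mod 2 ^ j + n) mod 2 ^ j" by (simp add: x_def mod_add_left_eq)
  then have 1: "(kap j w + n) mod 2 ^ j = x mod 2 ^ j" by (simp add: kap_mod)
  have "x mod 2 ^ Suc j = 2 ^ j * (x div 2 ^ j mod 2) + x mod 2 ^ j"
    using mod_mult2_eq'[of x "2 ^ j" 2] zmod_zmult2_eq[of 2 x "2 ^ j"] by (simp add: mult.commute)
  moreover have "kap (Suc j) (addK n w) = x mod 2 ^ j + (x div 2 ^ j mod 2) * 2 ^ j"
    unfolding kap_Suc[of j "addK n w"] Suc 1 addK_def x_def of_bool_odd_eq_mod_2 ..
  ultimately show ?case by (simp add: x_def)
qed simp

lemma addK_0 [simp]: "addK 0 w = w"
  by (rule kap_inj) (use kap_bounds in \<open>simp add: kap_addK\<close>)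

lemma addK_addK: "addK m (addK n w) = addK (m + n) w"
  by (rule kap_inj) (simp add: kap_addK mod_add_left_eq add.assoc add.commute[of m])

lemma dvd_kap_addK: "2 ^ j dvd kap j (addK n w) - m \<longleftrightarrow> 2 ^ j dvd kap j w - (m - n)"
proof -
  have "2 ^ j dvd (kap j w + n) mod 2 ^ j - m \<longleftrightarrow> 2 ^ j dvd kap j w + n - m"
    by (metis mod_diff_left_eq mod_eq_0_iff_dvd)
  then show ?thesis by (simp add: kap_addK algebra_simps)
qed

context free_grp2
begin

definition shY :: "'a \<Rightarrow> ('a \<Rightarrow> 'a) \<Rightarrow> 'a \<Rightarrow> 'a" where
  "shY g y h = (if h \<in> carrier G then y (inv g \<otimes> h) else \<one>)"

definition shZ :: "'a \<Rightarrow> ('a \<Rightarrow> bool) \<Rightarrow> 'a \<Rightarrow> bool" where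
  "shZ g z h \<longleftrightarrow> h \<in> carrier G \<and> z (inv g \<otimes> h)"

lemma pointing_shY: "\<lbrakk>g \<in> carrier G; pointing y\<rbrakk> \<Longrightarrow> pointing (shY g y)"
  unfolding pointing_def by (simp add: shY_def m_assoc[symmetric])

lemma ends_shY: "\<lbrakk>g \<in> carrier G; y \<in> ends\<rbrakk> \<Longrightarrow> shY g y \<in> ends"
  unfolding ends_def by (auto simp: pointing_shY) (auto simp: shY_def)

lemma shY_one: "y \<in> ends \<Longrightarrow> shY \<one> y = y"
  by (auto simp: shY_def ends_def)

lemma shY_mult: "\<lbrakk>g \<in> carrier G; h \<in> carrier G\<rbrakk> \<Longrightarrow> shY (g \<otimes> h) y = shY g (shY h y)"
  by (rule ext) (simp add: shY_def inv_mult_group m_assoc)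

lemma shZ_mult: "\<lbrakk>g \<in> carrier G; h \<in> carrier G\<rbrakk> \<Longrightarrow> shZ (g \<otimes> h) z = shZ g (shZ h z)"
  by (rule ext) (auto simp: shZ_def inv_mult_group m_assoc)

lemma shY_ap: "\<lbrakk>g \<in> carrier G; h \<in> carrier G\<rbrakk> \<Longrightarrow> shY g y (h \<otimes> ap i) = y (inv g \<otimes> h \<otimes> ap i)"
  by (simp add: shY_def m_assoc)

lemma exits_shY: "\<lbrakk>g \<in> carrier G; h \<in> carrier G\<rbrakk> \<Longrightarrow> exits (shY g y) h m \<longleftrightarrow> exits y (inv g \<otimes> h) m"
  by (simp add: exits_def shY_ap)

lemma stays_shY: "\<lbrakk>g \<in> carrier G; h \<in> carrier G\<rbrakk> \<Longrightarrow> stays (shY g y) h \<longleftrightarrow> stays y (inv g \<otimes> h)"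
  by (simp add: stays_def shY_ap)

lemma \<sigma>_inv_mult: "\<lbrakk>g \<in> carrier G; h \<in> carrier G\<rbrakk> \<Longrightarrow> \<sigma> (inv g \<otimes> h) = \<sigma> h - \<sigma> g"
  by (simp add: \<sigma>_mult \<sigma>_inv)

text \<open>Translation by \<open>g\<close> changes the 2-adic coordinate and the exponent sum of
  the vertex by the same amount \<open>\<sigma> g\<close>, so their difference is preserved.\<close>

lemma flag_sh: "\<lbrakk>g \<in> carrier G; h \<in> carrier G\<rbrakk>
    \<Longrightarrow> flag (shY g y) (addK (\<sigma> g) w) h \<longleftrightarrow> flag y w (inv g \<otimes> h)"
  unfolding flag_def dvd_kap_addK by (simp add: exits_shY \<sigma>_inv_mult)

lemma critical_sh: "\<lbrakk>g \<in> carrier G; h \<in> carrier G\<rbrakk>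
    \<Longrightarrow> critical (shY g y) (addK (\<sigma> g) w) h \<longleftrightarrow> critical y w (inv g \<otimes> h)"
  unfolding critical_def dvd_kap_addK by (simp add: stays_shY \<sigma>_inv_mult)

definition shX :: "'a \<Rightarrow> 'a config
    \<Rightarrow> 'a config" where
  "shX g = (\<lambda>(y, w, z). (shY g y, addK (\<sigma> g) w, shZ g z))"

lemma flagged_shX: "\<lbrakk>g \<in> carrier G; x \<in> flagged\<rbrakk> \<Longrightarrow> shX g x \<in> flagged"
  by (auto simp: flagged_def shX_def ends_shY flag_sh critical_sh) (auto simp: shZ_def)

lemma shX_one: "x \<in> flagged \<Longrightarrow> shX \<one> x = x"
  by (cases x) (auto simp: flagged_def shX_def shY_one shZ_def fun_eq_iff, (metis l_one inv_one)+)

lemma shX_mult: "\<lbrakk>g \<in> carrier G; h \<in> carrier G\<rbrakk> \<Longrightarrow> shX (g \<otimes> h) x = shX g (shX h x)"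
  by (cases x) (simp add: shX_def shY_mult shZ_mult addK_addK \<sigma>_mult)

text \<open>A section of the map that forgets the flags; it lowers the flag at a critical vertex, by
  \<open>flag_stays\<close>.\<close>

definition sec :: "('a \<Rightarrow> 'a) \<Rightarrow> (nat \<Rightarrow> bool) \<Rightarrow> 'a config" where
  "sec y w = (y, w, \<lambda>g. g \<in> carrier G \<and> flag y w g)"

lemma sec_flagged: "y \<in> ends \<Longrightarrow> sec y w \<in> flagged"
  by (simp add: sec_def flagged_def)

lemma shX_sec: "g \<in> carrier G \<Longrightarrow> shX g (sec y w) = sec (shY g y) (addK (\<sigma> g) w)"
  by (auto simp: shX_def sec_def shZ_def flag_sh fun_eq_iff)

lemma regular_eq_sec:
  "\<lbrakk>(y, w, z) \<in> flagged; \<And>g. g \<in> carrier G \<Longrightarrow> \<not> critical y w g\<rbrakk> \<Longrightarrow> (y, w, z) = sec y w"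
  by (auto simp: flagged_def sec_def fun_eq_iff)

section \<open>Axes of letters, their ends and north-south dynamics\<close>

definition pw :: "'a \<Rightarrow> 'a set" where "pw c = {c [^] i | i :: int. True}"

lemma pw_carrier: "\<lbrakk>c \<in> carrier G; g \<in> pw c\<rbrakk> \<Longrightarrow> g \<in> carrier G"
  by (auto simp: pw_def)

lemma pw_mult: "\<lbrakk>c \<in> carrier G; g \<in> pw c; h \<in> pw c\<rbrakk> \<Longrightarrow> g \<otimes> h \<in> pw c"
  unfolding pw_def by (auto simp: int_pow_mult[symmetric])

lemma pw_inv: "\<lbrakk>c \<in> carrier G; g \<in> pw c\<rbrakk> \<Longrightarrow> inv g \<in> pw c"
  unfolding pw_def by (auto simp: int_pow_neg[symmetric])

lemma pw_one [simp]: "\<one> \<in> pw c"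
  unfolding pw_def using int_pow_0 by (metis (mono_tags, lifting) mem_Collect_eq)

lemma pw_self: "c \<in> carrier G \<Longrightarrow> c \<in> pw c"
  unfolding pw_def using int_pow_1 by (metis (mono_tags, lifting) mem_Collect_eq)

lemma pw_nat: "c \<in> carrier G \<Longrightarrow> c [^] (n :: nat) \<in> pw c"
  by (induction n) (auto intro: pw_mult pw_self)

lemma pw_mult_iff:
  assumes "c \<in> carrier G" "g \<in> pw c" "h \<in> carrier G"
  shows "g \<otimes> h \<in> pw c \<longleftrightarrow> h \<in> pw c" "h \<otimes> g \<in> pw c \<longleftrightarrow> h \<in> pw c"
proof -
  have g: "g \<in> carrier G" "inv g \<in> pw c" using assms pw_carrier pw_inv by auto
  have "inv g \<otimes> (g \<otimes> h) = h" "h \<otimes> g \<otimes> inv g = h"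
    using g assms by (simp_all add: m_assoc[symmetric]) (simp add: m_assoc)
  then show "g \<otimes> h \<in> pw c \<longleftrightarrow> h \<in> pw c" "h \<otimes> g \<in> pw c \<longleftrightarrow> h \<in> pw c"
    using pw_mult[OF assms(1)] g assms by metis+
qed

lemma head_pow: "c \<in> Lt \<Longrightarrow> head (c [^] Suc n) = c"
proof (induction n)
  case (Suc n)
  have "c [^] Suc (Suc n) = c \<otimes> c [^] Suc n" using Suc.prems by (metis Lt_carrier nat_pow_Suc2)
  then show ?case using Suc head_mult[of c "c [^] Suc n"] Lt_neq_inv[of c] by fastforce
qed (simp add: head_letter)

lemma head_pw:
  assumes "c \<in> Lt" "g \<in> pw c" shows "head g \<in> {c, inv c, \<one>}"
proof -
  obtain i :: int where i: "g = c [^] i" using assms by (auto simp: pw_def)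
  have c: "c \<in> carrier G" using assms by simp
  consider "i = 0" | n where "i = int (Suc n)" | n where "i = - int (Suc n)"
    by (metis int_cases nonneg_int_cases of_nat_0 old.nat.exhaust)
  then show ?thesis
  proof cases
    case 2
    then have "g = c [^] Suc n" using i int_pow_int by metis
    then show ?thesis using head_pow[OF assms(1)] by simp
  next
    case 3
    then have "g = inv c [^] Suc n" using i c int_pow_neg_int[of c "Suc n"] nat_pow_inv[of c] by metis
    then show ?thesis using head_pow[of "inv c"] assms(1) by simp
  qed (simp add: i)
qed

text \<open>The end \<open>c c c \<dots>\<close>: a vertex on the axis of \<open>c\<close> looks along it, any other one looks towards \<open>\<one>\<close>.\<close>

definition pole :: "'a \<Rightarrow> 'a \<Rightarrow> 'a" where
  "pole c g = (if g \<notin> carrier G then \<one> else if g \<in> pw c then c else head (inv g))"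

text \<open>Off the axis of \<open>c\<close> the edge rule is inherited from
  \<open>dir \<one>\<close>, so only the edges that touch the axis need an argument.\<close>

lemma pointing_pole: assumes c: "c \<in> Lt" shows "pointing (pole c)"
  unfolding pointing_def
proof (intro ballI)
  fix g l assume g: "g \<in> carrier G" and l: "l \<in> Lt"
  have cc: "c \<in> carrier G" and lc: "l \<in> carrier G" using c l by auto
  have inv2: "c = inv l \<longleftrightarrow> l = inv c" "inv c = inv l \<longleftrightarrow> l = c"
    using cc lc by (metis inv_inv)+
  have R: "head (inv (g \<otimes> l)) = inv l \<longleftrightarrow> head (inv g) \<noteq> l"
    using pointingD[OF pointing_dir[of \<one>], of g l] g l lc by (simp add: dir_def)
  have lpw: "l \<in> pw c \<longleftrightarrow> l = c \<or> l = inv c"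
    using head_pw[OF c, of l] head_letter[OF l] Lt_neq_one[OF l] pw_self[OF cc] pw_inv[OF cc] by auto
  have ci: "inv c \<noteq> c" using Lt_neq_inv c by simp
  show "pole c (g \<otimes> l) = inv l \<longleftrightarrow> pole c g \<noteq> l"
  proof (cases "g \<in> pw c")
    case True
    then have gl: "g \<otimes> l \<in> pw c \<longleftrightarrow> l \<in> pw c" using pw_mult_iff(1)[OF cc True lc] by simp
    show ?thesis
    proof (cases "l \<in> pw c")
      case True
      then show ?thesis using gl \<open>g \<in> pw c\<close> g lc ci lpw inv2 cc by (auto simp: pole_def)
    next
      case False
      have "head (inv g) \<in> {c, inv c, \<one>}" using head_pw[OF c] pw_inv[OF cc True] by blast
      then have "head (inv g) \<noteq> l" using False lpw Lt_neq_one[OF l] by auto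
      then show ?thesis using R gl \<open>g \<in> pw c\<close> g lc False lpw by (auto simp: pole_def)
    qed
  next
    case False
    show ?thesis
    proof (cases "g \<otimes> l \<in> pw c")
      case True
      have ln: "l \<notin> pw c" using pw_mult_iff(2)[OF cc _ g] True False by blast
      have "head (inv (g \<otimes> l)) \<in> {c, inv c, \<one>}" using head_pw[OF c] pw_inv[OF cc True] by blast
      then have "head (inv (g \<otimes> l)) \<noteq> inv l"
        using ln lpw inv2 Lt_neq_one[OF Lt_inv[OF l]] by auto
      then show ?thesis using R True False g lc ln lpw inv2 by (auto simp: pole_def)
    qed (use R False g lc in \<open>auto simp: pole_def\<close>)
  qed
qed

lemma pole_ends: assumes c: "c \<in> Lt" shows "pole c \<in> ends"
proof -
  have "pole c g \<in> Lt" if g: "g \<in> carrier G" for g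
  proof (cases "g \<in> pw c")
    case False
    then have "g \<noteq> \<one>" using pw_one by blast
    then have "inv g \<noteq> \<one>" using g by (metis inv_inv inv_one)
    then show ?thesis using False g head_Lt[of "inv g"] by (simp add: pole_def)
  qed (use c g in \<open>simp add: pole_def\<close>)
  then show ?thesis using pointing_pole[OF c] by (simp add: ends_def pole_def)
qed

lemma dir_pow_off:
  assumes c: "c \<in> Lt" and g: "g \<in> carrier G" "g \<notin> pw c"
  shows "dir (c [^] (n::nat)) g = head (inv g)"
proof (induction n)
  case (Suc n)
  have cc: "c \<in> carrier G" using c by simp
  have "g \<noteq> c [^] n" "g \<noteq> c [^] n \<otimes> c" using g pw_nat[OF cc, of n] pw_nat[OF cc, of "Suc n"] by auto
  then show ?case using dir_step[of "c [^] n" c g] c g Suc cc by simp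
qed (use g in \<open>simp add: dir_def\<close>)

text \<open>After finitely many steps the vertex \<open>c [^] n\<close> has passed the point where
  the path to \<open>g\<close> branches off the axis of \<open>c\<close>. From there on it sees
  \<open>g\<close> behind it, and \<open>g\<close> sees it in the direction of the end.\<close>

lemma contraction_core:
  assumes c: "c \<in> Lt" and g: "g \<in> carrier G"
  shows "\<exists>N. \<forall>n\<ge>N. head (inv c [^] (n::nat) \<otimes> g) = inv c \<and> dir (c [^] n) g = pole c g"
proof -
  have cc: "c \<in> carrier G" using c by simp
  have ci: "inv c \<noteq> c" using Lt_neq_inv c by simp
  obtain i :: nat where i: "head (inv c [^] i \<otimes> g) \<noteq> c" using not_always_letter[OF c g] by blast
  \<comment> \<open>Without a leading \<open>c\<close> the new factor \<open>inv c\<close> cannot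
    cancel; once it leads, it keeps leading.\<close>
  have step: "head (inv c [^] Suc n \<otimes> g) = inv c" if "head (inv c [^] n \<otimes> g) \<noteq> c" for n
  proof -
    have "inv c [^] Suc n \<otimes> g = inv c \<otimes> (inv c [^] n \<otimes> g)"
      using nat_pow_Suc2[of "inv c" n] cc g by (simp add: m_assoc)
    then show ?thesis using head_mult[of "inv c" "inv c [^] n \<otimes> g"] that c cc g by simp
  qed
  have H: "head (inv c [^] n \<otimes> g) = inv c" if "n \<ge> Suc i" for n
    using that
  proof (induction n rule: dec_induct)
    case (step n)
    then show ?case using \<open>\<And>n. head (inv c [^] n \<otimes> g) \<noteq> c \<Longrightarrow> _ n\<close> ci by metis
  qed (rule step[OF i])
  show ?thesis
  proof (cases "g \<in> pw c")
    case False
    then show ?thesis using H dir_pow_off[OF c g False] g by (intro exI[of _ "Suc i"]) (auto simp: pole_def)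
  next
    case True
    then obtain k :: int where k: "g = c [^] k" by (auto simp: pw_def)
    have "dir (c [^] n) g = c" if n: "n \<ge> Suc (nat k)" for n
    proof -
      have "int n - k > 0" using n by linarith
      then obtain m where m: "int n - k = int (Suc m)" by (metis gr0_conv_Suc zero_less_imp_eq_int)
      have "inv g \<otimes> c [^] n = c [^] (- k + int n)"
        using k cc int_pow_neg[of c k] int_pow_int[of G c n] int_pow_mult[of c "-k" "int n"] by simp
      also have "- k + int n = int (Suc m)" using m by simp
      finally have "inv g \<otimes> c [^] n = c [^] Suc m" using int_pow_int by metis
      then show ?thesis using head_pow[OF c] by (simp add: dir_def)
    qed
    then show ?thesis using H True g by (intro exI[of _ "max (Suc i) (Suc (nat k))"]) (auto simp: pole_def)
  qed
qed

text \<open>The bound \<open>N\<close> depends neither on \<open>D\<close> nor on \<open>x\<close>;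
  this uniformity allows \<open>x\<close> to be chosen after \<open>N\<close> in
  \<open>contraction\<close>.\<close>

lemma contraction_at:
  assumes c: "c \<in> Lt" and g: "g \<in> carrier G"
  shows "\<exists>N. \<forall>n\<ge>N. \<forall>D x. pointing D \<and> x \<in> carrier G \<and> D x \<noteq> inv c
    \<longrightarrow> D (x \<otimes> (inv c [^] (n::nat) \<otimes> g)) = pole c g"
proof -
  have cc: "c \<in> carrier G" using c by simp
  obtain N where N: "\<And>n. n \<ge> N \<Longrightarrow> head (inv c [^] (n::nat) \<otimes> g) = inv c \<and> dir (c [^] n) g = pole c g"
    using contraction_core[OF c g] by blast
  have "D (x \<otimes> (inv c [^] n \<otimes> g)) = pole c g"
    if n: "n \<ge> N" and D: "pointing D" "x \<in> carrier G" "D x \<noteq> inv c" for n D x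
  proof -
    let ?u = "inv c [^] n \<otimes> g"
    have u: "?u \<in> carrier G" using cc g by simp
    have u1: "?u \<noteq> \<one>" using N[OF n] Lt_neq_one[OF Lt_inv[OF c]] by (metis head_one)
    have "inv ?u = inv g \<otimes> c [^] n" using g cc by (simp add: inv_mult_group nat_pow_inv)
    then have "head (inv ?u) = pole c g" using N[OF n] by (simp add: dir_def)
    moreover have "D (x \<otimes> ?u) = head (inv ?u)"
      using pointing_propagate[OF u] D u1 N[OF n] by simp
    ultimately show ?thesis by simp
  qed
  then show ?thesis by blast
qed

lemma shY_pow: "\<lbrakk>c \<in> carrier G; g \<in> carrier G\<rbrakk> \<Longrightarrow> shY (c [^] (n::nat)) y g = y (inv c [^] n \<otimes> g)"
  by (simp add: shY_def nat_pow_inv)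

text \<open>An end other than the repelling one leaves the ray of \<open>inv c\<close> at some
  vertex, and \<open>contraction_at\<close> applies from that vertex on.\<close>

lemma contraction:
  assumes c: "c \<in> Lt" and y: "y \<in> ends" and ny: "y \<noteq> pole (inv c)" and g: "g \<in> carrier G"
  shows "\<exists>N. \<forall>n\<ge>N. shY (c [^] (n::nat)) y g = pole c g"
proof -
  have cc: "c \<in> carrier G" and yr: "pointing y" using c y by (auto simp: ends_def)
  have "\<exists>i::nat. y (inv c [^] i) \<noteq> inv c"
  proof (rule ccontr)
    assume "\<not> ?thesis"
    then have all: "y (inv c [^] i) = inv c" for i :: nat by simp
    have "y h = pole (inv c) h" for h
    proof (cases "h \<in> carrier G")
      case True
      obtain N where N: "\<And>n D x. \<lbrakk>n \<ge> N; pointing D; x \<in> carrier G; D x \<noteq> inv (inv c)\<rbrakk>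
          \<Longrightarrow> D (x \<otimes> (inv (inv c) [^] (n::nat) \<otimes> h)) = pole (inv c) h"
        using contraction_at[OF Lt_inv[OF c] True] by blast
      \<comment> \<open>If \<open>y\<close> follows \<open>inv c\<close> forever, then
        \<open>contraction_at\<close> for \<open>inv c\<close>, started at the far vertex
        \<open>inv c [^] N\<close>, determines \<open>y\<close> at every \<open>h\<close>.\<close>
      have "y (inv c [^] N \<otimes> (inv (inv c) [^] N \<otimes> h)) = pole (inv c) h"
        using N[of N y "inv c [^] N"] yr cc all[of N] Lt_neq_inv[OF c] by simp
      moreover have "inv c [^] N \<otimes> (inv (inv c) [^] N \<otimes> h) = h"
        using cc True by (simp add: m_assoc[symmetric] nat_pow_inv)
      ultimately show ?thesis by simp
    qed (use y in \<open>simp add: ends_def pole_def\<close>)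
    then show False using ny by auto
  qed
  then obtain i :: nat where i: "y (inv c [^] i) \<noteq> inv c" by blast
  obtain N where N: "\<And>n D x. \<lbrakk>n \<ge> N; pointing D; x \<in> carrier G; D x \<noteq> inv c\<rbrakk>
      \<Longrightarrow> D (x \<otimes> (inv c [^] (n::nat) \<otimes> g)) = pole c g"
    using contraction_at[OF c g] by blast
  have "shY (c [^] n) y g = pole c g" if n: "n \<ge> N + i" for n
  proof -
    have "inv c [^] i \<otimes> (inv c [^] (n - i) \<otimes> g) = inv c [^] n \<otimes> g"
      using cc g n nat_pow_mult[of "inv c" i "n - i"] by (simp add: m_assoc[symmetric])
    then show ?thesis using N[of "n - i" y "inv c [^] i"] n yr cc i g shY_pow by simp
  qed
  then show ?thesis by blast
qed

lemma shY_pole_inv: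
  assumes c: "c \<in> Lt" shows "shY (c [^] (n::nat)) (pole (inv c)) = pole (inv c)"
proof -
  have cc: "c \<in> carrier G" using c by simp
  have *: "shY c (pole (inv c)) = pole (inv c)"
  proof
    fix h
    show "shY c (pole (inv c)) h = pole (inv c) h"
    proof (cases "h \<in> carrier G")
      case h: True
      have iff: "inv c \<otimes> h \<in> pw (inv c) \<longleftrightarrow> h \<in> pw (inv c)"
        using pw_mult_iff(1)[of "inv c" "inv c" h] cc h pw_self by simp
      show ?thesis
      proof (cases "h \<in> pw (inv c)")
        case True
        then show ?thesis using iff h cc by (simp add: shY_def pole_def)
      next
        case False
        have "h \<noteq> \<one>" using False pw_one by blast
        moreover have "h \<noteq> c"
          using False pw_inv[of "inv c" "inv c"] pw_self[of "inv c"] cc by auto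
        ultimately have "dir (\<one> \<otimes> c) h = dir \<one> h" using dir_step[of \<one> c h] c h cc by simp
        then have "head (inv h \<otimes> c) = head (inv h)" using cc h by (simp add: dir_def)
        then show ?thesis using False iff h cc by (simp add: shY_def pole_def inv_mult_group)
      qed
    qed (simp add: shY_def pole_def)
  qed
  show ?thesis
  proof (induction n)
    case 0
    show ?case using shY_one pole_ends c by simp
  next
    case (Suc n)
    then show ?case using * shY_mult[of "c [^] n" c] cc by simp
  qed
qed

lemma pole_one: "pole c \<one> = c"
  by (simp add: pole_def)

lemma stays_pole_a: "stays (pole a) \<one>"
proof -
  have "ap i \<in> pw a" for i by (auto simp: pw_def)
  then show ?thesis by (simp add: stays_def pole_def)
qed

text \<open>On its axis this end shows \<open>b\<close>, so the letter \<open>a\<close> appears only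
  where it agrees with \<open>dir \<one>\<close>, and the path to \<open>\<one>\<close> is
  finite.\<close>

lemma not_stays_pole_b: assumes g: "g \<in> carrier G" shows "\<not> stays (pole b) g"
proof
  assume I: "stays (pole b) g"
  have "dir \<one> (g \<otimes> ap i) = a" if "i \<ge> 0" for i
  proof -
    have "pole b (g \<otimes> ap i) = a" using I that by (simp add: stays_def)
    then show ?thesis using ab g by (auto simp: pole_def dir_def split: if_splits)
  qed
  then have "stays (dir \<one>) g" by (simp add: stays_def)
  then show False using not_stays_dir[of \<one> g] g by simp
qed

section \<open>Density of an orbit in the boundary\<close>

text \<open>From \<open>g\<close>, the vertex \<open>h\<close> lies in another direction than the end \<open>y\<close>.\<close>

definition sees :: "('a \<Rightarrow> 'a) \<Rightarrow> 'a \<Rightarrow> 'a \<Rightarrow> bool" where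
  "sees y h g \<longleftrightarrow> h \<noteq> g \<and> y g \<noteq> dir h g"

text \<open>One step towards the end leaves behind every vertex already behind and the starting
  vertex itself.\<close>

lemma sees_move:
  assumes y: "y \<in> ends" and g: "g \<in> carrier G" and h: "h \<in> carrier G" and s: "sees y h g \<or> h = g"
  shows "sees y h (g \<otimes> y g)"
proof -
  have l: "y g \<in> Lt" "pointing y" using y g by (auto simp: ends_def)
  have 1: "y (g \<otimes> y g) \<noteq> inv (y g)" using pointingD[OF l(2) g l(1)] by simp
  show ?thesis
  proof (cases "h = g")
    case True
    have "dir g (g \<otimes> y g) = inv (y g)"
      using g l head_letter[of "inv (y g)"] by (simp add: dir_def inv_mult_group m_assoc)
    moreover have "g \<noteq> g \<otimes> y g"
      using g l Lt_neq_one[OF l(1)] by simp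
    ultimately show ?thesis using 1 True by (simp add: sees_def)
  next
    case False
    then have s: "y g \<noteq> dir h g" using assms by (simp add: sees_def)
    have "dir h (g \<otimes> y g) = inv (y g)" using pointingD[OF pointing_dir[OF h] g l(1)] s by simp
    moreover have "h \<noteq> g \<otimes> y g"
      using s g l head_letter[OF l(1)] by (auto simp: dir_def m_assoc[symmetric])
    ultimately show ?thesis using 1 by (simp add: sees_def)
  qed
qed

text \<open>While walking towards the end, either \<open>h\<close> is left behind or the distance to
  \<open>h\<close> decreases with the step.\<close>

lemma sees_add:
  assumes y: "y \<in> ends" and h: "h \<in> carrier G" and H: "H \<subseteq> carrier G"
  shows "g \<in> carrier G \<Longrightarrow> \<forall>k\<in>H. sees y k g \<Longrightarrow> \<exists>g'\<in>carrier G. \<forall>k\<in>insert h H. sees y k g'"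
proof (induction "len (inv g \<otimes> h)" arbitrary: g rule: less_induct)
  case less
  have l: "y g \<in> Lt" using y less.prems by (auto simp: ends_def)
  have mv: "\<forall>k\<in>H. sees y k (g \<otimes> y g)" using sees_move[OF y less.prems(1)] H less.prems by auto
  show ?case
  proof (cases "sees y h g \<or> h = g")
    case True
    then have "\<forall>k\<in>insert h H. sees y k (g \<otimes> y g)" using mv sees_move[OF y less.prems(1) h] by auto
    then show ?thesis using less.prems l by (intro bexI[of _ "g \<otimes> y g"]) auto
  next
    case False
    then have d: "y g = head (inv g \<otimes> h)" by (auto simp: sees_def dir_def)
    have ne: "inv g \<otimes> h \<noteq> \<one>" using d Lt_neq_one[OF l] by auto
    have gh: "inv g \<otimes> h \<in> carrier G" using less.prems h by simp
    obtain u where u: "u \<in> carrier G" "inv g \<otimes> h = y g \<otimes> u" "len (inv g \<otimes> h) = Suc (len u)"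
      using head_decomp[OF gh ne] unfolding d[symmetric] by blast
    have "inv (g \<otimes> y g) \<otimes> h = inv (y g) \<otimes> (inv g \<otimes> h)"
      using less.prems h l by (simp add: inv_mult_group m_assoc)
    also have "\<dots> = u" using u l by (simp add: m_assoc[symmetric])
    finally have "len (inv (g \<otimes> y g) \<otimes> h) < len (inv g \<otimes> h)" using u(3) by simp
    then show ?thesis using less.hyps[of "g \<otimes> y g"] mv less.prems l by simp
  qed
qed

lemma sees_all:
  assumes "finite H" "H \<subseteq> carrier G" "y \<in> ends"
  shows "\<exists>g\<in>carrier G. \<forall>k\<in>H. sees y k g"
  using assms(1,2)
proof (induction rule: finite_induct)
  case (insert h H)
  then show ?case using sees_add[OF assms(3), of h H] by auto
qed auto

lemma orbit_letter:
  assumes l: "l \<in> Lt" and g: "g \<in> carrier G"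
  shows "\<exists>k\<in>carrier G. shY k (pole a) g = l"
proof -
  have lc: "l \<in> carrier G" using l by simp
  have *: "shY (g \<otimes> t) (pole a) g = pole a (inv t)" if "t \<in> carrier G" for t
    using that g by (simp add: shY_def inv_mult_group m_assoc)
  have off: "t \<in> carrier G \<Longrightarrow> t \<notin> pw a \<Longrightarrow> pole a (inv t) = head t" for t
    using pw_inv[of a "inv t"] by (auto simp: pole_def)
  have lpw: "l \<in> pw a \<Longrightarrow> l = a \<or> l = inv a" if "l \<in> Lt" for l
    using head_pw[of a l] head_letter[of l] Lt_neq_one[of l] that by auto
  consider "l = a" | "l = inv a" | "l \<notin> pw a" using lpw l by blast
  then show ?thesis
  proof cases
    case 1
    then show ?thesis using *[of \<one>] g pole_one by (intro bexI[of _ "g \<otimes> \<one>"]) auto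
  next
    case 2
    \<comment> \<open>The translate by \<open>g \<otimes> t\<close> shows \<open>head t\<close> at
      \<open>g\<close> if \<open>t\<close> is off the axis of \<open>a\<close>. As
      \<open>inv a\<close> lies on the axis, it is continued by \<open>b\<close> to get off
      it.\<close>
    have "b \<notin> pw a" using lpw[of b] ab b_neq_inv_a by auto
    then have n: "inv a \<otimes> b \<notin> pw a" using pw_mult_iff(1)[of a "inv a" b] pw_inv pw_self by simp
    have "head (inv a \<otimes> b) = inv a" using head_mult[of "inv a" b] head_letter[of b] ab by simp
    then show ?thesis using *[of "inv a \<otimes> b"] off[OF _ n] 2 g
      by (intro bexI[of _ "g \<otimes> (inv a \<otimes> b)"]) auto
  next
    case 3
    then show ?thesis using *[of l] off[of l] head_letter[OF l] g lc
      by (intro bexI[of _ "g \<otimes> l"]) auto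
  qed
qed

text \<open>Choose \<open>g\<close> with all of \<open>H\<close> behind it when facing
  \<open>y\<close>. A translate with the same letter at \<open>g\<close> is then forced by
  \<open>dir_sep\<close> to agree with \<open>y\<close> on \<open>H\<close>: both look towards
  \<open>g\<close>.\<close>

lemma orbit_dense:
  assumes y: "y \<in> ends" and H: "finite H" "H \<subseteq> carrier G"
  shows "\<exists>k\<in>carrier G. \<forall>h\<in>H. shY k (pole a) h = y h"
proof -
  obtain g where g: "g \<in> carrier G" "\<forall>k\<in>H. sees y k g" using sees_all[OF H y] by blast
  have yr: "pointing y" "y g \<in> Lt" using y g by (auto simp: ends_def)
  obtain k where k: "k \<in> carrier G" "shY k (pole a) g = y g" using orbit_letter[OF yr(2) g(1)] by blast
  have r: "pointing (shY k (pole a))" using pointing_shY[OF k(1)] pointing_pole by simp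
  have "shY k (pole a) h = y h" if h: "h \<in> H" for h
  proof -
    have hg: "h \<in> carrier G" "g \<noteq> h" "y g \<noteq> dir h g" using g h H by (auto simp: sees_def)
    show ?thesis using dir_sep[OF yr(1) g(1) hg(1,2)] dir_sep[OF r g(1) hg(1,2)] hg(3) k(2) by simp
  qed
  then show ?thesis using k(1) by blast
qed

text \<open>If the end has left the axis by height \<open>i\<close>, only exit heights up to
  \<open>i\<close> matter. If it stays, the 2-adic coordinate differs from \<open>\<sigma> g\<close>
  modulo some \<open>2 ^ j\<close>; a nearby end can exit only above \<open>2 ^ j\<close>, where the
  flag would need a congruence that already fails modulo \<open>2 ^ j\<close>.\<close>

lemma flag_locally_constant:
  assumes y: "pointing y" and g: "g \<in> carrier G" and n: "\<not> critical y w g"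
  shows "\<exists>H J. finite H \<and> H \<subseteq> carrier G \<and> (\<forall>y' w'. pointing y' \<and> (\<forall>h\<in>H. y' h = y h) \<and> (\<forall>i<J. w' i = w i)
    \<longrightarrow> flag y' w' g = flag y w g \<and> \<not> critical y' w' g)"
proof (cases "stays y g")
  case False
  then obtain i where i: "i \<ge> 0" "y (g \<otimes> ap i) \<noteq> a" by (auto simp: stays_def)
  let ?H = "(\<lambda>m. g \<otimes> ap m) ` {0..i}"
  have "flag y' w' g = flag y w g \<and> \<not> critical y' w' g"
    if y': "pointing y'" "\<forall>h\<in>?H. y' h = y h" and w': "\<forall>k<Suc (nat i). w' k = w k" for y' w'
  proof -
    have i': "y' (g \<otimes> ap i) \<noteq> a" using y' i by auto
    then have ns: "\<not> critical y' w' g" using i by (auto simp: critical_def stays_def)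
    have le: "2 ^ j \<le> i" if "pointing D" "D (g \<otimes> ap i) \<noteq> a" "exits D g (2 ^ j)" for D and j :: nat
      using not_a_mono[OF that(1) g, of i "2 ^ j - 1"] that by (force simp: exits_def)
    have eq: "exits y' g (2 ^ j) \<longleftrightarrow> exits y g (2 ^ j)" if "2 ^ j \<le> i" for j :: nat
      using y' that by (auto simp: exits_def)
    have kp: "kap (Suc j) w' = kap (Suc j) w" if "2 ^ j \<le> i" for j :: nat
    proof -
      have "int j < 2 ^ j" using of_nat_less_two_power by blast
      then have "Suc j \<le> Suc (nat i)" using that by linarith
      then show ?thesis using w' by (intro kap_cong) auto
    qed
    have "flag y' w' g = flag y w g"
      unfolding flag_def using le[OF y'(1) i'] le[OF y i(2)] eq kp by metis
    then show ?thesis using ns by simp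
  qed
  then show ?thesis using g by (intro exI[of _ ?H] exI[of _ "Suc (nat i)"]) auto
next
  case True
  then obtain j where j: "\<not> 2 ^ j dvd kap j w - \<sigma> g" using n by (auto simp: critical_def)
  let ?H = "(\<lambda>m. g \<otimes> ap m) ` {0..2 ^ j}"
  have "flag y' w' g = flag y w g \<and> \<not> critical y' w' g"
    if y': "pointing y'" "\<forall>h\<in>?H. y' h = y h" and w': "\<forall>k<j. w' k = w k" for y' w'
  proof -
    have kp: "kap j w' = kap j w" using w' by (intro kap_cong) auto
    then have "\<not> critical y' w' g" using j unfolding critical_def by metis
    moreover have "\<not> flag y' w' g"
    proof
      assume "flag y' w' g"
      then obtain k where k: "exits y' g (2 ^ k)" "2 ^ Suc k dvd kap (Suc k) w' - \<sigma> g" by (auto simp: flag_def)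
      have "\<not> (2::int) ^ k \<le> 2 ^ j"
        using k(1) y'(2) True by (auto simp: exits_def stays_def)
      then have "j \<le> Suc k" by simp
      then have "2 ^ j dvd kap j w' - \<sigma> g" using k(2) by (rule kap_dvd_mono)
      then show False using j kp by simp
    qed
    ultimately show ?thesis using flag_stays[OF True] by simp
  qed
  then show ?thesis using g by (intro exI[of _ ?H] exI[of _ j]) auto
qed

end

section \<open>Coding by real sequences\<close>

lemma tendsto_fun_iff:
  fixes f :: "'c \<Rightarrow> nat \<Rightarrow> real"
  shows "(f \<longlongrightarrow> l) F \<longleftrightarrow> (\<forall>i. ((\<lambda>x. f x i) \<longlongrightarrow> l i) F)"
proof -
  have "(f \<longlongrightarrow> l) F \<longleftrightarrow> limitin (product_topology (\<lambda>i. euclidean) UNIV) f l F"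
    by (simp add: euclidean_product_topology)
  also have "\<dots> \<longleftrightarrow> (\<forall>i. ((\<lambda>x. f x i) \<longlongrightarrow> l i) F)"
    by (simp add: limitin_componentwise)
  finally show ?thesis .
qed

lemma LIMSEQ_of_nat_iff:
  "(\<lambda>n. real (f n)) \<longlonglongrightarrow> real l \<longleftrightarrow> (\<forall>\<^sub>F n in sequentially. f n = l)"
proof
  assume "(\<lambda>n. real (f n)) \<longlonglongrightarrow> real l"
  then have "\<forall>\<^sub>F n in sequentially. dist (real (f n)) (real l) < 1"
    by (rule tendstoD) simp
  then show "\<forall>\<^sub>F n in sequentially. f n = l"
    by eventually_elim (simp add: dist_real_def)
qed (auto intro: tendsto_eventually elim: eventually_mono)

lemma LIMSEQ_of_bool_iff:
  "(\<lambda>n. of_bool (f n) :: real) \<longlonglongrightarrow> of_bool l \<longleftrightarrow> (\<forall>\<^sub>F n in sequentially. f n = l)"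
  using LIMSEQ_of_nat_iff[of "\<lambda>n. of_bool (f n)" "of_bool l"] by simp

lemma compact_PiE_UNIV: "compact F \<Longrightarrow> compact (PiE (UNIV :: nat set) (\<lambda>_. F :: real set))"
  using compactin_PiE[of "\<lambda>_. euclidean" "UNIV :: nat set" "\<lambda>_. F"]
  by (simp add: euclidean_product_topology)

text \<open>Transports an action along an injective code into real sequences, the type in which the
  spaces are required to live.\<close>

definition coded_act :: "'c set \<Rightarrow> ('c \<Rightarrow> nat \<Rightarrow> real) \<Rightarrow> ('g \<Rightarrow> 'c \<Rightarrow> 'c) \<Rightarrow> 'g \<Rightarrow> (nat \<Rightarrow> real) \<Rightarrow> nat \<Rightarrow> real"
  where "coded_act T enc sh g p = enc (sh g (inv_into T enc p))"

lemma coded_act: "\<lbrakk>inj_on enc T; t \<in> T\<rbrakk> \<Longrightarrow> coded_act T enc sh g (enc t) = enc (sh g t)"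
  by (simp add: coded_act_def)

lemma continuous_on_codedI:
  fixes enc :: "'c \<Rightarrow> nat \<Rightarrow> real" and f :: "(nat \<Rightarrow> real) \<Rightarrow> 'd::topological_space"
  assumes "\<And>ts t. \<lbrakk>\<And>n. ts n \<in> T; t \<in> T; (\<lambda>n. enc (ts n)) \<longlonglongrightarrow> enc t\<rbrakk>
    \<Longrightarrow> (\<lambda>n::nat. f (enc (ts n))) \<longlonglongrightarrow> f (enc t)"
  shows "continuous_on (enc ` T) f"
proof (rule continuous_on_sequentiallyI)
  fix u p assume u: "\<forall>n. u n \<in> enc ` T" and p: "p \<in> enc ` T" and lim: "u \<longlonglongrightarrow> p"
  obtain ts where ts: "\<And>n. ts n \<in> T" "\<And>n. u n = enc (ts n)" using u unfolding image_iff by metis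
  obtain t where t: "t \<in> T" "p = enc t" using p by auto
  have "u = (\<lambda>n. enc (ts n))" using ts by auto
  then show "(\<lambda>n. f (u n)) \<longlonglongrightarrow> f p" using assms[of ts t] ts t lim by simp
qed

lemma cont_action_coded:
  fixes enc :: "'c \<Rightarrow> nat \<Rightarrow> real"
  assumes inj: "inj_on enc T"
    and T: "\<And>g t. \<lbrakk>g \<in> carrier G; t \<in> T\<rbrakk> \<Longrightarrow> sh g t \<in> T"
    and one: "\<And>t. t \<in> T \<Longrightarrow> sh \<one>\<^bsub>G\<^esub> t = t"
    and mult: "\<And>g h t. \<lbrakk>g \<in> carrier G; h \<in> carrier G; t \<in> T\<rbrakk> \<Longrightarrow> sh (g \<otimes>\<^bsub>G\<^esub> h) t = sh g (sh h t)"
    and cont: "\<And>g ts t. \<lbrakk>g \<in> carrier G; \<And>n. ts n \<in> T; t \<in> T; (\<lambda>n. enc (ts n)) \<longlonglongrightarrow> enc t\<rbrakk>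
      \<Longrightarrow> (\<lambda>n::nat. enc (sh g (ts n))) \<longlonglongrightarrow> enc (sh g t)"
  shows "cont_action G (enc ` T) (coded_act T enc sh)"
  unfolding cont_action_def
proof (intro conjI ballI)
  fix g assume g: "g \<in> carrier G"
  show "continuous_on (enc ` T) (coded_act T enc sh g)"
    by (rule continuous_on_codedI) (simp add: coded_act[OF inj] cont[OF g])
  show "coded_act T enc sh g ` enc ` T \<subseteq> enc ` T"
    using T[OF g] by (auto simp: coded_act[OF inj])
qed (auto simp: coded_act[OF inj] T one mult)

lemma finite_closed_reals: "finite (A :: nat set) \<Longrightarrow> compact (real ` A)"
  by (simp add: finite_imp_compact)

text \<open>The values lie in a finite set, so coordinatewise convergence means that every coordinate is
  eventually constant.\<close>

lemma compact_coded:
  fixes enc :: "'c \<Rightarrow> nat \<Rightarrow> real"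
  assumes A: "finite (A :: nat set)" "\<And>t n. t \<in> T \<Longrightarrow> enc t n \<in> real ` A"
    and cl: "\<And>ts p. \<lbrakk>\<And>n. ts n \<in> T; \<And>i. \<forall>\<^sub>F n in sequentially. enc (ts n) i = p i\<rbrakk> \<Longrightarrow> p \<in> enc ` T"
  shows "compact (enc ` T)"
proof -
  let ?K = "PiE (UNIV :: nat set) (\<lambda>_. real ` A)"
  have K: "compact ?K" by (intro compact_PiE_UNIV finite_closed_reals A)
  have sub: "enc ` T \<subseteq> ?K" using A(2) by auto
  have "closed (enc ` T)"
    unfolding closed_sequential_limits
  proof (intro allI impI, elim conjE)
    fix u p assume u: "\<forall>n. u n \<in> enc ` T" and lim: "u \<longlonglongrightarrow> p"
    obtain ts where ts: "\<And>n. ts n \<in> T" "\<And>n. u n = enc (ts n)" using u unfolding image_iff by metis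
    have "p \<in> ?K" by (rule closed_sequentially[OF compact_imp_closed[OF K] _ lim]) (use u sub in blast)
    have "\<forall>\<^sub>F n in sequentially. enc (ts n) i = p i" for i
    proof -
      have "(\<lambda>n. u n i) \<longlonglongrightarrow> p i" using lim tendsto_fun_iff by blast
      moreover obtain k where k: "p i = real k" using \<open>p \<in> ?K\<close> by (force simp: PiE_iff)
      moreover have "\<forall>n. \<exists>m. u n i = real m" using u A(2) by (metis imageE)
      then obtain m where "\<And>n. u n i = real (m n)" by metis
      ultimately have "\<forall>\<^sub>F n in sequentially. m n = k" using LIMSEQ_of_nat_iff[of m k] by simp
      then show ?thesis using k ts \<open>\<And>n. u n i = real (m n)\<close> by (auto elim: eventually_mono)
    qed
    then show "p \<in> enc ` T" by (intro cl[of ts]) (auto simp: ts)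
  qed
  then show ?thesis using compact_Int_closed[OF K] sub by (metis inf.absorb_iff2)
qed

section \<open>Compactness, continuity and the factor map of the coded spaces\<close>

context free_grp2
begin

lemma cnt: "countable (carrier G)" and inf: "infinite (carrier G)"
proof -
  show "countable (carrier G)" using countable_carrier finS by simp
  have "inj ap" using \<sigma>_ap by (metis injI)
  then have "infinite (range ap)" by (simp add: finite_image_iff)
  then show "infinite (carrier G)" by (rule infinite_super[rotated]) auto
qed

definition en :: "'a \<Rightarrow> nat" where "en = to_nat_on (carrier G)"
definition de :: "nat \<Rightarrow> 'a" where "de = from_nat_into (carrier G)"

lemma de_car [simp]: "de n \<in> carrier G"
  unfolding de_def by (rule from_nat_into) auto

lemma de_en [simp]: "g \<in> carrier G \<Longrightarrow> de (en g) = g" and en_de [simp]: "en (de n) = n"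
  using cnt inf by (simp_all add: de_def en_def)

lemma en_inj: "\<lbrakk>g \<in> carrier G; h \<in> carrier G\<rbrakk> \<Longrightarrow> en g = en h \<longleftrightarrow> g = h"
  using cnt by (simp add: en_def)

definition encY :: "('a \<Rightarrow> 'a) \<Rightarrow> nat \<Rightarrow> real" where
  "encY y n = real (en (y (de n)))"

definition encX :: "'a config \<Rightarrow> nat \<Rightarrow> real" where
  "encX = (\<lambda>(y, w, z) n. if n mod 3 = 0 then encY y (n div 3)
     else if n mod 3 = 1 then of_bool (w (n div 3)) else of_bool (z (de (n div 3))))"

definition convY :: "(nat \<Rightarrow> 'a \<Rightarrow> 'a) \<Rightarrow> ('a \<Rightarrow> 'a) \<Rightarrow> bool" where
  "convY ys y \<longleftrightarrow> (\<forall>g\<in>carrier G. \<forall>\<^sub>F n in sequentially. ys n g = y g)"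

definition convX :: "(nat \<Rightarrow> 'a config)
    \<Rightarrow> 'a config \<Rightarrow> bool" where
  "convX xs x \<longleftrightarrow> convY (\<lambda>n. fst (xs n)) (fst x) \<and>
     (\<forall>i. \<forall>\<^sub>F n in sequentially. fst (snd (xs n)) i = fst (snd x) i) \<and>
     (\<forall>g\<in>carrier G. \<forall>\<^sub>F n in sequentially. snd (snd (xs n)) g = snd (snd x) g)"

lemma ends_car: "y \<in> ends \<Longrightarrow> y g \<in> carrier G"
  by (cases "g \<in> carrier G") (auto simp: ends_def)

lemma encX_0: "encX x (3 * n) = encY (fst x) n"
  and encX_1: "encX x (3 * n + 1) = of_bool (fst (snd x) n)"
  and encX_2: "encX x (3 * n + 2) = of_bool (snd (snd x) (de n))"
proof -
  have "(3 * n + 1) mod 3 = 1" "(3 * n + 1) div 3 = n" "(3 * n + 2) mod 3 = 2" "(3 * n + 2) div 3 = n"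
    by presburger+
  then show "encX x (3 * n) = encY (fst x) n" "encX x (3 * n + 1) = of_bool (fst (snd x) n)"
    "encX x (3 * n + 2) = of_bool (snd (snd x) (de n))"
    by (simp_all add: encX_def split_beta)
qed

lemma mod3_cases: obtains m :: nat where "n = 3 * m" | m where "n = 3 * m + 1" | m where "n = 3 * m + 2"
proof -
  have "n = 3 * (n div 3) \<or> n = 3 * (n div 3) + 1 \<or> n = 3 * (n div 3) + 2" by presburger
  then show thesis using that by blast
qed

lemma all_mod3: "(\<forall>n. P (n::nat)) \<longleftrightarrow> (\<forall>n. P (3 * n)) \<and> (\<forall>n. P (3 * n + 1)) \<and> (\<forall>n. P (3 * n + 2))"
  by (metis mod3_cases)

lemma all_de: "(\<forall>n. P (de n)) \<longleftrightarrow> (\<forall>g\<in>carrier G. P g)"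
  by (metis de_car de_en)

lemma encY_lim:
  assumes "\<And>n. ys n \<in> ends" "y \<in> ends"
  shows "(\<lambda>n. encY (ys n)) \<longlonglongrightarrow> encY y \<longleftrightarrow> convY ys y"
proof -
  have "(\<lambda>n. encY (ys n)) \<longlonglongrightarrow> encY y
      \<longleftrightarrow> (\<forall>i. \<forall>\<^sub>F n in sequentially. en (ys n (de i)) = en (y (de i)))"
    unfolding tendsto_fun_iff encY_def LIMSEQ_of_nat_iff ..
  also have "\<dots> \<longleftrightarrow> (\<forall>i. \<forall>\<^sub>F n in sequentially. ys n (de i) = y (de i))"
    using en_inj ends_car assms by simp
  also have "\<dots> \<longleftrightarrow> convY ys y"
    unfolding convY_def by (rule all_de)
  finally show ?thesis .
qed

lemma encX_lim:
  assumes "\<And>n. fst (xs n) \<in> ends" "fst x \<in> ends"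
  shows "(\<lambda>n. encX (xs n)) \<longlonglongrightarrow> encX x \<longleftrightarrow> convX xs x"
proof -
  have "(\<lambda>n. encX (xs n)) \<longlonglongrightarrow> encX x \<longleftrightarrow>
     (\<forall>i. (\<lambda>n. encY (fst (xs n)) i) \<longlonglongrightarrow> encY (fst x) i) \<and>
     (\<forall>i. \<forall>\<^sub>F n in sequentially. fst (snd (xs n)) i = fst (snd x) i) \<and>
     (\<forall>i. \<forall>\<^sub>F n in sequentially. snd (snd (xs n)) (de i) = snd (snd x) (de i))"
    unfolding tendsto_fun_iff all_mod3[of "\<lambda>i. (\<lambda>n. encX (xs n) i) \<longlonglongrightarrow> encX x i"]
      encX_0 encX_1 encX_2 LIMSEQ_of_bool_iff ..
  also have "\<dots> \<longleftrightarrow> convX xs x"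
    unfolding convX_def tendsto_fun_iff[symmetric] encY_lim[OF assms]
      all_de[of "\<lambda>g. \<forall>\<^sub>F n in sequentially. snd (snd (xs n)) g = snd (snd x) g"] ..
  finally show ?thesis .
qed

lemma inj_encY: "inj_on encY ends"
proof (rule inj_onI)
  fix y y' assume y: "y \<in> ends" "y' \<in> ends" and e: "encY y = encY y'"
  have "y g = y' g" for g
  proof (cases "g \<in> carrier G")
    case True
    have "encY y (en g) = encY y' (en g)" using e by simp
    then show ?thesis using True en_inj ends_car y by (simp add: encY_def)
  qed (use y in \<open>simp add: ends_def\<close>)
  then show "y = y'" by auto
qed

lemma flagged_fst: "x \<in> flagged \<Longrightarrow> fst x \<in> ends"
  by (auto simp: flagged_def)

lemma inj_encX: "inj_on encX flagged"
proof (rule inj_onI)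
  fix x x' assume x: "x \<in> flagged" "x' \<in> flagged" and e: "encX x = encX x'"
  have "encY (fst x) = encY (fst x')" using e by (metis encX_0 ext)
  then have 1: "fst x = fst x'" by (rule inj_onD[OF inj_encY _ flagged_fst[OF x(1)] flagged_fst[OF x(2)]])
  have "fst (snd x) n = fst (snd x') n" for n using e encX_1[of x n] encX_1[of x' n] by (metis of_bool_eq_iff)
  then have 2: "fst (snd x) = fst (snd x')" by auto
  have "snd (snd x) g = snd (snd x') g" for g
  proof (cases "g \<in> carrier G")
    case True
    then show ?thesis using e encX_2[of x "en g"] encX_2[of x' "en g"]
      by (metis de_en of_bool_eq_iff)
  next
    case False
    then show ?thesis using x by (auto simp: flagged_def)
  qed
  then have "snd (snd x) = snd (snd x')" by auto
  with 1 2 show "x = x'" by (simp add: prod_eq_iff)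
qed

lemma convY_window: "\<lbrakk>convY ys y; finite H; H \<subseteq> carrier G\<rbrakk>
    \<Longrightarrow> \<forall>\<^sub>F n in sequentially. \<forall>h\<in>H. ys n h = y h"
  by (auto simp: convY_def intro!: eventually_ball_finite)

lemma eventually_prefix:
  assumes "\<And>i. \<forall>\<^sub>F n in sequentially. ws n i = w i"
  shows "\<forall>\<^sub>F n in sequentially. \<forall>i<(J::nat). ws n i = w i"
  using eventually_ball_finite[of "{..<J}" "\<lambda>n i. ws n i = w i" sequentially] assms
  unfolding Ball_def lessThan_iff by blast

text \<open>Each instance of the defining conditions involves at most two vertices, where some
  member of the sequence agrees with the limit.\<close>

lemma ends_closed:
  assumes ys: "\<And>n. ys n \<in> ends" and lim: "convY ys y" and off: "\<And>g. g \<notin> carrier G \<Longrightarrow> y g = \<one>"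
  shows "y \<in> ends"
proof -
  have get: "\<exists>n. \<forall>h\<in>H. ys n h = y h" if "finite H" "H \<subseteq> carrier G" for H
    using convY_window[OF lim that] eventually_happens[of _ sequentially] by force
  have "y g \<in> Lt" if g: "g \<in> carrier G" for g
  proof -
    obtain n where "ys n g = y g" using get[of "{g}"] g by auto
    moreover have "ys n g \<in> Lt" using ys[of n] g by (simp add: ends_def)
    ultimately show ?thesis by simp
  qed
  moreover have "pointing y"
    unfolding pointing_def
  proof (intro ballI)
    fix g l assume g: "g \<in> carrier G" and l: "l \<in> Lt"
    obtain n where "ys n g = y g" "ys n (g \<otimes> l) = y (g \<otimes> l)"
      using get[of "{g, g \<otimes> l}"] g l by auto
    moreover have "pointing (ys n)" using ys by (simp add: ends_def)
    ultimately show "y (g \<otimes> l) = inv l \<longleftrightarrow> y g \<noteq> l" using pointingD[of "ys n" g l] g l by simp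
  qed
  ultimately show ?thesis using off by (simp add: ends_def)
qed

lemma flag_eventually:
  assumes ys: "\<And>n. ys n \<in> ends" and y: "y \<in> ends" and lim: "convY ys y"
    and ws: "\<And>i. \<forall>\<^sub>F n in sequentially. ws n i = w i" and g: "g \<in> carrier G" and ns: "\<not> critical y w g"
  shows "\<forall>\<^sub>F n in sequentially. flag (ys n) (ws n) g = flag y w g \<and> \<not> critical (ys n) (ws n) g"
proof -
  have r: "pointing y" "\<And>n. pointing (ys n)" using ys y by (auto simp: ends_def)
  obtain H J where H: "finite H" "H \<subseteq> carrier G"
    "\<forall>y' w'. pointing y' \<and> (\<forall>h\<in>H. y' h = y h) \<and> (\<forall>i<J. w' i = w i)
      \<longrightarrow> flag y' w' g = flag y w g \<and> \<not> critical y' w' g"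
    using flag_locally_constant[OF r(1) g ns] by (elim exE conjE)
  have pre: "\<forall>\<^sub>F n in sequentially. \<forall>i<J. ws n i = w i"
    by (rule eventually_prefix) (rule ws)
  show ?thesis
    using convY_window[OF lim H(1,2)] pre
    by eventually_elim (use H(3) r(2) in blast)
qed

text \<open>Noncritical flags are locally constant and critical ones are unconstrained, so nothing
  can fail in the limit.\<close>

lemma flagged_closed:
  assumes xs: "\<And>n. xs n \<in> flagged" and lim: "convX xs x"
    and off: "\<And>g. g \<notin> carrier G \<Longrightarrow> fst x g = \<one> \<and> \<not> snd (snd x) g"
  shows "x \<in> flagged"
proof -
  obtain y w z where x: "x = (y, w, z)" by (cases x) auto
  have lY: "convY (\<lambda>n. fst (xs n)) y" and lw: "\<And>i. \<forall>\<^sub>F n in sequentially. fst (snd (xs n)) i = w i"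
    and lz: "\<And>g. g \<in> carrier G \<Longrightarrow> \<forall>\<^sub>F n in sequentially. snd (snd (xs n)) g = z g"
    using lim by (auto simp: convX_def x)
  have Y: "\<And>n. fst (xs n) \<in> ends" using flagged_fst xs by simp
  have y: "y \<in> ends" using ends_closed[OF Y lY] off by (simp add: x)
  have "z g = flag y w g" if g: "g \<in> carrier G" and ns: "\<not> critical y w g" for g
  proof -
    obtain n where n: "flag (fst (xs n)) (fst (snd (xs n))) g = flag y w g"
      "\<not> critical (fst (xs n)) (fst (snd (xs n))) g" "snd (snd (xs n)) g = z g"
      using eventually_happens[OF eventually_conj[OF flag_eventually[OF Y y lY lw g ns] lz[OF g]]] by auto
    obtain y' w' z' where e: "xs n = (y', w', z')" by (cases "xs n") auto
    then have "(y', w', z') \<in> flagged" using xs by metis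
    then show ?thesis using n g e by (simp add: flagged_def)
  qed
  then show ?thesis using y off by (simp add: x flagged_def)
qed

text \<open>Reduces convergence of regular points to the behaviour of flags at critical vertices;
  minimality and continuity of the RIM both rest on it.\<close>

lemma sec_lim:
  assumes ys: "\<And>n. ys n \<in> ends" and x: "(y, w, z) \<in> flagged" and lim: "convY ys y"
    and ws: "\<And>i. \<forall>\<^sub>F n in sequentially. ws n i = w i"
    and S: "\<And>g. \<lbrakk>g \<in> carrier G; critical y w g\<rbrakk> \<Longrightarrow> \<forall>\<^sub>F n in sequentially. flag (ys n) (ws n) g = z g"
  shows "convX (\<lambda>n. sec (ys n) (ws n)) (y, w, z)"
proof -
  have y: "y \<in> ends" using x by (simp add: flagged_def)
  have "\<forall>\<^sub>F n in sequentially. flag (ys n) (ws n) g = z g" if g: "g \<in> carrier G" for g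
  proof (cases "critical y w g")
    case False
    then have "z g = flag y w g" using x g by (simp add: flagged_def)
    then show ?thesis using flag_eventually[OF ys y lim ws g False] by (auto elim: eventually_mono)
  qed (use S g in auto)
  then show ?thesis using lim ws by (simp add: convX_def sec_def)
qed

definition valA :: "nat set" where "valA = en ` Lt \<union> {0, 1}"

lemma encY_val: "y \<in> ends \<Longrightarrow> encY y n \<in> real ` valA"
  by (auto simp: encY_def valA_def ends_def)

lemma encX_val: "x \<in> flagged \<Longrightarrow> encX x n \<in> real ` valA"
  by (cases n rule: mod3_cases)
    (auto simp: encX_0 encX_1[simplified] encX_2[simplified] encY_val flagged_fst, auto simp: valA_def)

lemma finite_valA: "finite valA"
  using finite_Lt[OF finS] by (simp add: valA_def)

lemma lim_letters:
  assumes ys: "\<And>n. ys n \<in> ends" and ev: "\<And>i. \<forall>\<^sub>F n in sequentially. encY (ys n) i = p i"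
  obtains y where "y \<in> ends" "encY y = p" "convY ys y"
proof -
  \<comment> \<open>The sequence \<open>p\<close> is not yet known to be a code; rounding down turns
    its entries into indices of group elements.\<close>
  define y where "y g = (if g \<in> carrier G then de (nat \<lfloor>p (en g)\<rfloor>) else \<one>)" for g
  have 1: "\<forall>\<^sub>F n in sequentially. ys n g = y g" if g: "g \<in> carrier G" for g
    using ev[of "en g"]
  proof eventually_elim
    case (elim n)
    then have "p (en g) = real (en (ys n g))" using g by (simp add: encY_def)
    then show ?case using g ends_car[OF ys] by (simp add: y_def)
  qed
  then have c: "convY ys y" by (simp add: convY_def)
  have y: "y \<in> ends" by (rule ends_closed[OF ys c]) (simp add: y_def)
  have "encY y i = p i" for i
  proof -
    obtain n where "ys n (de i) = y (de i)" "encY (ys n) i = p i"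
      using eventually_happens[OF eventually_conj[OF 1[of "de i"] ev[of i]]] by auto
    then show ?thesis by (simp add: encY_def)
  qed
  then show thesis using that[OF y _ c] by auto
qed

lemma compact_Y: "compact (encY ` ends)"
proof (rule compact_coded[OF finite_valA encY_val])
  fix ts p assume "\<And>n. ts n \<in> ends" "\<And>i. \<forall>\<^sub>F n in sequentially. encY (ts n) i = p i"
  then show "p \<in> encY ` ends" using lim_letters by (metis imageI)
qed

lemma compact_X: "compact (encX ` flagged)"
proof (rule compact_coded[OF finite_valA encX_val])
  fix ts p assume ts: "\<And>n. ts n \<in> flagged" and ev: "\<And>i. \<forall>\<^sub>F n in sequentially. encX (ts n) i = p i"
  have e0: "\<forall>\<^sub>F n in sequentially. encY (fst (ts n)) i = p (3 * i)" for i
    using ev[of "3 * i"] by (simp only: encX_0)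
  have e1: "\<forall>\<^sub>F n in sequentially. of_bool (fst (snd (ts n)) i) = p (3 * i + 1)" for i
    using ev[of "3 * i + 1"] by (simp only: encX_1)
  have e2: "\<forall>\<^sub>F n in sequentially. of_bool (snd (snd (ts n)) (de i)) = p (3 * i + 2)" for i
    using ev[of "3 * i + 2"] by (simp only: encX_2)
  obtain y where y: "y \<in> ends" "encY y = (\<lambda>i. p (3 * i))" "convY (\<lambda>n. fst (ts n)) y"
    using lim_letters[of "\<lambda>n. fst (ts n)" "\<lambda>i. p (3 * i)"] flagged_fst[OF ts] e0 by blast
  define w where "w i \<longleftrightarrow> p (3 * i + 1) = 1" for i
  define z where "z g \<longleftrightarrow> g \<in> carrier G \<and> p (3 * en g + 2) = 1" for g
  have w: "\<forall>\<^sub>F n in sequentially. fst (snd (ts n)) i = w i" for i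
    using e1[of i] by eventually_elim (auto simp: w_def of_bool_def split: if_splits)
  have z: "\<forall>\<^sub>F n in sequentially. snd (snd (ts n)) g = z g" if "g \<in> carrier G" for g
    using e2[of "en g"] by eventually_elim (use that in \<open>auto simp: z_def of_bool_def split: if_splits\<close>)
  have c: "convX ts (y, w, z)" using y(3) w z by (simp add: convX_def)
  have x: "(y, w, z) \<in> flagged" by (rule flagged_closed[OF ts c]) (use y in \<open>auto simp: ends_def z_def\<close>)
  have "(\<lambda>n. encX (ts n)) \<longlonglongrightarrow> encX (y, w, z)"
    using encX_lim[of ts "(y, w, z)"] c flagged_fst ts y(1) by simp
  moreover have "(\<lambda>n. encX (ts n)) \<longlonglongrightarrow> p"
    unfolding tendsto_fun_iff using ev by (auto intro: tendsto_eventually)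
  ultimately have "encX (y, w, z) = p" by (rule LIMSEQ_unique)
  then show "p \<in> encX ` flagged" using x by blast
qed

lemma flagged_subseq:
  assumes xs: "\<And>n. xs n \<in> flagged"
  obtains x r where "x \<in> flagged" "strict_mono (r :: nat \<Rightarrow> nat)" "convX (xs \<circ> r) x"
proof -
  obtain p r where p: "p \<in> encX ` flagged" "strict_mono (r :: nat \<Rightarrow> nat)" "((\<lambda>n. encX (xs n)) \<circ> r) \<longlonglongrightarrow> p"
    using compact_X xs unfolding compact_eq_seq_compact_metric seq_compact_def
    by (metis (mono_tags, lifting) imageI)
  then obtain x where x: "x \<in> flagged" "p = encX x" by auto
  have "convX (xs \<circ> r) x"
    using encX_lim[of "xs \<circ> r" x] p(3) x flagged_fst xs by (simp add: o_def)
  then show thesis using that x p(2) by blast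
qed

lemma convY_shY:
  "\<lbrakk>convY ys y; g \<in> carrier G\<rbrakk> \<Longrightarrow> convY (\<lambda>n. shY g (ys n)) (shY g y)"
  by (auto simp: convY_def shY_def)

lemma convX_shX:
  assumes c: "convX xs x" and g: "g \<in> carrier G"
  shows "convX (\<lambda>n. shX g (xs n)) (shX g x)"
proof -
  have "\<forall>\<^sub>F n in sequentially. addK (\<sigma> g) (fst (snd (xs n))) i = addK (\<sigma> g) (fst (snd x)) i" for i
  proof -
    have "\<forall>\<^sub>F n in sequentially. \<forall>j<Suc i. fst (snd (xs n)) j = fst (snd x) j"
      using eventually_prefix[of "\<lambda>n. fst (snd (xs n))"] c by (simp add: convX_def)
    then show ?thesis
    proof eventually_elim
      case (elim n)
      then have "kap (Suc i) (fst (snd (xs n))) = kap (Suc i) (fst (snd x))" by (intro kap_cong) auto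
      then show ?case by (simp add: addK_def)
    qed
  qed
  then show ?thesis
    using c g convY_shY[of "\<lambda>n. fst (xs n)" "fst x" g]
    by (auto simp: convX_def shX_def split_beta shZ_def)
qed

abbreviation "YS \<equiv> encY ` ends"
abbreviation "XS \<equiv> encX ` flagged"

definition actY :: "'a \<Rightarrow> (nat \<Rightarrow> real) \<Rightarrow> nat \<Rightarrow> real" where "actY = coded_act ends encY shY"
definition actX :: "'a \<Rightarrow> (nat \<Rightarrow> real) \<Rightarrow> nat \<Rightarrow> real" where "actX = coded_act flagged encX shX"
definition prj :: "(nat \<Rightarrow> real) \<Rightarrow> nat \<Rightarrow> real" where "prj p = encY (fst (inv_into flagged encX p))"

lemma actY: "y \<in> ends \<Longrightarrow> actY g (encY y) = encY (shY g y)"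
  unfolding actY_def by (rule coded_act[OF inj_encY])

lemma actX: "x \<in> flagged \<Longrightarrow> actX g (encX x) = encX (shX g x)"
  unfolding actX_def by (rule coded_act[OF inj_encX])

lemma prj: "x \<in> flagged \<Longrightarrow> prj (encX x) = encY (fst x)"
  using inj_encX by (simp add: prj_def)

lemma cont_Y: "cont_action G YS actY"
  unfolding actY_def
proof (rule cont_action_coded[OF inj_encY])
  fix g ts t assume g: "g \<in> carrier G" and t: "\<And>n. ts n \<in> ends" "t \<in> ends"
    "(\<lambda>n. encY (ts n)) \<longlonglongrightarrow> encY t"
  then have "convY (\<lambda>n. shY g (ts n)) (shY g t)" using convY_shY encY_lim by simp
  then show "(\<lambda>n. encY (shY g (ts n))) \<longlonglongrightarrow> encY (shY g t)"
    using encY_lim[of "\<lambda>n. shY g (ts n)" "shY g t"] ends_shY[OF g] t by simp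
qed (auto simp: ends_shY shY_one shY_mult)

lemma cont_X: "cont_action G XS actX"
  unfolding actX_def
proof (rule cont_action_coded[OF inj_encX])
  fix g ts t assume g: "g \<in> carrier G" and t: "\<And>n. ts n \<in> flagged" "t \<in> flagged"
    "(\<lambda>n. encX (ts n)) \<longlonglongrightarrow> encX t"
  then have "convX (\<lambda>n. shX g (ts n)) (shX g t)" using convX_shX encX_lim flagged_fst by simp
  then show "(\<lambda>n. encX (shX g (ts n))) \<longlonglongrightarrow> encX (shX g t)"
    using encX_lim[of "\<lambda>n. shX g (ts n)" "shX g t"] flagged_shX[OF g] t flagged_fst by simp
qed (auto simp: flagged_shX shX_one shX_mult)

lemma prj_factor: "factor_map G XS actX YS actY prj"
  unfolding factor_map_def
proof (intro conjI ballI)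
  show "continuous_on XS prj"
  proof (rule continuous_on_codedI)
    fix ts t assume t: "\<And>n. ts n \<in> flagged" "t \<in> flagged" "(\<lambda>n. encX (ts n)) \<longlonglongrightarrow> encX t"
    then have "convY (\<lambda>n. fst (ts n)) (fst t)" using encX_lim flagged_fst by (simp add: convX_def)
    then show "(\<lambda>n. prj (encX (ts n))) \<longlonglongrightarrow> prj (encX t)"
      using encY_lim[of "\<lambda>n. fst (ts n)" "fst t"] t flagged_fst by (simp add: prj)
  qed
  show "prj ` XS = YS"
  proof
    show "YS \<subseteq> prj ` XS"
    proof
      fix p assume "p \<in> YS"
      then obtain y where y: "y \<in> ends" "p = encY y" by auto
      then have "prj (encX (sec y undefined)) = p" using prj[OF sec_flagged] by (simp add: sec_def)
      then show "p \<in> prj ` XS" using sec_flagged[OF y(1)] by blast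
    qed
    show "prj ` XS \<subseteq> YS"
    proof (rule image_subsetI)
      fix p assume "p \<in> XS"
      then obtain x where "x \<in> flagged" "p = encX x" by (rule imageE)
      then show "prj p \<in> YS" using flagged_fst[of x] prj[of x] by simp
    qed
  qed
  fix g p assume g: "g \<in> carrier G" and "p \<in> XS"
  then obtain x where x: "x \<in> flagged" "p = encX x" by auto
  have "fst (shX g x) = shY g (fst x)" by (simp add: shX_def split_beta)
  then show "prj (actX g p) = actY g (prj p)"
    using actX[OF x(1)] prj[OF x(1)] prj[OF flagged_shX[OF g x(1)]] actY[OF flagged_fst[OF x(1)]] x(2) by simp
qed

end

section \<open>Nullness, effectiveness and non-openness\<close>

lemma cover_number_le:
  assumes "\<W> \<subseteq> \<V>" "finite \<W>" "X \<subseteq> \<Union>\<W>" shows "cover_number X \<V> \<le> card \<W>"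
  unfolding cover_number_def by (rule Least_le) (use assms in blast)

text \<open>A Lebesgue number in terms of windows of coordinates: counterexamples for growing
  windows would accumulate at a point that some member of the cover contains together with a
  neighbourhood.\<close>

lemma open_cover_window:
  fixes X :: "(nat \<Rightarrow> real) set"
  assumes X: "compact X" and U: "open_cover X \<U>"
  shows "\<exists>N. \<forall>p\<in>X. \<exists>U\<in>\<U>. \<forall>p'\<in>X. (\<forall>i<N. p' i = p i) \<longrightarrow> p' \<in> U"
proof (rule ccontr)
  assume "\<not> ?thesis"
  then have "\<forall>N. \<exists>p\<in>X. \<forall>U\<in>\<U>. \<exists>p'\<in>X. (\<forall>i<N. p' i = p i) \<and> p' \<notin> U" by meson
  then obtain p where p: "\<And>N. p N \<in> X"
    "\<And>N U. U \<in> \<U> \<Longrightarrow> \<exists>p'\<in>X. (\<forall>i<N. p' i = p N i) \<and> p' \<notin> U"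
    by metis
  obtain l r where l: "l \<in> X" "strict_mono (r :: nat \<Rightarrow> nat)" "(p \<circ> r) \<longlonglongrightarrow> l"
    by (rule seq_compactE[of X p]) (use X p(1) compact_eq_seq_compact_metric in auto)
  obtain U V where UV: "U \<in> \<U>" "l \<in> U" "open V" "U = X \<inter> V"
  proof -
    obtain U where "U \<in> \<U>" "l \<in> U" using U l(1) by (auto simp: open_cover_def)
    moreover from this have "openin (top_of_set X) U" using U by (simp add: open_cover_def)
    then obtain V where "open V" "U = X \<inter> V" unfolding openin_open by blast
    ultimately show thesis by (rule that)
  qed
  obtain q where q: "\<And>N. q N \<in> X" "\<And>N i. i < N \<Longrightarrow> q N i = p N i" "\<And>N. q N \<notin> U"
    using p(2)[OF UV(1)] by metis
  have "(q \<circ> r) \<longlonglongrightarrow> l"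
    unfolding tendsto_fun_iff
  proof
    fix i
    have "\<forall>\<^sub>F n in sequentially. (p \<circ> r) n i = (q \<circ> r) n i"
      using eventually_gt_at_top[of i]
    proof eventually_elim
      case (elim n)
      then have "i < r n" using seq_suble[OF l(2), of n] by linarith
      then show ?case using q(2) by simp
    qed
    moreover have "(\<lambda>n. (p \<circ> r) n i) \<longlonglongrightarrow> l i" using l(3) unfolding tendsto_fun_iff by blast
    ultimately show "(\<lambda>n. (q \<circ> r) n i) \<longlonglongrightarrow> l i" by (rule Lim_transform_eventually[rotated])
  qed
  then have "\<forall>\<^sub>F n in sequentially. (q \<circ> r) n \<in> V" using topological_tendstoD UV by blast
  then obtain n where "q (r n) \<in> V" using eventually_happens[of _ sequentially] by fastforce
  then show False using q UV(4) by blast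
qed

lemma sequence_entropy_zero:
  assumes "\<And>n. n \<ge> 1 \<Longrightarrow> cover_number X (join_cover X act s n \<U>) \<le> C * n ^ 4"
  shows "sequence_entropy X act s \<U> = 0"
proof -
  let ?c = "\<lambda>n. cover_number X (join_cover X act s n \<U>)"
  let ?f = "\<lambda>n. ln (real (?c n)) / real n"
  \<comment> \<open>\<open>Suc\<close> keeps the logarithm nonnegative also for
    \<open>C = 0\<close>; a zero cover number is harmless because \<open>ln 0 = 0\<close>.\<close>
  define D where "D = real (Suc C)"
  have D: "D > 0" by (simp add: D_def)
  have lo: "0 \<le> ?f n" for n by (cases "?c n") auto
  have hi: "?f n \<le> (ln D + 4 * ln (real n)) / real n" if n: "n \<ge> 1" for n
  proof -
    have "ln (real (?c n)) \<le> ln D + 4 * ln (real n)"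
    proof (cases "?c n = 0")
      case True
      then show ?thesis using n by (simp add: D_def)
    next
      case False
      have "?c n \<le> Suc C * n ^ 4" using assms[OF n] by (simp add: le_trans)
      then have "real (?c n) \<le> D * real n ^ 4"
        unfolding D_def by (metis of_nat_le_iff of_nat_mult of_nat_power)
      then have "ln (real (?c n)) \<le> ln (D * real n ^ 4)" using False by simp
      also have "\<dots> = ln D + 4 * ln (real n)" using D n by (simp add: ln_mult ln_realpow)
      finally show ?thesis .
    qed
    then show ?thesis by (rule divide_right_mono) simp
  qed
  have "(\<lambda>n. (ln D + 4 * ln (real n)) / real n) \<longlonglongrightarrow> 0" by real_asymp
  then have "?f \<longlonglongrightarrow> 0"
    by (rule tendsto_sandwich[rotated 2, OF tendsto_const])
      (use lo hi in \<open>auto intro: always_eventually eventually_mono[OF eventually_ge_at_top[of 1]]\<close>)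
  then have "(\<lambda>n. ereal (?f n)) \<longlonglongrightarrow> ereal 0" by simp
  then have "limsup (\<lambda>n. ereal (?f n)) = ereal 0" by (rule lim_imp_Limsup[rotated]) simp
  then show ?thesis by (simp add: sequence_entropy_def zero_ereal_def)
qed

context free_grp2
begin

lemma null_X: "null_action G XS actX"
  unfolding null_action_def
proof (intro allI impI, elim conjE)
  fix s :: "nat \<Rightarrow> 'a" and \<U>
  assume "range s \<subseteq> carrier G" and U: "open_cover XS \<U>"
  then have s: "s i \<in> carrier G" for i by auto
  obtain N where N: "\<And>p. p \<in> XS \<Longrightarrow> \<exists>U\<in>\<U>. \<forall>p'\<in>XS. (\<forall>i<N. p' i = p i) \<longrightarrow> p' \<in> U"
    using open_cover_window[OF compact_X U] by blast
  \<comment> \<open>One more than the window size, so that \<open>W\<close> below is nonempty even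
    for \<open>N = 0\<close>.\<close>
  define M where "M = Suc N"
  define C where "C = card Lt * 2 ^ M * Suc M ^ 4"
  have "cover_number XS (join_cover XS actX s n \<U>) \<le> C * n ^ 4" if n: "n \<ge> 1" for n
  proof -
    \<comment> \<open>These are the vertices that the first \<open>M\<close> coordinates of the
      translates by \<open>s 1\<close> to \<open>s n\<close> read; their number grows linearly in
      \<open>n\<close>.\<close>
    define W where "W = (\<lambda>(i, j). inv (s i) \<otimes> de j) ` ({1..n} \<times> {..<M})"
    have W: "finite W" "W \<noteq> {}" "W \<subseteq> carrier G" using n s by (auto simp: W_def M_def)
    have "card W \<le> card ({1..n} \<times> {..<M})" unfolding W_def by (rule card_image_le) simp
    then have cW: "card W \<le> n * M" by (simp add: card_cartesian_product)
    define f where "f = (\<lambda>(y :: 'a \<Rightarrow> 'a, w :: nat \<Rightarrow> bool, z). (restrict y W, restrict w {..<M}, {h\<in>W. z h}))"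
    have fin: "finite (f ` flagged)" and cF: "card (f ` flagged) \<le> (card W * card Lt) * 2 ^ M * (card W * (Suc (card W) * Suc (card W)))"
      using card_patterns[OF W, of M] unfolding f_def by blast+
    have agree: "encX (shX (s i) x) k = encX (shX (s i) x') k"
      if e: "f x = f x'" and i: "i \<in> {1..n}" and k: "k < M" for x x' i k
    proof -
      obtain y w z y' w' z' where x: "x = (y, w, z)" "x' = (y', w', z')" by (cases x, cases x') auto
      have yW: "y h = y' h" "z h = z' h" if "h \<in> W" for h
        using e that unfolding f_def x by (auto simp: restrict_def fun_eq_iff set_eq_iff) metis
      have wM: "w j = w' j" if "j < M" for j
      proof -
        have "restrict w {..<M} j = restrict w' {..<M} j" using e unfolding f_def x by simp
        then show ?thesis using that by simp
      qed
      have iW: "inv (s i) \<otimes> de j \<in> W" if "j < M" for j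
        using i that by (auto simp: W_def)
      show ?thesis
      proof (cases k rule: mod3_cases)
        case (1 j)
        then have "j < M" using k by simp
        then show ?thesis using yW(1)[OF iW] 1 by (simp only: encX_0) (simp add: x shX_def encY_def shY_def)
      next
        case (2 j)
        then have "j < M" using k by simp
        then have "kap (Suc j) w = kap (Suc j) w'" using wM by (intro kap_cong) auto
        then have "addK (\<sigma> (s i)) w j = addK (\<sigma> (s i)) w' j" by (simp add: addK_def)
        then show ?thesis using 2 by (simp only: encX_1) (simp add: x shX_def)
      next
        case (3 j)
        then have "j < M" using k by simp
        then show ?thesis using yW(2)[OF iW] 3 by (simp only: encX_2) (simp add: x shX_def shZ_def)
      qed
    qed
    define u where "u p = (SOME U. U \<in> \<U> \<and> (\<forall>p'\<in>XS. (\<forall>i<N. p' i = p i) \<longrightarrow> p' \<in> U))" for p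
    have u: "u p \<in> \<U> \<and> (\<forall>p'\<in>XS. (\<forall>i<N. p' i = p i) \<longrightarrow> p' \<in> u p)" if "p \<in> XS" for p
      unfolding u_def by (rule someI_ex) (use N[OF that] in \<open>simp only: Bex_def\<close>)
    define r where "r v = (SOME x. x \<in> flagged \<and> f x = v)" for v
    have r: "r v \<in> flagged" "f (r v) = v" if "v \<in> f ` flagged" for v
      using someI_ex[of "\<lambda>x. x \<in> flagged \<and> f x = v"] that unfolding r_def by auto
    define J where "J v = XS \<inter> (\<Inter>i\<in>{1..n}. {p \<in> XS. actX (s i) p \<in> u (encX (shX (s i) (r v)))})" for v
    have "cover_number XS (join_cover XS actX s n \<U>) \<le> card (J ` f ` flagged)"
    proof (rule cover_number_le)
      show "J ` f ` flagged \<subseteq> join_cover XS actX s n \<U>"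
      proof (rule image_subsetI)
        fix v assume v: "v \<in> f ` flagged"
        have "\<forall>i\<in>{1..n}. u (encX (shX (s i) (r v))) \<in> \<U>" using u flagged_shX[OF s r(1)[OF v]] by blast
        then show "J v \<in> join_cover XS actX s n \<U>"
          unfolding join_cover_def J_def
          by (intro CollectI exI[of _ "\<lambda>i. u (encX (shX (s i) (r v)))"] conjI refl)
      qed
      show "finite (J ` f ` flagged)" using fin by simp
      show "XS \<subseteq> \<Union> (J ` f ` flagged)"
      proof
        fix p assume p: "p \<in> XS"
        then obtain x where x: "x \<in> flagged" "p = encX x" by auto
        have v: "f x \<in> f ` flagged" using x by simp
        have "actX (s i) p \<in> u (encX (shX (s i) (r (f x))))" if i: "i \<in> {1..n}" for i
        proof -
          have "\<forall>k<N. encX (shX (s i) x) k = encX (shX (s i) (r (f x))) k"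
            by (intro allI impI agree[OF r(2)[OF v, symmetric] i]) (simp add: M_def)
          moreover have "encX (shX (s i) x) \<in> XS" "encX (shX (s i) (r (f x))) \<in> XS"
            by (intro imageI flagged_shX s x(1) r(1)[OF v])+
          ultimately show ?thesis
            unfolding x(2) actX[OF x(1)] by (intro u[THEN conjunct2, THEN bspec, THEN mp])
        qed
        then have "p \<in> J (f x)" using p by (simp add: J_def)
        then show "p \<in> \<Union> (J ` f ` flagged)" using v by blast
      qed
    qed
    also have "\<dots> \<le> card (f ` flagged)" by (rule card_image_le[OF fin])
    also note cF
    also have "(card W * card Lt) * 2 ^ M * (card W * (Suc (card W) * Suc (card W))) \<le> C * n ^ 4"
    proof -
      \<comment> \<open>As \<open>n \<ge> 1\<close>, the additional \<open>1\<close> is absorbed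
        into the factor \<open>Suc M\<close>; four such factors give \<open>n ^ 4\<close>.\<close>
      have a: "card W \<le> Suc M * n" "Suc (card W) \<le> Suc M * n" using cW n by (simp_all add: algebra_simps)
      have "(card W * card Lt) * 2 ^ M * (card W * (Suc (card W) * Suc (card W)))
          = card Lt * 2 ^ M * (card W * (card W * (Suc (card W) * Suc (card W))))" by (simp only: ac_simps)
      also have "\<dots> \<le> card Lt * 2 ^ M * ((Suc M * n) * ((Suc M * n) * ((Suc M * n) * (Suc M * n))))"
        by (intro mult_le_mono a order_refl)
      also have "\<dots> = C * n ^ 4" unfolding C_def by (simp only: power4_eq_xxxx ac_simps)
      finally show ?thesis .
    qed
    finally show ?thesis .
  qed
  then show "sequence_entropy XS actX s \<U> = 0" by (rule sequence_entropy_zero)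
qed

text \<open>Among the three letters \<open>a\<close>, \<open>inv a\<close>, \<open>b\<close> one
  differs from the first letters of \<open>u\<close> and of \<open>inv u\<close>. An end with this
  letter at \<open>\<one>\<close> looks back from \<open>inv u\<close> along \<open>head u\<close>,
  so the two translates differ at \<open>t\<close>.\<close>

lemma effective_Y: "effective_action G YS actY"
  unfolding effective_action_def
proof (intro ballI impI)
  fix s t assume s: "s \<in> carrier G" and t: "t \<in> carrier G" and st: "s \<noteq> t"
  define u where "u = inv t \<otimes> s"
  have u: "u \<in> carrier G" using s t by (simp add: u_def)
  have u1: "u \<noteq> \<one>" using s t st unfolding u_def by (metis inv_closed inv_equality inv_inv)
  have "\<exists>l\<in>Lt. l \<noteq> head u \<and> l \<noteq> head (inv u)"
  proof -
    have "a \<noteq> inv a" "b \<noteq> inv a" "a \<noteq> b" using Lt_neq_inv[of a] ab b_neq_inv_a by auto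
    then have "{a, inv a, b} - {head u, head (inv u)} \<noteq> {}" by auto
    then show ?thesis by auto
  qed
  then obtain l where l: "l \<in> Lt" "l \<noteq> head u" "l \<noteq> head (inv u)" by blast
  obtain k where k: "k \<in> carrier G" "shY k (pole a) \<one> = l" using orbit_letter[OF l(1) one_closed] by blast
  define y where "y = shY k (pole a)"
  have y: "y \<in> ends" "y \<one> = l" using k pole_ends ends_shY by (simp_all add: y_def)
  have "inv (inv t \<otimes> s) = inv s \<otimes> t" using s t by (simp add: inv_mult_group)
  then have "inv u \<noteq> \<one>" using u u1 by (metis inv_inv inv_one)
  then have "y (\<one> \<otimes> inv u) = head (inv (inv u))"
    using pointing_propagate[of "inv u", THEN spec[of _ y], THEN spec[of _ \<one>]] y l u by (simp add: ends_def)
  then have yu: "y (inv u) \<noteq> l" using u l by simp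
  have "shY s y \<noteq> shY t y"
  proof
    assume "shY s y = shY t y"
    then have "shY s y t = shY t y t" by simp
    then have "y (inv s \<otimes> t) = l" using s t y by (simp add: shY_def)
    then show False using yu s t by (simp add: u_def inv_mult_group)
  qed
  then have "encY (shY s y) \<noteq> encY (shY t y)"
    using inj_encY ends_shY s t y by (metis inj_onD)
  then show "\<exists>p\<in>YS. actY s p \<noteq> actY t p" using actY y(1) by (intro bexI[of _ "encY y"]) auto
qed

section \<open>Ends approximating the axis, and non-openness\<close>

text \<open>The end obtained by following \<open>a\<close> for \<open>m\<close> steps and \<open>b\<close> from then on.\<close>

definition approx :: "nat \<Rightarrow> 'a \<Rightarrow> 'a" where "approx m = shY (a [^] m) (pole b)"

lemma a_pow_int: "a [^] (m::nat) = ap (int m)"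
  by (simp add: int_pow_int)

lemma approx_ends: "approx m \<in> ends"
  unfolding approx_def by (rule ends_shY) (auto simp: pole_ends)

lemma pole_ba: "pole b \<noteq> pole (inv a)"
  using pole_one[of b] pole_one[of "inv a"] b_neq_inv_a by metis

lemma approx_lim:
  assumes g: "g \<in> carrier G" shows "\<exists>N. \<forall>m\<ge>N. approx m g = pole a g"
  unfolding approx_def by (rule contraction[OF a_Lt _ pole_ba g]) (simp add: pole_ends)

lemma exits_approx: "exits (approx m) \<one> k \<longleftrightarrow> k = int m"
proof -
  have "pointing (pole b)" using pole_ends[of b] by (simp add: ends_def)
  have b0: "exits (pole b) \<one> 0"
  proof -
    have "inv a \<notin> pw b" "a \<notin> pw b"
      using head_pw[of b a] head_letter[of a] ab b_neq_inv_a Lt_neq_one[of a] pw_inv[of b "inv a"]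
      by (auto dest!: inv_eq_1_iff[THEN iffD1])
    then have "pole b (inv a) = a" using head_letter[of a] by (simp add: pole_def)
    moreover have "pole b \<one> \<noteq> a" using ab by (simp add: pole_one)
    ultimately show ?thesis by (simp add: exits_def ap_m1)
  qed
  have "exits (approx m) \<one> k \<longleftrightarrow> exits (pole b) (\<one> \<otimes> ap (- int m)) k"
    by (simp add: approx_def exits_shY a_pow_int int_pow_neg)
  also have "\<dots> \<longleftrightarrow> exits (pole b) \<one> (- int m + k)" by (rule exits_ap) simp
  also have "\<dots> \<longleftrightarrow> k = int m"
    using b0 exits_unique[OF \<open>pointing (pole b)\<close> one_closed b0] by fastforce
  finally show ?thesis .
qed

lemma not_stays_approx: "g \<in> carrier G \<Longrightarrow> \<not> stays (approx m) g"
  by (simp add: approx_def stays_shY not_stays_pole_b)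

lemma not_critical_sh_approx: "\<lbrakk>k \<in> carrier G; g \<in> carrier G\<rbrakk> \<Longrightarrow> \<not> critical (shY k (approx m)) w g"
  by (simp add: critical_def stays_shY not_stays_approx)

text \<open>Any other end is attracted by \<open>inv a\<close>, so at some height on the axis it
  would look down.\<close>

lemma stays_pole:
  assumes y: "y \<in> ends" and I: "stays y \<one>" shows "y = pole a"
proof (rule ccontr)
  assume n: "y \<noteq> pole a"
  have "\<exists>N. \<forall>m\<ge>N. shY (inv a [^] (m::nat)) y \<one> = pole (inv a) \<one>"
    using contraction[of "inv a" y \<one>] n y by simp
  then obtain m :: nat where "shY (inv a [^] m) y \<one> = inv a" using pole_one by auto
  then have "y (ap (int m)) = inv a" using shY_pow[of "inv a" \<one> m y] by (simp add: a_pow_int)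
  moreover have "y (ap (int m)) = a" using I unfolding stays_def by (metis l_one int_pow_closed a_car of_nat_0_le_iff)
  ultimately show False using Lt_neq_inv[of a] by simp
qed

lemma stays_pole_shift:
  assumes y: "y \<in> ends" and g: "g \<in> carrier G" and I: "stays y g" shows "y = shY g (pole a)"
proof -
  have "stays (shY (inv g) y) \<one>" using stays_shY[of "inv g" \<one> y] g I by simp
  then have "shY (inv g) y = pole a" using stays_pole ends_shY[of "inv g" y] y g by simp
  then have "shY g (pole a) = shY (g \<otimes> inv g) y" using shY_mult[of g "inv g" y] g by simp
  then show ?thesis using shY_one[OF y] g by simp
qed

lemma critical_zero: "critical (pole a) (\<lambda>_. False) \<one>"
  using stays_pole_a by (simp add: critical_def kap_def)

lemma convY_approx:
  assumes r: "\<And>n. r n \<ge> n" shows "convY (\<lambda>n. approx (r n)) (pole a)"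
  unfolding convY_def
proof
  fix g assume "g \<in> carrier G"
  then obtain N where "\<forall>m\<ge>N. approx m g = pole a g" using approx_lim by blast
  then show "\<forall>\<^sub>F n in sequentially. approx (r n) g = pole a g"
    unfolding eventually_sequentially using r le_trans by blast
qed

text \<open>For \<open>n \<ge> 1\<close> the exit height \<open>2 ^ n + 1\<close> is odd and greater
  than \<open>1\<close>, hence no power of \<open>2\<close>; \<open>n = 0\<close> would give
  \<open>2\<close>.\<close>

lemma approx_in_flagged_z:
  assumes "(approx (2 ^ n + 1), w, z) \<in> flagged" "n \<ge> 1" shows "\<not> z \<one>"
proof -
  have "\<not> critical (approx (2 ^ n + 1)) w \<one>" using not_stays_approx[of \<one>] by (simp add: critical_def)
  then have "z \<one> = flag (approx (2 ^ n + 1)) w \<one>" using assms(1) by (simp add: flagged_def)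
  also have "\<not> flag (approx (2 ^ n + 1)) w \<one>"
  proof
    assume "flag (approx (2 ^ n + 1)) w \<one>"
    then obtain j where "(2::int) ^ j = int (2 ^ n + 1)" unfolding flag_def exits_approx by blast
    then have e: "(2::nat) ^ j = 2 ^ n + 1" by (metis of_nat_eq_iff of_nat_numeral of_nat_power)
    have "odd ((2::nat) ^ n + 1)" using assms(2) by simp
    then have "odd ((2::nat) ^ j)" using e by simp
    then have "j = 0" by (cases j) auto
    then show False using e by simp
  qed
  finally show ?thesis .
qed

lemma not_open: "\<not> open_extension XS YS prj"
proof
  assume "open_extension XS YS prj"
  \<comment> \<open>The doubled point with its free flag at \<open>\<one>\<close> raised;
    \<open>i\<close> below is the coordinate that records this flag.\<close>
  define x where "x = (pole a, \<lambda>_::nat. False, \<lambda>g. g = \<one> \<or> g \<in> carrier G \<and> flag (pole a) (\<lambda>_. False) g)"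
  have x: "x \<in> flagged"
    using pole_ends[of a] critical_zero by (auto simp: flagged_def x_def)
  define i where "i = 3 * en \<one> + 2"
  define V where "V = {p :: nat \<Rightarrow> real. p i > 1/2}"
  have enc_i: "encX t i = of_bool (snd (snd t) \<one>)" for t
    unfolding i_def encX_2 by simp
  have "open V" unfolding V_def
    by (intro open_Collect_less continuous_on_const continuous_on_product_coordinates)
  then have "openin (top_of_set XS) (XS \<inter> V)" by auto
  then have "openin (top_of_set YS) (prj ` (XS \<inter> V))"
    using \<open>open_extension XS YS prj\<close> by (simp add: open_extension_def)
  then obtain T where T: "open T" "prj ` (XS \<inter> V) = YS \<inter> T" by (auto simp: openin_open)
  have "encX x \<in> XS \<inter> V" using x enc_i[of x] by (simp add: V_def x_def)
  then have "prj (encX x) \<in> T" using T by blast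
  then have "encY (pole a) \<in> T" using prj[OF x] by (simp add: x_def)
  have "convY (\<lambda>n. approx (2 ^ n + 1)) (pole a)"
    by (rule convY_approx) (metis add.commute le_add2 le_trans less_exp nat_less_le)
  then have "(\<lambda>n. encY (approx (2 ^ n + 1))) \<longlonglongrightarrow> encY (pole a)"
    using encY_lim approx_ends pole_ends by simp
  then have "\<forall>\<^sub>F n in sequentially. encY (approx (2 ^ n + 1)) \<in> T"
    using T(1) \<open>encY (pole a) \<in> T\<close> by (rule topological_tendstoD)
  then obtain n where n: "n \<ge> 1" "encY (approx (2 ^ n + 1)) \<in> T"
    using eventually_happens[OF eventually_conj[OF _ eventually_ge_at_top[of 1]]] by force
  then have "encY (approx (2 ^ n + 1)) \<in> prj ` (XS \<inter> V)" using T approx_ends by blast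
  then obtain t where t: "t \<in> flagged" "encX t \<in> V" "encY (approx (2 ^ n + 1)) = prj (encX t)" by blast
  have "fst t = approx (2 ^ n + 1)"
    using inj_onD[OF inj_encY _ flagged_fst[OF t(1)] approx_ends] t(3) prj[OF t(1)] by simp
  then have "(approx (2 ^ n + 1), fst (snd t), snd (snd t)) \<in> flagged" using t(1) by (metis prod.collapse)
  then have "\<not> snd (snd t) \<one>" using approx_in_flagged_z n(1) by blast
  then show False using t(2) enc_i[of t] by (simp add: V_def)
qed

end

section \<open>Minimality and point-distality\<close>

context free_grp2
begin

lemma convY_unique: "\<lbrakk>convY ys y; convY ys y'; y \<in> ends; y' \<in> ends\<rbrakk> \<Longrightarrow> y = y'"
proof
  fix g assume c: "convY ys y" "convY ys y'" and y: "y \<in> ends" "y' \<in> ends"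
  show "y g = y' g"
  proof (cases "g \<in> carrier G")
    case True
    then have "\<forall>\<^sub>F n in sequentially. ys n g = y g \<and> ys n g = y' g"
      using c by (simp add: convY_def eventually_conj_iff)
    then show ?thesis using eventually_happens[of _ sequentially] by fastforce
  qed (use y in \<open>simp add: ends_def\<close>)
qed

lemma eventually_eq_unique:
  assumes "\<forall>\<^sub>F n in sequentially. f n = u" "\<forall>\<^sub>F n in sequentially. f n = v" shows "u = v"
  using eventually_happens[OF eventually_conj[OF assms]] by auto

text \<open>Compactness yields a limit in \<open>T\<close> over the prescribed end; the last clause
  lets the 2-adic coordinate of the limit be prescribed as well.\<close>

lemma minimal_step:
  assumes sub: "T \<subseteq> flagged" and cl: "\<forall>xs x. (\<forall>n. xs n \<in> T) \<and> convX xs x \<and> x \<in> flagged \<longrightarrow> x \<in> T"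
    and xs: "\<And>n. xs n \<in> T" and y: "convY (\<lambda>n. fst (xs n)) y" "y \<in> ends"
  obtains w z where "(y, w, z) \<in> T"
    "\<forall>w'. (\<forall>i. \<forall>\<^sub>F n in sequentially. fst (snd (xs n)) i = w' i) \<longrightarrow> w = w'"
proof -
  obtain x r where x: "x \<in> flagged" "strict_mono (r :: nat \<Rightarrow> nat)" "convX (xs \<circ> r) x"
    using flagged_subseq[of xs] xs sub by blast
  have xT: "x \<in> T"
    using cl[THEN spec[of _ "xs \<circ> r"], THEN spec[of _ x]] x xs by simp
  have "convY (\<lambda>n. fst (xs (r n))) y"
    unfolding convY_def
  proof
    fix g assume "g \<in> carrier G"
    then show "\<forall>\<^sub>F n in sequentially. fst (xs (r n)) g = y g"
      using eventually_subseq[OF x(2), of "\<lambda>n. fst (xs n) g = y g"] y(1) by (simp add: convY_def)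
  qed
  moreover have "convY (\<lambda>n. fst (xs (r n))) (fst x)" using x(3) by (simp add: convX_def)
  ultimately have fy: "fst x = y" using convY_unique y(2) flagged_fst[OF x(1)] by blast
  have "fst (snd x) = w'" if "\<And>i. \<forall>\<^sub>F n in sequentially. fst (snd (xs n)) i = w' i" for w'
  proof
    fix i
    have "\<forall>\<^sub>F n in sequentially. fst (snd (xs (r n))) i = w' i"
      using eventually_subseq[OF x(2), of "\<lambda>n. fst (snd (xs n)) i = w' i"] that by simp
    moreover have "\<forall>\<^sub>F n in sequentially. fst (snd (xs (r n))) i = fst (snd x) i"
      using x(3) by (simp add: convX_def)
    ultimately show "fst (snd x) i = w' i" by (metis eventually_eq_unique)
  qed
  then show thesis using that[of "fst (snd x)" "snd (snd x)"] xT fy by (metis prod.collapse)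
qed

lemma minimal_core:
  assumes sub: "T \<subseteq> flagged" and ne: "T \<noteq> {}"
    and cl: "\<forall>xs x. (\<forall>n. xs n \<in> T) \<and> convX xs x \<and> x \<in> flagged \<longrightarrow> x \<in> T"
    and inv: "\<And>g x. \<lbrakk>g \<in> carrier G; x \<in> T\<rbrakk> \<Longrightarrow> shX g x \<in> T"
  shows "T = flagged"
proof
  have contr: "\<exists>w z. (pole c, w, z) \<in> T" if c: "c \<in> Lt" and x: "x \<in> T" and n: "fst x \<noteq> pole (inv c)" for c x
  proof -
    have "fst (shX (c [^] n) x) = shY (c [^] n) (fst x)" for n :: nat by (simp add: shX_def split_beta)
    moreover have "fst x \<in> ends" using flagged_fst x sub by blast
    ultimately have 1: "convY (\<lambda>n::nat. fst (shX (c [^] n) x)) (pole c)"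
      using contraction[OF c _ n] by (simp add: convY_def eventually_sequentially)
    have 2: "shX (c [^] n) x \<in> T" for n :: nat using inv x c by simp
    obtain w z where "(pole c, w, z) \<in> T"
      using minimal_step[OF sub cl 2 1 pole_ends[OF c]] by blast
    then show ?thesis by blast
  qed
  obtain x where x: "x \<in> T" using ne by blast
  \<comment> \<open>A point over the repelling end of \<open>a\<close> is first moved over
    \<open>pole b\<close>, so that the powers of \<open>a\<close> can act afterwards.\<close>
  have "\<exists>x\<in>T. fst x \<noteq> pole (inv a)"
  proof (cases "fst x = pole (inv a)")
    case True
    have "inv a \<noteq> inv b" using ab by (metis a_car b_car inv_inv)
    then have "fst x \<noteq> pole (inv b)" using True pole_one by metis
    then obtain w z where "(pole b, w, z) \<in> T" using contr[OF b_Lt x] by blast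
    then show ?thesis using pole_ba by (intro bexI[of _ "(pole b, w, z)"]) auto
  qed (use x in blast)
  then obtain w0 z0 where x0: "(pole a, w0, z0) \<in> T" using contr[OF a_Lt] by blast
  have fiber: "\<exists>z. (pole a, w, z) \<in> T" for w
  proof -
    \<comment> \<open>Powers of \<open>a\<close> fix \<open>pole a\<close> and translate the 2-adic
      coordinate. With this exponent, \<open>inv a\<close> carries \<open>w0\<close> to a point that
      agrees with \<open>w\<close> in the first \<open>i\<close> digits.\<close>
    define n where "n i = nat ((kap i w0 - kap i w) mod 2 ^ i)" for i
    define xs where "xs i = shX (inv a [^] n i) (pole a, w0, z0)" for i
    have fx: "fst (xs i) = pole a" for i
      using shY_pole_inv[of "inv a" "n i"] by (simp add: xs_def shX_def)
    have "kap i (fst (snd (xs i))) = kap i w" for i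
    proof -
      have "int (n i) = (kap i w0 - kap i w) mod 2 ^ i" by (simp add: n_def)
      then have "kap i (fst (snd (xs i))) = (kap i w0 - (kap i w0 - kap i w) mod 2 ^ i) mod 2 ^ i"
        by (simp add: xs_def shX_def inv_a_pow \<sigma>_ap kap_addK)
      also have "\<dots> = kap i w mod 2 ^ i" by (simp add: mod_diff_right_eq)
      finally show ?thesis by (simp add: kap_mod)
    qed
    then have pre: "\<forall>j<i. fst (snd (xs i)) j = w j" for i unfolding kap_eq_iff .
    have ev: "\<forall>\<^sub>F i in sequentially. fst (snd (xs i)) j = w j" for j
      using eventually_gt_at_top[of j] by eventually_elim (use pre in blast)
    have 1: "xs i \<in> T" for i using inv[OF _ x0] by (simp add: xs_def)
    have 2: "convY (\<lambda>i. fst (xs i)) (pole a)" by (simp add: fx convY_def)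
    obtain w' z where z: "(pole a, w', z) \<in> T"
      "\<forall>w''. (\<forall>i. \<forall>\<^sub>F n in sequentially. fst (snd (xs n)) i = w'' i) \<longrightarrow> w' = w''"
      by (rule minimal_step[OF sub cl 1 2 pole_ends[OF a_Lt]])
    have "w' = w" using z(2) ev by blast
    then show ?thesis using z(1) by blast
  qed
  have all: "\<exists>z. (y, w, z) \<in> T" if y: "y \<in> ends" for y w
  proof -
    have "\<exists>k\<in>carrier G. \<forall>h\<in>de ` {..<n}. shY k (pole a) h = y h" for n :: nat
      by (rule orbit_dense[OF y]) auto
    then obtain k where k: "\<And>n. k n \<in> carrier G" "\<And>n i. i < n \<Longrightarrow> shY (k n) (pole a) (de i) = y (de i)"
      by (metis imageI lessThan_iff)
    \<comment> \<open>The 2-adic coordinate is shifted back in advance, so that it is exactly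
      \<open>w\<close> after the action of \<open>k n\<close>.\<close>
    define z where "z n = (SOME z. (pole a, addK (- \<sigma> (k n)) w, z) \<in> T)" for n
    have z: "(pole a, addK (- \<sigma> (k n)) w, z n) \<in> T" for n
      unfolding z_def by (rule someI_ex[OF fiber])
    define xs where "xs n = shX (k n) (pole a, addK (- \<sigma> (k n)) w, z n)" for n
    have 1: "xs n \<in> T" for n using inv[OF k(1) z] by (simp add: xs_def)
    have 2: "convY (\<lambda>n. fst (xs n)) y"
      unfolding convY_def
    proof
      fix g assume g: "g \<in> carrier G"
      show "\<forall>\<^sub>F n in sequentially. fst (xs n) g = y g"
        using eventually_gt_at_top[of "en g"]
        by eventually_elim (use k(2)[of "en g"] g in \<open>simp add: xs_def shX_def\<close>)
    qed
    have "fst (snd (xs n)) = w" for n by (simp add: xs_def shX_def addK_addK)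
    then have 3: "\<forall>\<^sub>F n in sequentially. fst (snd (xs n)) i = w i" for i by simp
    obtain w' z' where z': "(y, w', z') \<in> T"
      "\<forall>w''. (\<forall>i. \<forall>\<^sub>F n in sequentially. fst (snd (xs n)) i = w'' i) \<longrightarrow> w' = w''"
      by (rule minimal_step[OF sub cl 1 2 y])
    have "w' = w" using z'(2) 3 by blast
    then show ?thesis using z'(1) by blast
  qed
  have reg: "sec y w \<in> T" if "y \<in> ends" "\<And>g. g \<in> carrier G \<Longrightarrow> \<not> critical y w g" for y w
    using all[OF that(1), of w] regular_eq_sec that(2) sub by (metis subsetD)
  show "flagged \<subseteq> T"
  proof
    fix x assume x: "x \<in> flagged"
    obtain y w z where xx: "x = (y, w, z)" by (cases x) auto
    have y: "y \<in> ends" "pointing y" using x xx by (auto simp: flagged_def ends_def)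
    show "x \<in> T"
    proof (cases "\<exists>g\<in>carrier G. critical y w g")
      case False
      then show ?thesis using reg[OF y(1)] regular_eq_sec[of y w z] x xx by auto
    next
      case True
      then obtain g where g: "g \<in> carrier G" "critical y w g" by blast
      \<comment> \<open>The exit height decides the flag at \<open>g\<close>, because all
        congruences hold there: a power of \<open>2\<close> raises it, an odd number greater than
        \<open>1\<close> does not. \<open>Suc n\<close> makes the second height odd also for
        \<open>n = 0\<close>.\<close>
      define r :: "nat \<Rightarrow> nat" where "r n = (if z g then 2 ^ n else 2 ^ Suc n + 1)" for n
      have rn: "r n \<ge> n" for n
      proof -
        have 1: "n < 2 ^ n" by (rule less_exp)
        then have 2: "n \<le> 2 ^ Suc n + 1" unfolding power_Suc by linarith
        show ?thesis using less_imp_le[OF 1] 2 unfolding r_def by presburger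
      qed
      define ys where "ys n = shY g (approx (r n))" for n
      have ys: "ys n \<in> ends" for n using ends_shY[OF g(1) approx_ends] by (simp add: ys_def)
      have "y = shY g (pole a)" using stays_pole_shift[OF y(1) g(1)] g(2) by (simp add: critical_def)
      then have lim: "convY ys y" unfolding ys_def using convY_shY[OF convY_approx[of r] g(1)] rn by simp
      have dv: "2 ^ Suc j dvd kap (Suc j) w - \<sigma> g" for j using g(2) unfolding critical_def by blast
      have fzg: "flag (ys n) w g = z g" for n
      proof -
        have "flag (ys n) w g \<longleftrightarrow> (\<exists>j. (2::int) ^ j = int (r n))"
          unfolding flag_def ys_def using dv by (simp only: exits_shY[OF g(1) g(1)] l_inv[OF g(1)] exits_approx simp_thms)
        also have "\<dots> \<longleftrightarrow> z g"
        proof (cases "z g")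
          case True
          then show ?thesis by (auto simp: r_def)
        next
          case False
          have "(2::int) ^ j \<noteq> int (2 ^ Suc n + 1)" for j
          proof
            assume e: "(2::int) ^ j = int (2 ^ Suc n + 1)"
            then have "odd ((2::int) ^ j)" by simp
            then have "j = 0" by (cases j) auto
            then show False using e by simp
          qed
          then show ?thesis using False by (simp add: r_def)
        qed
        finally show ?thesis .
      qed
      have "convX (\<lambda>n. sec (ys n) w) (y, w, z)"
      proof (rule sec_lim[OF ys _ lim])
        show "(y, w, z) \<in> flagged" using x xx by simp
        fix h assume "h \<in> carrier G" "critical y w h"
        then have "h = g" using critical_unique[OF y(2)] g by blast
        then show "\<forall>\<^sub>F n in sequentially. flag (ys n) w h = z h" using fzg by simp
      qed simp
      moreover have "sec (ys n) w \<in> T" for n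
        by (rule reg[OF ys]) (simp add: ys_def not_critical_sh_approx g(1))
      ultimately show ?thesis
        using cl[THEN spec[of _ "\<lambda>n. sec (ys n) w"], THEN spec[of _ x]] x xx by blast
    qed
  qed
qed (rule sub)

lemma minimal_X: "minimal_action G XS actX"
  unfolding minimal_action_def
proof (intro allI impI, elim conjE)
  fix Z assume Z: "closedin (top_of_set XS) Z" and ne: "Z \<noteq> {}"
    and inv: "\<forall>g\<in>carrier G. actX g ` Z \<subseteq> Z"
  obtain C where C: "closed C" "Z = XS \<inter> C" using Z unfolding closedin_closed by blast
  define T where "T = {x\<in>flagged. encX x \<in> Z}"
  have "T = flagged"
  proof (rule minimal_core)
    show "T \<noteq> {}" using ne C by (auto simp: T_def)
    have "x \<in> T" if xs: "\<And>n. xs n \<in> T" and c: "convX xs x" and x: "x \<in> flagged" for xs x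
    proof -
    have xX: "xs n \<in> flagged" "encX (xs n) \<in> C" for n using xs[of n] C(2) by (auto simp: T_def)
    have "(\<lambda>n. encX (xs n)) \<longlonglongrightarrow> encX x"
      using encX_lim[of xs x] flagged_fst x xX(1) c by simp
    then have "encX x \<in> C" using closed_sequentially[OF C(1), of "\<lambda>n. encX (xs n)"] xX(2) by simp
    then show ?thesis using x C(2) by (simp add: T_def)
    qed
    then show "\<forall>xs x. (\<forall>n. xs n \<in> T) \<and> convX xs x \<and> x \<in> flagged \<longrightarrow> x \<in> T" by blast
  next
    fix g x assume g: "g \<in> carrier G" and x: "x \<in> T"
    then have "actX g (encX x) \<in> Z" using inv by (auto simp: T_def)
    then show "shX g x \<in> T" using actX flagged_shX[OF g] x by (simp add: T_def)
  qed (auto simp: T_def)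
  then show "Z = XS" using C(2) by (auto simp: T_def)
qed

lemma closure_orbit:
  assumes p: "p \<in> XS" shows "closure {actX g p | g. g \<in> carrier G} = XS"
proof -
  let ?O = "{actX g p | g. g \<in> carrier G}"
  have act: "\<And>g. g \<in> carrier G \<Longrightarrow> continuous_on XS (actX g)" "\<And>g q. \<lbrakk>g \<in> carrier G; q \<in> XS\<rbrakk> \<Longrightarrow> actX g q \<in> XS"
    "\<And>q. q \<in> XS \<Longrightarrow> actX \<one> q = q"
    "\<And>g h q. \<lbrakk>g \<in> carrier G; h \<in> carrier G; q \<in> XS\<rbrakk> \<Longrightarrow> actX (g \<otimes> h) q = actX g (actX h q)"
    using cont_X unfolding cont_action_def by (blast, blast, blast, blast)
  have sub: "?O \<subseteq> XS" using act(2) p by blast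
  then have cs: "closure ?O \<subseteq> XS" by (rule closure_minimal[OF _ compact_imp_closed[OF compact_X]])
  have "actX g ` closure ?O \<subseteq> closure ?O" if g: "g \<in> carrier G" for g
  proof -
    have "actX g ` ?O \<subseteq> ?O"
    proof (rule image_subsetI)
      fix q assume "q \<in> ?O"
      then obtain h where h: "h \<in> carrier G" "q = actX h p" by blast
      then have "actX g q = actX (g \<otimes> h) p" using act(4)[OF g h(1) p] by simp
      then show "actX g q \<in> ?O" using g h(1) by blast
    qed
    then show ?thesis
      using image_closure_subset[OF continuous_on_subset[OF act(1)[OF g] cs], of "closure ?O"]
        closure_subset by (meson closed_closure subset_trans)
  qed
  moreover have "p \<in> ?O" using act(3)[OF p] by force
  then have "closure ?O \<noteq> {}" using closure_subset by blast
  moreover have "closedin (top_of_set XS) (closure ?O)" using cs by (simp add: closed_subset)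
  ultimately show ?thesis
    using minimal_X[unfolded minimal_action_def, THEN spec[of _ "closure ?O"]] by simp
qed

text \<open>The fibre over \<open>pole b\<close> has no critical vertices, so two of its points
  differ in the 2-adic coordinate. The group translates both coordinates by the same integer, hence
  they stay different modulo a fixed \<open>2 ^ j\<close>.\<close>

lemma point_distal_X: "point_distal G XS actX prj"
proof -
  define x where "x = sec (pole b) (\<lambda>_. False)"
  have x: "x \<in> flagged" using sec_flagged pole_ends by (simp add: x_def)
  have "closure {(actX g (encX x), actX g q) | g. g \<in> carrier G} \<inter> {(z, z) | z. True} = {}"
    if q: "q \<in> XS" "q \<noteq> encX x" "prj q = prj (encX x)" for q
  proof (rule ccontr)
    assume "\<not> ?thesis"
    then obtain p where p: "(p, p) \<in> closure {(actX g (encX x), actX g q) | g. g \<in> carrier G}" by blast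
    obtain x' where x': "x' \<in> flagged" "q = encX x'" using q by blast
    obtain y w z where xx': "x' = (y, w, z)" by (cases x') auto
    have "y = pole b"
      using q(3) prj[OF x'(1)] prj[OF x] x'(2) inj_onD[OF inj_encY] flagged_fst[OF x'(1)] pole_ends[OF b_Lt]
      by (simp add: x_def sec_def xx')
    then have "x' = sec (pole b) w"
      using regular_eq_sec[of "pole b" w z] x'(1) xx' not_stays_pole_b by (simp add: critical_def)
    then have "w \<noteq> (\<lambda>_. False)" using q(2) x'(2) by (auto simp: x_def)
    then obtain j where j: "kap j w \<noteq> kap j (\<lambda>_. False)" using kap_inj by blast
    obtain u where u: "\<And>n. u n \<in> {(actX g (encX x), actX g q) | g. g \<in> carrier G}" "u \<longlonglongrightarrow> (p, p)"
      using p unfolding closure_sequential by blast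
    have "\<forall>n. \<exists>g. g \<in> carrier G \<and> u n = (actX g (encX x), actX g q)" using u(1) by blast
    then obtain k where k: "\<And>n. k n \<in> carrier G" "\<And>n. u n = (actX (k n) (encX x), actX (k n) q)" by metis
    have l1: "(\<lambda>n. encX (shX (k n) x)) \<longlonglongrightarrow> p" "(\<lambda>n. encX (shX (k n) x')) \<longlonglongrightarrow> p"
      using tendsto_fst[OF u(2)] tendsto_snd[OF u(2)] k(2) x' actX[OF x] actX[OF x'(1)] by simp_all
    have "\<forall>\<^sub>F n in sequentially. fst (snd (shX (k n) x)) i = fst (snd (shX (k n) x')) i" for i
    proof -
      have "(\<lambda>n. encX (shX (k n) x) (3 * i + 1) - encX (shX (k n) x') (3 * i + 1))
          \<longlonglongrightarrow> p (3 * i + 1) - p (3 * i + 1)"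
        using l1 unfolding tendsto_fun_iff by (intro tendsto_diff) blast+
      from tendstoD[OF this, of 1]
      have "\<forall>\<^sub>F n in sequentially. \<bar>encX (shX (k n) x) (3 * i + 1) - encX (shX (k n) x') (3 * i + 1)\<bar> < 1"
        by (simp add: dist_real_def)
      then show ?thesis
        unfolding encX_1 by eventually_elim (auto simp: of_bool_def split: if_splits)
    qed
    then have "\<forall>\<^sub>F n in sequentially. \<forall>i\<in>{..<j}. fst (snd (shX (k n) x)) i = fst (snd (shX (k n) x')) i"
      by (intro eventually_ball_finite) auto
    then obtain n where "\<forall>i\<in>{..<j}. fst (snd (shX (k n) x)) i = fst (snd (shX (k n) x')) i"
      using eventually_happens[of _ sequentially] by fastforce
    then have "kap j (fst (snd (shX (k n) x))) = kap j (fst (snd (shX (k n) x')))"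
      by (intro kap_cong) auto
    then have e: "(kap j (\<lambda>_. False) + \<sigma> (k n)) mod 2 ^ j = (kap j w + \<sigma> (k n)) mod 2 ^ j"
      by (simp add: shX_def x_def sec_def xx' kap_addK)
    then have "kap j (\<lambda>_. False) mod 2 ^ j = kap j w mod 2 ^ j"
      by (simp add: mod_eq_dvd_iff)
    then show False using j kap_mod[of j j] by simp
  qed
  then show ?thesis
    unfolding point_distal_def
    using closure_orbit[of "encX x"] x by (intro bexI[of _ "encX x"] conjI ballI impI) auto
qed

end

section \<open>Strong proximality\<close>

abbreviation borel_on :: "'c::topological_space set \<Rightarrow> 'c measure" where
  "borel_on X \<equiv> restrict_space borel X"

lemma space_borel_on [simp]: "space (borel_on X) = X"
  by (simp add: space_restrict_space)

lemma topspace_weak_star: "topspace (weak_star_top X) = prob_measures X"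
proof -
  have "prob_measures X = {\<mu> \<in> prob_measures X. (\<integral>x. (0::real) \<partial>\<mu>) \<in> UNIV}" by simp
  then have "prob_measures X \<in> {{\<mu> \<in> prob_measures X. (\<integral>x. f x \<partial>\<mu>) \<in> U} | (f :: 'a \<Rightarrow> real) U.
      continuous_on X f \<and> open U}"
    by (intro CollectI exI[of _ "\<lambda>_. 0"] exI[of _ UNIV]) auto
  then show ?thesis unfolding weak_star_top_def topology_generated_by_topspace by blast
qed

lemma prob_measuresD:
  assumes "\<mu> \<in> prob_measures X"
  shows "sets \<mu> = sets (borel_on X)" "prob_space \<mu>" "space \<mu> = X"
  using assms sets_eq_imp_space_eq[of \<mu> "borel_on X"] by (auto simp: prob_measures_def)

text \<open>The topology is given only by generators, so convergence of integrals is extended to all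
  open sets by induction on how they are generated.\<close>

lemma closedin_weak_star_limit:
  assumes C: "closedin (weak_star_top X) C" and \<nu>n: "\<And>n. \<nu>n n \<in> C" and \<nu>: "\<nu> \<in> prob_measures X"
    and lim: "\<And>f :: _ \<Rightarrow> real. continuous_on X f \<Longrightarrow> (\<lambda>n::nat. \<integral>x. f x \<partial>\<nu>n n) \<longlonglongrightarrow> (\<integral>x. f x \<partial>\<nu>)"
  shows "\<nu> \<in> C"
proof -
  have CP: "\<nu>n n \<in> prob_measures X" for n
    using closedin_subset[OF C] \<nu>n topspace_weak_star by blast
  have "\<forall>\<^sub>F n in sequentially. \<nu>n n \<in> U" if "openin (weak_star_top X) U" "\<nu> \<in> U" for U
  proof -
    have "generate_topology_on {{\<mu> \<in> prob_measures X. (\<integral>x. f x \<partial>\<mu>) \<in> U} | (f :: _ \<Rightarrow> real) U.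
      continuous_on X f \<and> open U} U"
      using that(1) unfolding weak_star_top_def by (rule openin_topology_generated_by)
    then show ?thesis using that(2)
    proof induction
      case (Int A B)
      then show ?case by (auto intro: eventually_conj)
    next
      case (UN K)
      then obtain k where k: "k \<in> K" "\<nu> \<in> k" by blast
      then have "\<forall>\<^sub>F n in sequentially. \<nu>n n \<in> k" using UN by blast
      then show ?case by eventually_elim (use k in blast)
    next
      case (Basis s)
      then obtain f :: "_ \<Rightarrow> real" and V where f: "continuous_on X f" "open V"
        "s = {\<mu> \<in> prob_measures X. (\<integral>x. f x \<partial>\<mu>) \<in> V}" by blast
      then have "(\<integral>x. f x \<partial>\<nu>) \<in> V" using Basis by simp
      then have "\<forall>\<^sub>F n in sequentially. (\<integral>x. f x \<partial>\<nu>n n) \<in> V"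
        using lim[OF f(1)] f(2) topological_tendstoD by blast
      then show ?case using CP f(3) by simp
    qed simp
  qed
  then have "limitin (weak_star_top X) \<nu>n \<nu> sequentially"
    using \<nu> by (simp add: limitin_def topspace_weak_star)
  then show ?thesis using limitin_closedin[OF _ C] \<nu>n by force
qed

lemma measurable_on_continuous: "continuous_on X f \<Longrightarrow> f \<in> borel_measurable (borel_on X)"
  by (rule borel_measurable_continuous_on_restrict)

lemma measurable_to_borel_on:
  assumes "f \<in> borel_measurable M" "\<And>x. x \<in> space M \<Longrightarrow> f x \<in> X"
  shows "f \<in> measurable M (borel_on X)"
  using assms by (intro measurable_restrict_space2) auto

lemma measurable_self_map: "\<lbrakk>continuous_on X f; f ` X \<subseteq> X\<rbrakk> \<Longrightarrow> f \<in> measurable (borel_on X) (borel_on X)"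
  by (intro measurable_to_borel_on measurable_on_continuous) auto

lemma distr_in_prob_measures:
  "\<lbrakk>prob_space M; f \<in> measurable M (borel_on X)\<rbrakk> \<Longrightarrow> distr M (borel_on X) f \<in> prob_measures X"
  by (simp add: prob_measures_def prob_space.prob_space_distr)

lemma bounded_dominated:
  fixes f :: "'c::topological_space \<Rightarrow> real"
  assumes M: "prob_space M" and X: "compact X" and f: "continuous_on X f"
    and h: "\<And>n. h n \<in> measurable M (borel_on X)" "h' \<in> measurable M (borel_on X)"
    and lim: "AE w in M. (\<lambda>n. f (h n w)) \<longlonglongrightarrow> f (h' w)"
  shows "(\<lambda>n::nat. \<integral>x. f x \<partial>distr M (borel_on X) (h n)) \<longlonglongrightarrow> (\<integral>x. f x \<partial>distr M (borel_on X) h')"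
proof -
  interpret prob_space M by (rule M)
  have fm: "f \<in> borel_measurable (borel_on X)" using f by (rule measurable_on_continuous)
  have "bounded (f ` X)" using compact_continuous_image[OF f X] by (rule compact_imp_bounded)
  then obtain B where B: "\<And>x. x \<in> X \<Longrightarrow> \<bar>f x\<bar> \<le> B" by (auto simp: bounded_iff)
  have hX: "h n w \<in> X" if "w \<in> space M" for n w using measurable_space[OF h(1) that] by simp
  have "(\<lambda>n. \<integral>w. f (h n w) \<partial>M) \<longlonglongrightarrow> (\<integral>w. f (h' w) \<partial>M)"
  proof (rule integral_dominated_convergence[where w = "\<lambda>_. B"])
    show "AE w in M. norm (f (h n w)) \<le> B" for n by (rule AE_I2) (simp add: B hX)
  qed (use measurable_compose[OF h(1) fm] measurable_compose[OF h(2) fm] lim in auto)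
  then show ?thesis
    using integral_distr[OF h(1) fm] integral_distr[OF h(2) fm] by simp
qed

section \<open>Haar measure on the 2-adic integers\<close>

definition cyl :: "nat \<Rightarrow> (nat \<Rightarrow> bool) \<Rightarrow> (nat \<Rightarrow> bool) set" where
  "cyl j v = {w. \<forall>i<j. w i = v i}"

lemma cyl_kap: "cyl j v = {w. kap j w = kap j v}"
  unfolding cyl_def kap_eq_iff ..

abbreviation bits :: "(nat \<Rightarrow> bool) measure" where
  "bits \<equiv> PiM UNIV (\<lambda>_. count_space UNIV)"

lemma space_bits [simp]: "space bits = UNIV"
  by (simp add: space_PiM)

lemma coord_bits: "(\<lambda>w. w i) \<in> measurable bits (count_space UNIV)"
  by (rule measurable_component_singleton) simp

lemma cyl_sets: "cyl j v \<in> sets bits"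
proof (induction j)
  case 0
  have "cyl 0 v = space bits" by (simp add: cyl_def)
  then show ?case by (simp only: sets.top)
next
  case (Suc j)
  have "(\<lambda>w. w j) -` {v j} \<inter> space bits \<in> sets bits"
    by (rule measurable_sets[OF coord_bits]) simp
  then have "cyl j v \<inter> ((\<lambda>w. w j) -` {v j} \<inter> space bits) \<in> sets bits"
    by (rule sets.Int[OF Suc])
  moreover have "cyl (Suc j) v = cyl j v \<inter> ((\<lambda>w. w j) -` {v j} \<inter> space bits)"
    by (auto simp: cyl_def less_Suc_eq)
  ultimately show ?case by (simp only:)
qed

text \<open>Finitely many representatives of the cylinders of length \<open>j\<close>, extended by
  \<open>False\<close>.\<close>

definition prefixes :: "nat \<Rightarrow> (nat \<Rightarrow> bool) set" where
  "prefixes j = (\<lambda>A i. i \<in> A) ` Pow {..<j}"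

lemma finite_prefixes: "finite (prefixes j)"
  by (simp add: prefixes_def)

lemma ex_prefix: "\<exists>v\<in>prefixes j. w \<in> cyl j v"
  unfolding prefixes_def by (rule bexI[OF _ imageI[of "{i. i < j \<and> w i}"]]) (auto simp: cyl_def)

lemma finitely_determined:
  assumes "\<forall>w w'. (\<forall>i<j. w i = w' i) \<longrightarrow> P w = P w'"
  shows "{w. P w} = (\<Union>v\<in>{v\<in>prefixes j. P v}. cyl j v)"
proof (intro equalityI subsetI)
  fix w assume w: "w \<in> {w. P w}"
  obtain v where v: "v \<in> prefixes j" "w \<in> cyl j v" using ex_prefix by blast
  then have "P w = P v" using assms[THEN spec[of _ w], THEN spec[of _ v]] by (simp add: cyl_def)
  then show "w \<in> (\<Union>v\<in>{v\<in>prefixes j. P v}. cyl j v)" using v w by auto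
next
  fix w assume "w \<in> (\<Union>v\<in>{v\<in>prefixes j. P v}. cyl j v)"
  then obtain v where v: "P v" "w \<in> cyl j v" by auto
  then show "w \<in> {w. P w}" using assms[THEN spec[of _ w], THEN spec[of _ v]] by (simp add: cyl_def)
qed

lemma finitely_determined_sets:
  assumes "\<forall>w w'. (\<forall>i<j. w i = w' i) \<longrightarrow> P w = P w'"
    and S: "\<And>v. cyl j v \<in> sets M"
  shows "{w. P w} \<in> sets M"
  unfolding finitely_determined[OF assms(1)]
  using finite_prefixes S by (intro sets.finite_UN) auto

lemma measurable_to_bits:
  assumes "\<And>i. {x \<in> space M. f x i} \<in> sets M"
  shows "f \<in> measurable M bits"
proof (rule measurable_PiM_single')
  fix i
  have "Measurable.pred M (\<lambda>x. f x i)" using assms[of i] by (simp add: pred_def)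
  then show "(\<lambda>x. f x i) \<in> measurable M (count_space UNIV)" .
qed auto

lemma bits_eqI:
  fixes M N :: "(nat \<Rightarrow> bool) measure"
  assumes M: "prob_space M" "sets M = sets bits" and N: "sets N = sets bits"
    and eq: "\<And>j v. emeasure M (cyl j v) = emeasure N (cyl j v)"
  shows "M = N"
proof -
  \<comment> \<open>The empty set is added because two incompatible cylinders have empty
    intersection.\<close>
  let ?E = "insert {} (range (case_prod cyl))"
  have "sets bits \<subseteq> sigma_sets UNIV ?E"
  proof -
    have m: "(\<lambda>w. w) \<in> measurable (sigma UNIV ?E) bits"
    proof (rule measurable_to_bits)
      fix i
      have "{w. w i} \<in> sets (sigma UNIV ?E)"
        by (rule finitely_determined_sets[of "Suc i"]) (auto intro!: sigma_sets.Basic)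
      then show "{w \<in> space (sigma UNIV ?E). w i} \<in> sets (sigma UNIV ?E)"
        by (simp add: space_measure_of_conv)
    qed
    have "A \<in> sets (sigma UNIV ?E)" if "A \<in> sets bits" for A
      using measurable_sets[OF m that] by (simp add: space_measure_of_conv)
    then show ?thesis by (auto simp: sets_measure_of_conv)
  qed
  moreover have "sigma_sets UNIV ?E \<subseteq> sets bits"
  proof -
    have "?E \<subseteq> sets bits" using cyl_sets by (auto simp: case_prod_beta simp del: space_bits)
    then show ?thesis using sets.sigma_sets_subset[of ?E bits] unfolding space_bits by blast
  qed
  ultimately have S: "sets bits = sigma_sets UNIV ?E" by blast
  show ?thesis
  proof (rule measure_eqI_generator_eq[where E = ?E and \<Omega> = UNIV and A = "\<lambda>_. cyl 0 undefined"])
    have "cyl j u \<inter> cyl k v \<in> ?E" if "j \<le> k" for j k u v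
    proof (cases "\<forall>i<j. v i = u i")
      case True
      then have "cyl j u \<inter> cyl k v = cyl k v" using that by (auto simp: cyl_def)
      then show ?thesis by auto
    next
      case False
      then have "cyl j u \<inter> cyl k v = {}" using that by (auto simp: cyl_def)
      then show ?thesis by auto
    qed
    then have "cyl j u \<inter> cyl k v \<in> ?E" for j k u v
      by (metis Int_commute linear)
    then show "Int_stable ?E" unfolding Int_stable_def by auto
    show "emeasure M X = emeasure N X" if "X \<in> ?E" for X using that eq by auto
    show "emeasure M (cyl 0 undefined) \<noteq> \<infinity>" for i :: nat
      using M(1) by (simp add: prob_space.emeasure_le_1 neq_top_trans[OF ennreal_one_neq_top])
    show "range (\<lambda>_::nat. cyl 0 undefined) \<subseteq> ?E" by auto
    show "(\<Union>i::nat. cyl 0 undefined) = UNIV" by (simp add: cyl_def)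
  qed (use S M N in simp_all)
qed

definition haar :: "(nat \<Rightarrow> bool) measure" where
  "haar = PiM UNIV (\<lambda>_. measure_pmf (bernoulli_pmf (1/2)))"

lemma sets_haar: "sets haar = sets bits"
  unfolding haar_def by (intro sets_PiM_cong) auto

lemma space_haar [simp]: "space haar = UNIV"
  using sets_eq_imp_space_eq[OF sets_haar] by simp

lemma prob_haar: "prob_space haar"
  unfolding haar_def by (intro prob_space_PiM measure_pmf.prob_space_axioms)

lemma haar_cyl: "emeasure haar (cyl j v) = ennreal ((1/2) ^ j)"
proof -
  interpret product_prob_space "\<lambda>_::nat. measure_pmf (bernoulli_pmf (1/2))" UNIV
    by unfold_locales
  have "cyl j v = prod_emb UNIV (\<lambda>_. measure_pmf (bernoulli_pmf (1/2))) {..<j} (Pi\<^sub>E {..<j} (\<lambda>i. {v i}))"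
    unfolding set_eq_iff cyl_def prod_emb_def by (simp add: PiE_iff Ball_def)
  then have "emeasure haar (cyl j v) = (\<Prod>i<j. emeasure (measure_pmf (bernoulli_pmf (1/2))) {v i})"
    unfolding haar_def by (simp add: emeasure_PiM_emb)
  also have "\<dots> = (\<Prod>i<j. ennreal (1/2))"
  proof (intro prod.cong refl)
    fix i show "emeasure (measure_pmf (bernoulli_pmf (1/2))) {v i} = ennreal (1/2)"
      by (cases "v i") (simp_all add: emeasure_pmf_single)
  qed
  also have "\<dots> = ennreal (1/2) ^ j" by (simp only: prod_constant card_lessThan)
  also have "\<dots> = ennreal ((1/2) ^ j)" by (rule ennreal_power) simp
  finally show ?thesis .
qed

text \<open>Each cylinder splits into two of the next length with equal mass, so its mass is halved
  in every step.\<close>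

lemma haar_unique:
  assumes N: "prob_space N" "sets N = sets bits"
    and eq: "\<And>j v v'. measure N (cyl j v) = measure N (cyl j v')"
  shows "N = haar"
proof (rule bits_eqI[OF N sets_haar])
  interpret prob_space N by (rule N)
  have sp: "space N = UNIV" using sets_eq_imp_space_eq[OF N(2)] by simp
  have "measure N (cyl j v) = (1/2) ^ j" for j v
  proof (induction j arbitrary: v)
    case 0
    have "cyl 0 v = space N" by (simp add: cyl_def sp)
    then show ?case using prob_space by simp
  next
    case (Suc j)
    have "cyl j v = cyl (Suc j) (v(j := True)) \<union> cyl (Suc j) (v(j := False))"
      by (auto simp: cyl_def less_Suc_eq)
    moreover have "cyl (Suc j) (v(j := True)) \<inter> cyl (Suc j) (v(j := False)) = {}"
      by (auto simp: cyl_def)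
    ultimately have "measure N (cyl j v)
        = measure N (cyl (Suc j) (v(j := True))) + measure N (cyl (Suc j) (v(j := False)))"
      using finite_measure_Union[of "cyl (Suc j) (v(j := True))" "cyl (Suc j) (v(j := False))"] cyl_sets N(2)
      by simp
    also have "\<dots> = 2 * measure N (cyl (Suc j) v)"
      using eq[of "Suc j" "v(j := True)" v] eq[of "Suc j" "v(j := False)" v] by simp
    finally show ?case using Suc[of v] by simp
  qed
  then show "emeasure N (cyl j v) = emeasure haar (cyl j v)" for j v
    by (simp add: haar_cyl emeasure_eq_measure)
qed

lemma addK_cong: "\<forall>i<Suc k. w i = w' i \<Longrightarrow> addK n w k = addK n w' k"
  using kap_cong[of "Suc k" w w'] by (simp add: addK_def)

lemma addK_measurable: "addK n \<in> measurable bits bits"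
proof (rule measurable_to_bits)
  fix i
  have "{w. addK n w i} \<in> sets bits"
    by (rule finitely_determined_sets[of "Suc i"]) (use addK_cong in blast, rule cyl_sets)
  then show "{w \<in> space bits. addK n w i} \<in> sets bits" by simp
qed

lemma addK_cyl: "addK n -` cyl j v = cyl j (addK (- n) v)"
proof -
  have "kap j (addK n w) = kap j v \<longleftrightarrow> kap j w = kap j (addK (- n) v)" for w
  proof
    assume "kap j (addK n w) = kap j v"
    then have "kap j (addK (- n) (addK n w)) = kap j (addK (- n) v)" unfolding kap_addK[of j "- n"] by simp
    then show "kap j w = kap j (addK (- n) v)" by (simp add: addK_addK)
  next
    assume "kap j w = kap j (addK (- n) v)"
    then have "kap j (addK n w) = kap j (addK n (addK (- n) v))" unfolding kap_addK[of j n] by simp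
    then show "kap j (addK n w) = kap j v" by (simp add: addK_addK)
  qed
  then show ?thesis by (auto simp: cyl_kap)
qed

text \<open>The integers are dense in the 2-adic integers, so invariance under integer translations
  already equalises all cylinders of one length.\<close>

lemma addK_transitive: "\<exists>n. cyl j (addK n v) = cyl j v'"
proof
  have "kap j (addK (kap j v' - kap j v) v) = kap j v'" by (simp add: kap_addK kap_mod)
  then show "cyl j (addK (kap j v' - kap j v) v) = cyl j v'" by (simp add: cyl_kap)
qed

lemma haar_addK: "distr haar bits (addK n) = haar"
proof (rule bits_eqI)
  have m: "addK n \<in> measurable haar bits" using addK_measurable sets_haar by (simp cong: measurable_cong_sets)
  then show "prob_space (distr haar bits (addK n))" by (rule prob_space.prob_space_distr[OF prob_haar])
  show "emeasure (distr haar bits (addK n)) (cyl j v) = emeasure haar (cyl j v)" for j v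
    using emeasure_distr[OF m cyl_sets] by (simp add: addK_cyl haar_cyl)
qed (simp_all add: sets_haar)

lemma haar_singleton: "{v} \<in> null_sets haar"
proof (rule null_setsI)
  have "{v} = (\<Inter>j. cyl j v)" by (auto simp: cyl_def)
  moreover have "(\<Inter>j. cyl j v) \<in> sets haar" unfolding sets_haar using cyl_sets by (intro sets.countable_INT) auto
  ultimately show S: "{v} \<in> sets haar" by simp
  have "emeasure haar {v} \<le> ennreal ((1/2) ^ j)" for j
    using emeasure_mono[of "{v}" "cyl j v" haar] cyl_sets sets_haar haar_cyl by (auto simp: cyl_def)
  moreover have "(\<lambda>j. ennreal ((1/2) ^ j)) \<longlonglongrightarrow> ennreal 0"
    by (intro tendsto_ennrealI LIMSEQ_realpow_zero) auto
  ultimately have "emeasure haar {v} \<le> ennreal 0" by (intro LIMSEQ_le_const) auto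
  then show "emeasure haar {v} = 0" by simp
qed

section \<open>Limits of powers of a letter acting on measures\<close>

context free_grp2
begin

lemma actY_cont: "g \<in> carrier G \<Longrightarrow> continuous_on YS (actY g)" "g \<in> carrier G \<Longrightarrow> actY g ` YS \<subseteq> YS"
  using cont_Y unfolding cont_action_def by blast+

lemma actX_cont: "g \<in> carrier G \<Longrightarrow> continuous_on XS (actX g)" "g \<in> carrier G \<Longrightarrow> actX g ` XS \<subseteq> XS"
  using cont_X unfolding cont_action_def by blast+

text \<open>The pointwise limit of the powers of \<open>c\<close> on the boundary.\<close>

definition psi :: "'a \<Rightarrow> (nat \<Rightarrow> real) \<Rightarrow> nat \<Rightarrow> real" where
  "psi c p = (if p = encY (pole (inv c)) then p else encY (pole c))"

lemma psi_lim:
  assumes c: "c \<in> Lt" and p: "p \<in> YS" shows "(\<lambda>n::nat. actY (c [^] n) p) \<longlonglongrightarrow> psi c p"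
proof -
  obtain y where y: "y \<in> ends" "p = encY y" using p by auto
  show ?thesis
  proof (cases "y = pole (inv c)")
    case True
    then show ?thesis using actY[OF y(1)] shY_pole_inv[OF c] y by (simp add: psi_def)
  next
    case False
    have "convY (\<lambda>n. shY (c [^] n) y) (pole c)"
      using contraction[OF c y(1) False] by (simp add: convY_def eventually_sequentially)
    then have "(\<lambda>n. encY (shY (c [^] (n::nat)) y)) \<longlonglongrightarrow> encY (pole c)"
      using encY_lim[of "\<lambda>n. shY (c [^] n) y"] ends_shY y(1) pole_ends[OF c] c by simp
    moreover have "p \<noteq> encY (pole (inv c))"
      using inj_onD[OF inj_encY _ y(1) pole_ends] y(2) c False by auto
    ultimately show ?thesis using actY[OF y(1)] y(2) by (simp add: psi_def)
  qed
qed

lemma psi_YS: "\<lbrakk>c \<in> Lt; p \<in> YS\<rbrakk> \<Longrightarrow> psi c p \<in> YS"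
  by (simp add: psi_def pole_ends)

lemma psi_measurable:
  assumes c: "c \<in> Lt" shows "psi c \<in> measurable (borel_on YS) (borel_on YS)"
proof (rule measurable_to_borel_on)
  show "psi c \<in> borel_measurable (borel_on YS)"
  proof (rule borel_measurable_LIMSEQ_metric)
    show "actY (c [^] (n::nat)) \<in> borel_measurable (borel_on YS)" for n
      using actY_cont(1)[of "c [^] n"] c by (intro measurable_on_continuous) simp
    show "(\<lambda>n::nat. actY (c [^] n) p) \<longlonglongrightarrow> psi c p" if "p \<in> space (borel_on YS)" for p
      using psi_lim[OF c] that by simp
  qed
qed (simp add: psi_YS[OF c])

text \<open>By dominated convergence, the images of \<open>\<mu>\<close> under the powers of
  \<open>c\<close> converge in the weak-star sense to its image under \<open>psi c\<close>.\<close>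

lemma push_psi_closed:
  assumes c: "c \<in> Lt" and C: "closedin (weak_star_top YS) C"
    and inv: "\<forall>g\<in>carrier G. \<forall>\<mu>\<in>C. push_measure YS (actY g) \<mu> \<in> C" and \<mu>: "\<mu> \<in> C"
  shows "distr \<mu> (borel_on YS) (psi c) \<in> C"
proof (rule closedin_weak_star_limit[OF C])
  have P: "\<mu> \<in> prob_measures YS" using closedin_subset[OF C] \<mu> topspace_weak_star by blast
  have mm: "measurable \<mu> (borel_on YS) = measurable (borel_on YS) (borel_on YS)"
    by (rule measurable_cong_sets[OF prob_measuresD(1)[OF P] refl])
  have am: "actY (c [^] (n::nat)) \<in> measurable \<mu> (borel_on YS)" for n
    unfolding mm using actY_cont[of "c [^] n"] c by (intro measurable_self_map) auto
  have pm: "psi c \<in> measurable \<mu> (borel_on YS)" unfolding mm by (rule psi_measurable[OF c])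
  show "distr \<mu> (borel_on YS) (actY (c [^] (n::nat))) \<in> C" for n
    using inv \<mu> c unfolding push_measure_def by simp
  show "distr \<mu> (borel_on YS) (psi c) \<in> prob_measures YS"
    using prob_measuresD(2)[OF P] pm by (rule distr_in_prob_measures)
  fix f :: "(nat \<Rightarrow> real) \<Rightarrow> real" assume f: "continuous_on YS f"
  show "(\<lambda>n::nat. \<integral>x. f x \<partial>distr \<mu> (borel_on YS) (actY (c [^] n))) \<longlonglongrightarrow> (\<integral>x. f x \<partial>distr \<mu> (borel_on YS) (psi c))"
  proof (rule bounded_dominated[OF prob_measuresD(2)[OF P] compact_Y f am pm], rule AE_I2)
    fix p assume "p \<in> space \<mu>"
    then have p: "p \<in> YS" using prob_measuresD(3)[OF P] by simp
    have "actY (c [^] (n::nat)) p \<in> YS" for n using actY_cont(2)[of "c [^] n"] c p by auto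
    then show "(\<lambda>n::nat. f (actY (c [^] n) p)) \<longlonglongrightarrow> f (psi c p)"
      using continuous_on_tendsto_compose[OF f psi_lim[OF c p] psi_YS[OF c p]] by simp
  qed
qed

text \<open>The map \<open>psi a\<close> takes only the values \<open>pole a\<close> and
  \<open>pole (inv a)\<close>, and neither is the repelling end of \<open>b\<close>. So
  \<open>psi b\<close> after \<open>psi a\<close> is constant and sends every measure to a point
  mass.\<close>

lemma strongly_proximal_Y: "strongly_proximal G YS actY"
  unfolding strongly_proximal_def
proof (intro allI impI, elim conjE)
  fix C assume ne: "C \<noteq> {}" and C: "closedin (weak_star_top YS) C"
    and inv: "\<forall>g\<in>carrier G. \<forall>\<mu>\<in>C. push_measure YS (actY g) \<mu> \<in> C"
  obtain \<mu> where \<mu>: "\<mu> \<in> C" using ne by blast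
  have P: "\<mu> \<in> prob_measures YS" using closedin_subset[OF C] \<mu> topspace_weak_star by blast
  interpret prob_space \<mu> using P by (rule prob_measuresD)
  have mm: "measurable \<mu> (borel_on YS) = measurable (borel_on YS) (borel_on YS)"
    by (rule measurable_cong_sets[OF prob_measuresD(1)[OF P] refl])
  let ?q = "encY (pole b)"
  have q: "?q \<in> YS" using pole_ends by simp
  have const: "psi b (psi a p) = ?q" for p
  proof -
    have n: "pole (inv a) \<noteq> pole (inv b)" "pole a \<noteq> pole (inv b)"
      using pole_one[of "inv a"] pole_one[of "inv b"] pole_one[of a] ab b_neq_inv_a
      by (metis a_car b_car inv_inv)+
    have "encY (pole (inv a)) \<noteq> encY (pole (inv b))" "encY (pole a) \<noteq> encY (pole (inv b))"
      using n inj_onD[OF inj_encY] pole_ends by (metis Lt_inv a_Lt b_Lt)+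
    then show ?thesis by (auto simp: psi_def)
  qed
  have "distr (distr \<mu> (borel_on YS) (psi a)) (borel_on YS) (psi b) \<in> C"
    by (intro push_psi_closed C inv \<mu> a_Lt b_Lt)
  also have "distr (distr \<mu> (borel_on YS) (psi a)) (borel_on YS) (psi b) = distr \<mu> (borel_on YS) (psi b \<circ> psi a)"
    using psi_measurable mm by (intro distr_distr) auto
  also have "psi b \<circ> psi a = (\<lambda>_. ?q)" using const by auto
  also have "distr \<mu> (borel_on YS) (\<lambda>_. ?q) = point_mass YS ?q"
    unfolding point_mass_def by (rule distr_const) (use q in simp)
  finally show "\<exists>x\<in>YS. point_mass YS x \<in> C" using q by blast
qed

end

section \<open>The relatively invariant measure\<close>

lemma open_in_borel_on: "open U \<Longrightarrow> U \<inter> X \<in> sets (borel_on X)"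
  unfolding sets_restrict_space by (rule image_eqI[of _ _ U]) auto

context free_grp2
begin

definition wpart :: "(nat \<Rightarrow> real) \<Rightarrow> nat \<Rightarrow> bool" where
  "wpart q i \<longleftrightarrow> q (3 * i + 1) = 1"

lemma wpart_encX: "wpart (encX x) = fst (snd x)"
  by (rule ext) (simp only: wpart_def encX_1, simp)

lemma wpart_measurable: "wpart \<in> measurable (borel_on XS) bits"
proof (rule measurable_to_bits)
  fix i
  have "(\<lambda>q :: nat \<Rightarrow> real. q (3 * i + 1)) \<in> borel_measurable (borel_on XS)"
    by (rule measurable_on_continuous[OF continuous_on_subset[OF continuous_on_product_coordinates subset_UNIV]])
  then have "(\<lambda>q. q (3 * i + 1)) -` {1} \<inter> space (borel_on XS) \<in> sets (borel_on XS)"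
    by (rule measurable_sets) simp
  moreover have "{q \<in> space (borel_on XS). wpart q i} = (\<lambda>q. q (3 * i + 1)) -` {1} \<inter> space (borel_on XS)"
    unfolding wpart_def by blast
  ultimately show "{q \<in> space (borel_on XS). wpart q i} \<in> sets (borel_on XS)" by (simp only:)
qed

lemma wpart_actX:
  assumes g: "g \<in> carrier G" and q: "q \<in> XS" shows "wpart (actX g q) = addK (\<sigma> g) (wpart q)"
proof -
  obtain x where x: "x \<in> flagged" "q = encX x" using q by auto
  then show ?thesis using actX[OF x(1)] by (simp add: wpart_encX shX_def split_beta)
qed

definition lift :: "('a \<Rightarrow> 'a) \<Rightarrow> (nat \<Rightarrow> bool) \<Rightarrow> nat \<Rightarrow> real" where
  "lift y w = encX (sec y w)"

lemma lift_XS: "y \<in> ends \<Longrightarrow> lift y w \<in> XS"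
  using sec_flagged by (simp add: lift_def)

lemma flag_sets: "{w. flag y w g} \<in> sets bits"
proof -
  have "{w. 2 ^ Suc j dvd kap (Suc j) w - \<sigma> g} \<in> sets bits" for j
  proof (rule finitely_determined_sets[of "Suc j"])
    show "\<forall>w w'. (\<forall>i<Suc j. w i = w' i) \<longrightarrow>
        (2 ^ Suc j dvd kap (Suc j) w - \<sigma> g) = (2 ^ Suc j dvd kap (Suc j) w' - \<sigma> g)"
    proof (intro allI impI)
      fix w w' :: "nat \<Rightarrow> bool" assume "\<forall>i<Suc j. w i = w' i"
      then have "kap (Suc j) w = kap (Suc j) w'" by (intro kap_cong) auto
      then show "(2 ^ Suc j dvd kap (Suc j) w - \<sigma> g) = (2 ^ Suc j dvd kap (Suc j) w' - \<sigma> g)"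
        by (simp only:)
    qed
  qed (rule cyl_sets)
  then have "(\<Union>j\<in>{j. exits y g (2 ^ j)}. {w. 2 ^ Suc j dvd kap (Suc j) w - \<sigma> g}) \<in> sets bits"
    by (intro sets.countable_UN') auto
  moreover have "{w. flag y w g} = (\<Union>j\<in>{j. exits y g (2 ^ j)}. {w. 2 ^ Suc j dvd kap (Suc j) w - \<sigma> g})"
    unfolding flag_def by blast
  ultimately show ?thesis by (simp only:)
qed

lemma lift_measurable:
  assumes y: "y \<in> ends" shows "lift y \<in> measurable bits (borel_on XS)"
proof (rule measurable_to_borel_on)
  have pred: "(\<lambda>w. of_bool (P w) :: real) \<in> borel_measurable bits" if "{w. P w} \<in> sets bits" for P
  proof -
    have "(\<lambda>w. of_bool (P w) :: real) = indicator {w. P w}" by (auto simp: indicator_def)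
    then show ?thesis using that by simp
  qed
  have co: "{w. w i} \<in> sets bits" for i
    by (rule finitely_determined_sets[of "Suc i"]) (auto intro: cyl_sets)
  show "lift y \<in> borel_measurable bits"
  proof (rule measurable_coordinatewise_then_product)
    fix n
    show "(\<lambda>w. lift y w n) \<in> borel_measurable bits"
    proof (cases n rule: mod3_cases)
      case (1 m)
      then have "(\<lambda>w. lift y w n) = (\<lambda>w. encY y m)"
        unfolding lift_def by (simp only: encX_0) (simp add: sec_def)
      then show ?thesis by simp
    next
      case (2 m)
      then have "(\<lambda>w. lift y w n) = (\<lambda>w. of_bool (w m))"
        unfolding lift_def by (simp only: encX_1) (simp add: sec_def)
      then show ?thesis using pred[OF co[of m]] by simp
    next
      case (3 m)
      then have "(\<lambda>w. lift y w n) = (\<lambda>w. of_bool (flag y w (de m)))"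
        unfolding lift_def by (simp only: encX_2) (simp add: sec_def)
      then show ?thesis using pred[OF flag_sets[of y "de m"]] by simp
    qed
  qed
qed (use lift_XS[OF y] in simp)

lemma haar_cong: "measurable haar N = measurable bits N"
  by (rule measurable_cong_sets[OF sets_haar refl])

lemma lift_measurable_haar: "y \<in> ends \<Longrightarrow> lift y \<in> measurable haar (borel_on XS)"
  unfolding haar_cong by (rule lift_measurable)

definition singular :: "('a \<Rightarrow> 'a) \<Rightarrow> (nat \<Rightarrow> bool) set" where
  "singular y = {w. \<exists>g\<in>carrier G. critical y w g}"

text \<open>A critical vertex \<open>g\<close> forces the 2-adic coordinate to be the integer
  \<open>\<sigma> g\<close>; there are countably many of these, and points have Haar measure
  zero.\<close>

lemma singular_null: "\<exists>N\<in>null_sets haar. singular y \<subseteq> N"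
proof
  have "singular y \<subseteq> (\<Union>g\<in>carrier G. {addK (\<sigma> g) (\<lambda>_. False)})"
  proof
    fix w assume "w \<in> singular y"
    then obtain g where g: "g \<in> carrier G" "critical y w g" by (auto simp: singular_def)
    have "kap j w = kap j (addK (\<sigma> g) (\<lambda>_. False))" for j
    proof -
      have "2 ^ j dvd kap j w - \<sigma> g" using g(2) unfolding critical_def by blast
      then have "kap j w mod 2 ^ j = \<sigma> g mod 2 ^ j" by (simp add: mod_eq_dvd_iff)
      moreover have "kap j (\<lambda>_. False) = 0" by (simp add: kap_def)
      ultimately show ?thesis by (simp add: kap_addK kap_mod)
    qed
    then have "w = addK (\<sigma> g) (\<lambda>_. False)" by (rule kap_inj)
    then show "w \<in> (\<Union>g\<in>carrier G. {addK (\<sigma> g) (\<lambda>_. False)})" using g(1) by blast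
  qed
  then show "singular y \<subseteq> (\<Union>g\<in>carrier G. {addK (\<sigma> g) (\<lambda>_. False)})" .
  show "(\<Union>g\<in>carrier G. {addK (\<sigma> g) (\<lambda>_. False)}) \<in> null_sets haar"
    by (rule null_sets_UN'[OF cnt haar_singleton])
qed

lemma AE_regular: "AE w in haar. \<forall>g\<in>carrier G. \<not> critical y w g"
proof -
  obtain N where N: "N \<in> null_sets haar" "singular y \<subseteq> N" using singular_null by blast
  show ?thesis by (rule AE_I'[OF N(1)]) (use N(2) in \<open>auto simp: singular_def\<close>)
qed

definition rim :: "(nat \<Rightarrow> real) \<Rightarrow> (nat \<Rightarrow> real) measure" where
  "rim p = distr haar (borel_on XS) (lift (inv_into ends encY p))"

lemma rim: "y \<in> ends \<Longrightarrow> rim (encY y) = distr haar (borel_on XS) (lift y)"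
  using inj_encY by (simp add: rim_def)

lemma rim_prob: "p \<in> YS \<Longrightarrow> rim p \<in> prob_measures XS"
  using rim distr_in_prob_measures[OF prob_haar lift_measurable_haar] by auto

text \<open>For almost every \<open>w\<close> no vertex is critical over the limit end, so
  \<open>lift\<close> converges there by \<open>sec_lim\<close>; dominated convergence does the
  rest.\<close>

lemma rim_continuous: "continuous_map (top_of_set YS) (weak_star_top XS) rim"
  unfolding weak_star_top_def
proof (rule continuous_on_generated_topo)
  have "rim ` topspace (top_of_set YS) \<subseteq> topspace (weak_star_top XS)"
    unfolding topspace_weak_star using rim_prob by auto
  then show "rim ` topspace (top_of_set YS) \<subseteq>
      \<Union> {{\<mu> \<in> prob_measures XS. (\<integral>x. f x \<partial>\<mu>) \<in> U} | (f :: _ \<Rightarrow> real) U. continuous_on XS f \<and> open U}"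
    unfolding weak_star_top_def topology_generated_by_topspace .
next
  fix U assume "U \<in> {{\<mu> \<in> prob_measures XS. (\<integral>x. f x \<partial>\<mu>) \<in> U} | (f :: _ \<Rightarrow> real) U. continuous_on XS f \<and> open U}"
  then obtain f :: "(nat \<Rightarrow> real) \<Rightarrow> real" and V where f: "continuous_on XS f" and V: "open V"
    and U: "U = {\<mu> \<in> prob_measures XS. (\<integral>x. f x \<partial>\<mu>) \<in> V}" by blast
  have "continuous_on YS (\<lambda>p. \<integral>x. f x \<partial>rim p)"
  proof (rule continuous_on_codedI)
    fix ts t assume t: "\<And>n. ts n \<in> ends" "t \<in> ends" "(\<lambda>n. encY (ts n)) \<longlonglongrightarrow> encY t"
    then have c: "convY ts t" using encY_lim by blast
    have "(\<lambda>n. \<integral>x. f x \<partial>distr haar (borel_on XS) (lift (ts n))) \<longlonglongrightarrow> (\<integral>x. f x \<partial>distr haar (borel_on XS) (lift t))"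
    proof (rule bounded_dominated[OF prob_haar compact_X f lift_measurable_haar[OF t(1)] lift_measurable_haar[OF t(2)]])
      show "AE w in haar. (\<lambda>n. f (lift (ts n) w)) \<longlonglongrightarrow> f (lift t w)"
        using AE_regular[of t]
      proof eventually_elim
        case (elim w)
        have x: "(t, w, \<lambda>g. g \<in> carrier G \<and> flag t w g) \<in> flagged" using sec_flagged[OF t(2), of w] by (simp add: sec_def)
        have "convX (\<lambda>n. sec (ts n) w) (t, w, \<lambda>g. g \<in> carrier G \<and> flag t w g)"
          by (rule sec_lim[OF t(1) x c]) (use elim in auto)
        then have "(\<lambda>n. encX (sec (ts n) w)) \<longlonglongrightarrow> encX (sec t w)"
          using encX_lim[of "\<lambda>n. sec (ts n) w" "sec t w"] flagged_fst[OF sec_flagged] t(1,2) by (simp add: sec_def)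
        then have "(\<lambda>n. lift (ts n) w) \<longlonglongrightarrow> lift t w" by (simp add: lift_def)
        then show ?case
          by (rule continuous_on_tendsto_compose[OF f _ lift_XS[OF t(2)]])
            (use lift_XS[OF t(1)] in simp)
      qed
    qed
    then show "(\<lambda>n. \<integral>x. f x \<partial>rim (encY (ts n))) \<longlonglongrightarrow> (\<integral>x. f x \<partial>rim (encY t))"
      using rim[OF t(1)] rim[OF t(2)] by simp
  qed
  then have "openin (top_of_set YS) (YS \<inter> (\<lambda>p. \<integral>x. f x \<partial>rim p) -` V)"
    by (rule continuous_openin_preimage_gen[OF _ V])
  moreover have "rim -` U \<inter> topspace (top_of_set YS) = YS \<inter> (\<lambda>p. \<integral>x. f x \<partial>rim p) -` V"
    unfolding U using rim_prob by auto
  ultimately show "openin (top_of_set YS) (rim -` U \<inter> topspace (top_of_set YS))" by (simp only:)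
qed

lemma rim_equivariant:
  assumes g: "g \<in> carrier G" and p: "p \<in> YS"
  shows "rim (actY g p) = push_measure XS (actX g) (rim p)"
proof -
  obtain y where y: "y \<in> ends" "p = encY y" using p by auto
  have y': "shY g y \<in> ends" using ends_shY g y by simp
  have am: "actX g \<in> measurable (borel_on XS) (borel_on XS)"
    using actX_cont[OF g] by (intro measurable_self_map)
  have ad: "addK (\<sigma> g) \<in> measurable haar bits" unfolding haar_cong by (rule addK_measurable)
  have "push_measure XS (actX g) (rim p) = distr haar (borel_on XS) (actX g \<circ> lift y)"
    unfolding push_measure_def y(2) rim[OF y(1)] by (rule distr_distr[OF am lift_measurable_haar[OF y(1)]])
  also have "actX g \<circ> lift y = lift (shY g y) \<circ> addK (\<sigma> g)"
    using actX[OF sec_flagged[OF y(1)]] shX_sec[OF g] by (auto simp: lift_def)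
  also have "distr haar (borel_on XS) \<dots> = distr (distr haar bits (addK (\<sigma> g))) (borel_on XS) (lift (shY g y))"
    by (rule distr_distr[OF lift_measurable[OF y'] ad, symmetric])
  also have "\<dots> = rim (actY g p)" unfolding haar_addK y(2) actY[OF y(1)] rim[OF y'] ..
  finally show ?thesis ..
qed

lemma rim_support:
  assumes p: "p \<in> YS" shows "measure_support XS (rim p) \<subseteq> {q \<in> XS. prj q = p}"
proof
  fix q assume q: "q \<in> measure_support XS (rim p)"
  obtain y where y: "y \<in> ends" "p = encY y" using p by auto
  have qX: "q \<in> XS" and pos: "\<And>U. \<lbrakk>open U; q \<in> U\<rbrakk> \<Longrightarrow> emeasure (rim p) (U \<inter> XS) > 0"
    using q by (auto simp: measure_support_def)
  obtain x where x: "x \<in> flagged" "q = encX x" using qX by auto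
  have "encY (fst x) n = encY y n" for n
  proof (rule ccontr)
    assume ne: "encY (fst x) n \<noteq> encY y n"
    define U where "U = {q :: nat \<Rightarrow> real. q (3 * n) \<noteq> encY y n}"
    have oU: "open U" unfolding U_def
      by (intro open_Collect_neq continuous_on_const continuous_on_product_coordinates)
    have "q \<in> U" using ne x(2) by (simp add: U_def encX_0)
    then have "emeasure (rim p) (U \<inter> XS) > 0" using pos[OF oU] by simp
    moreover have S: "U \<inter> XS \<in> sets (borel_on XS)"
      using oU by (rule open_in_borel_on)
    have "emeasure (rim p) (U \<inter> XS) = emeasure haar (lift y -` (U \<inter> XS) \<inter> space haar)"
      unfolding y(2) rim[OF y(1)] by (rule emeasure_distr[OF lift_measurable_haar[OF y(1)] S])
    moreover have "lift y -` (U \<inter> XS) = {}"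
      by (auto simp: U_def lift_def encX_0 sec_def)
    ultimately show False by simp
  qed
  then have "prj q = p" using prj[OF x(1)] x(2) y(2) by auto
  then show "q \<in> {q \<in> XS. prj q = p}" using qX by simp
qed

lemma rim_is_RIM: "is_RIM G XS actX YS actY prj rim"
  unfolding is_RIM_def using rim_continuous rim_equivariant rim_support by blast

text \<open>The complement of the support is a union of null open sets, and by the Lindelof property
  countably many of them suffice.\<close>

lemma support_full:
  assumes \<mu>: "\<mu> \<in> prob_measures XS" shows "AE q in \<mu>. q \<in> measure_support XS \<mu>"
proof -
  define F where "F = {U. open U \<and> emeasure \<mu> (U \<inter> XS) = 0}"
  obtain F' where F': "F' \<subseteq> F" "countable F'" "\<Union>F' = \<Union>F"
    by (rule Lindelof[of F]) (auto simp: F_def)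
  have "(\<Union>U\<in>F'. U \<inter> XS) \<in> null_sets \<mu>"
  proof (rule null_sets_UN'[OF F'(2)])
    fix U assume "U \<in> F'"
    then have U: "open U" "emeasure \<mu> (U \<inter> XS) = 0" using F'(1) by (auto simp: F_def)
    have "U \<inter> XS \<in> sets \<mu>" unfolding prob_measuresD(1)[OF \<mu>] using U(1) by (rule open_in_borel_on)
    then show "U \<inter> XS \<in> null_sets \<mu>" using U(2) by (rule null_setsI[rotated])
  qed
  moreover have "{q \<in> space \<mu>. \<not> q \<in> measure_support XS \<mu>} \<subseteq> (\<Union>U\<in>F'. U \<inter> XS)"
  proof
    fix q assume "q \<in> {q \<in> space \<mu>. \<not> q \<in> measure_support XS \<mu>}"
    then have q: "q \<in> XS" "q \<notin> measure_support XS \<mu>" using prob_measuresD(3)[OF \<mu>] by auto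
    then obtain U where "open U" "q \<in> U" "emeasure \<mu> (U \<inter> XS) = 0"
      by (auto simp: measure_support_def)
    then have "q \<in> \<Union>F" by (auto simp: F_def)
    then show "q \<in> (\<Union>U\<in>F'. U \<inter> XS)" using F'(3) q(1) by blast
  qed
  ultimately show ?thesis by (rule AE_I')
qed

section \<open>Uniqueness of the RIM\<close>

context
  fixes \<rho> :: "(nat \<Rightarrow> real) \<Rightarrow> (nat \<Rightarrow> real) measure"
  assumes \<rho>: "is_RIM G XS actX YS actY prj \<rho>"
begin

lemma \<rho>_prob: "p \<in> YS \<Longrightarrow> \<rho> p \<in> prob_measures XS"
  using \<rho> continuous_map_image_subset_topspace[of "top_of_set YS" "weak_star_top XS" \<rho>]
  unfolding is_RIM_def topspace_weak_star by auto

lemma \<rho>_measurable: "p \<in> YS \<Longrightarrow> measurable (\<rho> p) N = measurable (borel_on XS) N"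
  by (rule measurable_cong_sets[OF prob_measuresD(1)[OF \<rho>_prob] refl])

text \<open>The law of the 2-adic coordinate on the fibre over \<open>p\<close>.\<close>

definition kmeas :: "(nat \<Rightarrow> real) \<Rightarrow> (nat \<Rightarrow> bool) measure" where
  "kmeas p = distr (\<rho> p) bits wpart"

lemma kmeas_prob: "p \<in> YS \<Longrightarrow> prob_space (kmeas p)"
  unfolding kmeas_def
  by (rule prob_space.prob_space_distr[OF prob_measuresD(2)[OF \<rho>_prob]]) (simp_all add: \<rho>_measurable wpart_measurable)

lemma kmeas_act:
  assumes g: "g \<in> carrier G" and p: "p \<in> YS"
  shows "measure (kmeas (actY g p)) (cyl j v) = measure (kmeas p) (cyl j (addK (- \<sigma> g) v))"
proof -
  have am: "actX g \<in> measurable (borel_on XS) (borel_on XS)"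
    using actX_cont[OF g] by (intro measurable_self_map)
  have wm: "wpart \<in> measurable (\<rho> p) bits" and am': "actX g \<in> measurable (\<rho> p) (borel_on XS)"
    using wpart_measurable am by (simp_all add: \<rho>_measurable[OF p])
  have "\<rho> (actY g p) = distr (\<rho> p) (borel_on XS) (actX g)"
    using \<rho> g p unfolding is_RIM_def push_measure_def by blast
  then have "kmeas (actY g p) = distr (\<rho> p) bits (wpart \<circ> actX g)"
    unfolding kmeas_def using distr_distr[OF wpart_measurable am'] by simp
  also have "\<dots> = distr (\<rho> p) bits (addK (\<sigma> g) \<circ> wpart)"
    by (rule distr_cong) (use wpart_actX[OF g] prob_measuresD(3)[OF \<rho>_prob[OF p]] in auto)
  also have "\<dots> = distr (kmeas p) bits (addK (\<sigma> g))"
    unfolding kmeas_def by (rule distr_distr[OF addK_measurable wm, symmetric])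
  finally have "measure (kmeas (actY g p)) (cyl j v) = measure (distr (kmeas p) bits (addK (\<sigma> g))) (cyl j v)"
    by simp
  also have "\<dots> = measure (kmeas p) (addK (\<sigma> g) -` cyl j v \<inter> space (kmeas p))"
    by (rule measure_distr) (use addK_measurable cyl_sets in \<open>simp_all add: kmeas_def\<close>)
  also have "\<dots> = measure (kmeas p) (cyl j (addK (- \<sigma> g) v))"
    by (simp add: kmeas_def addK_cyl)
  finally show ?thesis .
qed

text \<open>The indicator of a cylinder, pulled back by \<open>wpart\<close>, is locally constant
  and hence an admissible test function for the weak-star topology.\<close>

lemma kmeas_continuous: "continuous_on YS (\<lambda>p. measure (kmeas p) (cyl j v))"
proof -
  define f :: "(nat \<Rightarrow> real) \<Rightarrow> real" where "f q = indicator (wpart -` cyl j v) q" for q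
  have f: "continuous_on XS f"
  proof (rule continuous_on_codedI)
    fix ts t assume t: "\<And>n. ts n \<in> flagged" "t \<in> flagged" "(\<lambda>n. encX (ts n)) \<longlonglongrightarrow> encX t"
    then have "convX ts t" using encX_lim flagged_fst by blast
    then have "\<forall>\<^sub>F n in sequentially. \<forall>i<j. fst (snd (ts n)) i = fst (snd t) i"
      using eventually_prefix[of "\<lambda>n. fst (snd (ts n))" "fst (snd t)"] by (simp add: convX_def)
    then have "\<forall>\<^sub>F n in sequentially. f (encX (ts n)) = f (encX t)"
      by eventually_elim (simp add: f_def indicator_def wpart_encX cyl_def)
    then show "(\<lambda>n. f (encX (ts n))) \<longlonglongrightarrow> f (encX t)" by (rule tendsto_eventually)
  qed
  have eq: "(\<integral>q. f q \<partial>\<rho> p) = measure (kmeas p) (cyl j v)" if p: "p \<in> YS" for p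
  proof -
    have wm: "wpart \<in> measurable (\<rho> p) bits" using wpart_measurable by (simp add: \<rho>_measurable[OF p])
    have "(\<integral>q. f q \<partial>\<rho> p) = measure (\<rho> p) (wpart -` cyl j v \<inter> space (\<rho> p))"
      unfolding f_def by simp
    also have "\<dots> = measure (kmeas p) (cyl j v)"
      unfolding kmeas_def by (rule measure_distr[OF wm cyl_sets, symmetric])
    finally show ?thesis .
  qed
  have "openin (top_of_set YS) {p \<in> YS. (\<integral>q. f q \<partial>\<rho> p) \<in> U}" if U: "open U" for U
  proof -
    have "openin (weak_star_top XS) {\<mu> \<in> prob_measures XS. (\<integral>q. f q \<partial>\<mu>) \<in> U}"
      unfolding weak_star_top_def by (rule topology_generated_by_Basis) (use f U in blast)
    then have "openin (top_of_set YS) {p \<in> topspace (top_of_set YS). \<rho> p \<in> {\<mu> \<in> prob_measures XS. (\<integral>q. f q \<partial>\<mu>) \<in> U}}"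
      using \<rho> unfolding is_RIM_def by (intro openin_continuous_map_preimage) auto
    moreover have "{p \<in> topspace (top_of_set YS). \<rho> p \<in> {\<mu> \<in> prob_measures XS. (\<integral>q. f q \<partial>\<mu>) \<in> U}}
        = {p \<in> YS. (\<integral>q. f q \<partial>\<rho> p) \<in> U}" using \<rho>_prob by auto
    ultimately show ?thesis by simp
  qed
  then have "continuous_map (top_of_set YS) euclidean (\<lambda>p. \<integral>q. f q \<partial>\<rho> p)"
    by (simp add: continuous_map_def)
  then have "continuous_on YS (\<lambda>p. \<integral>q. f q \<partial>\<rho> p)" by simp
  then show ?thesis using eq by (simp cong: continuous_on_cong)
qed

lemma kmeas_contract:
  assumes c: "c \<in> Lt" and y: "y \<in> ends" "y \<noteq> pole (inv c)"
  shows "measure (kmeas (encY y)) (cyl j v) = measure (kmeas (encY (pole c))) (cyl j v)"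
proof -
  let ?H = "\<lambda>p. measure (kmeas p) (cyl j v)"
  have cc: "c \<in> carrier G" using c by simp
  have \<sigma>pow: "\<sigma> (c [^] (n::nat)) = int n * \<sigma> c" for n
    using cc by (induction n) (simp_all add: \<sigma>_mult algebra_simps)
  \<comment> \<open>Multiples of \<open>2 ^ j\<close> as exponents: these powers of \<open>c\<close>
    preserve all cylinders of length \<open>j\<close> and still contract the boundary, so the mass
    is constant along a sequence that converges to \<open>pole c\<close>.\<close>
  define r :: "nat \<Rightarrow> nat" where "r n = n * 2 ^ j" for n
  have "?H (actY (c [^] r n) (encY y)) = ?H (encY y)" for n
  proof -
    have "kap j (addK (- \<sigma> (c [^] r n)) v) = kap j v"
    proof -
      have "(2::int) ^ j dvd - \<sigma> (c [^] r n)" unfolding \<sigma>pow r_def by simp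
      then have "(kap j v + - \<sigma> (c [^] r n)) mod 2 ^ j = kap j v mod 2 ^ j"
        unfolding mod_eq_dvd_iff by simp
      then show ?thesis by (simp only: kap_addK kap_mod[OF order_refl])
    qed
    then have "cyl j (addK (- \<sigma> (c [^] r n)) v) = cyl j v" by (simp only: cyl_kap)
    then show ?thesis using kmeas_act[of "c [^] r n" "encY y" j v] cc y(1) by simp
  qed
  moreover have "strict_mono r" by (rule strict_monoI) (simp add: r_def)
  have "(\<lambda>n::nat. actY (c [^] n) (encY y)) \<longlonglongrightarrow> psi c (encY y)" using psi_lim[OF c] y(1) by simp
  then have "((\<lambda>n::nat. actY (c [^] n) (encY y)) \<circ> r) \<longlonglongrightarrow> psi c (encY y)"
    by (rule LIMSEQ_subseq_LIMSEQ[OF _ \<open>strict_mono r\<close>])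
  moreover have "psi c (encY y) = encY (pole c)"
    using inj_onD[OF inj_encY _ y(1) pole_ends[OF Lt_inv[OF c]]] y(2) by (auto simp: psi_def)
  ultimately have "(\<lambda>n. actY (c [^] r n) (encY y)) \<longlonglongrightarrow> encY (pole c)" by (simp add: o_def)
  moreover have "actY (c [^] r n) (encY y) \<in> YS" for n
    using actY_cont(2)[of "c [^] r n"] cc y(1) by auto
  ultimately have "(\<lambda>n. ?H (actY (c [^] r n) (encY y))) \<longlonglongrightarrow> ?H (encY (pole c))"
    by (intro continuous_on_tendsto_compose[OF kmeas_continuous[of j v]])
      (use pole_ends[OF c] in simp_all)
  then have "(\<lambda>n. ?H (encY y)) \<longlonglongrightarrow> ?H (encY (pole c))"
    using \<open>\<And>n. ?H (actY (c [^] r n) (encY y)) = ?H (encY y)\<close> by simp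
  then show ?thesis by (simp add: LIMSEQ_const_iff)
qed

text \<open>Powers of \<open>b\<close> handle all ends except their repelling one; that one is
  compared with \<open>pole b\<close> through \<open>pole a\<close>.\<close>

lemma kmeas_const:
  assumes y: "y \<in> ends"
  shows "measure (kmeas (encY y)) (cyl j v) = measure (kmeas (encY (pole b))) (cyl j v)"
proof (cases "y = pole (inv b)")
  case False
  then show ?thesis using kmeas_contract[OF b_Lt y] by simp
next
  case True
  have "inv b \<noteq> inv a" using ab by (metis a_car b_car inv_inv)
  then have "y \<noteq> pole (inv a)" using True pole_one by metis
  then have "measure (kmeas (encY y)) (cyl j v) = measure (kmeas (encY (pole a))) (cyl j v)"
    using kmeas_contract[OF a_Lt y] by simp
  also have "\<dots> = measure (kmeas (encY (pole b))) (cyl j v)"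
    using kmeas_contract[OF a_Lt pole_ends[OF b_Lt] pole_ba] by simp
  finally show ?thesis .
qed

lemma kmeas_haar: assumes p: "p \<in> YS" shows "kmeas p = haar"
proof (rule haar_unique[OF kmeas_prob[OF p]])
  show "sets (kmeas p) = sets bits" by (simp add: kmeas_def)
  fix j v v'
  have const: "measure (kmeas q) (cyl j u) = measure (kmeas q') (cyl j u)" if "q \<in> YS" "q' \<in> YS" for q q' u
  proof -
    obtain y y' where "y \<in> ends" "q = encY y" "y' \<in> ends" "q' = encY y'" using \<open>q \<in> YS\<close> \<open>q' \<in> YS\<close> by auto
    then show ?thesis using kmeas_const[of y j u] kmeas_const[of y' j u] by simp
  qed
  obtain n where n: "cyl j (addK n v) = cyl j v'" using addK_transitive by blast
  have g: "ap (- n) \<in> carrier G" by simp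
  have "actY (ap (- n)) p \<in> YS" using actY_cont(2)[OF g] p by blast
  \<comment> \<open>Independence of the fibre combined with equivariance under a power of
    \<open>a\<close> turns into translation invariance on a single fibre.\<close>
  then have "measure (kmeas p) (cyl j v) = measure (kmeas (actY (ap (- n)) p)) (cyl j v)"
    by (intro const p)
  also have "\<dots> = measure (kmeas p) (cyl j (addK n v))"
    using kmeas_act[OF g p] by (simp add: \<sigma>_ap)
  finally show "measure (kmeas p) (cyl j v) = measure (kmeas p) (cyl j v')" using n by simp
qed

text \<open>Almost every point of the fibre is regular, because its 2-adic coordinate has Haar law,
  and a regular point is recovered from that coordinate by \<open>lift y\<close>.\<close>

lemma RIM_eq: assumes p: "p \<in> YS" shows "\<rho> p = rim p"
proof -
  obtain y where y: "y \<in> ends" "p = encY y" using p by auto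
  have P: "\<rho> p \<in> prob_measures XS" by (rule \<rho>_prob[OF p])
  have wm: "wpart \<in> measurable (\<rho> p) bits" using wpart_measurable by (simp add: \<rho>_measurable[OF p])
  have "AE q in \<rho> p. prj q = p"
    using support_full[OF P]
  proof eventually_elim
    case (elim q)
    then show ?case using \<rho> p unfolding is_RIM_def by blast
  qed
  moreover have "AE q in \<rho> p. \<forall>g\<in>carrier G. \<not> critical y (wpart q) g"
  proof -
    obtain N where N: "N \<in> null_sets haar" "singular y \<subseteq> N" using singular_null by blast
    have "AE w in kmeas p. w \<notin> N" unfolding kmeas_haar[OF p] by (rule AE_not_in[OF N(1)])
    then have "AE q in \<rho> p. wpart q \<notin> N" unfolding kmeas_def by (rule AE_distrD[OF wm])
    then show ?thesis by eventually_elim (use N(2) in \<open>auto simp: singular_def\<close>)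
  qed
  moreover have "AE q in \<rho> p. q \<in> XS" using prob_measuresD(3)[OF P] by (intro AE_I2) simp
  ultimately have ae: "AE q in \<rho> p. q = (lift y \<circ> wpart) q"
  proof eventually_elim
    case (elim q)
    obtain y' w z where x: "(y', w, z) \<in> flagged" "q = encX (y', w, z)" using elim(3) by (metis imageE prod.exhaust)
    have "y' = y"
      using elim(1) prj[OF x(1)] x(2) y inj_onD[OF inj_encY _ flagged_fst[OF x(1)] y(1)] by simp
    moreover have "wpart q = w" using wpart_encX[of "(y', w, z)"] x(2) by simp
    ultimately show ?case using regular_eq_sec[of y w z] x elim(2) by (simp add: lift_def)
  qed
  have "\<rho> p = distr (\<rho> p) (borel_on XS) (\<lambda>q. q)"
    by (rule distr_id2[symmetric]) (simp add: prob_measuresD(1)[OF P])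
  also have "\<dots> = distr (\<rho> p) (borel_on XS) (lift y \<circ> wpart)"
  proof (rule distr_cong_AE[OF refl refl ae])
    show "(\<lambda>q. q) \<in> measurable (\<rho> p) (borel_on XS)" by (simp add: \<rho>_measurable[OF p])
    show "lift y \<circ> wpart \<in> measurable (\<rho> p) (borel_on XS)"
      by (rule measurable_comp[OF wm lift_measurable[OF y(1)]])
  qed
  also have "\<dots> = distr (kmeas p) (borel_on XS) (lift y)"
    unfolding kmeas_def by (rule distr_distr[OF lift_measurable[OF y(1)] wm, symmetric])
  also have "\<dots> = rim p" using kmeas_haar[OF p] rim[OF y(1)] y(2) by simp
  finally show ?thesis .
qed

end

lemma unique_RIM_X: "unique_RIM G XS actX YS actY prj"
  unfolding unique_RIM_def using rim_is_RIM RIM_eq by blast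

lemma XS_nonempty: "XS \<noteq> {}"
  using sec_flagged pole_ends[OF a_Lt] by blast

end

theorem theorem1p2:
  fixes G :: "('g, 'm) monoid_scheme" and S :: "'g set"
  assumes "group G" and "free_basis G S" and "finite S" and "\<not> comm_group G"
  shows "\<exists>(X :: (nat \<Rightarrow> real) set) (Y :: (nat \<Rightarrow> real) set) actX actY \<pi>.
           compact X \<and> X \<noteq> {} \<and> compact Y \<and>
           cont_action G X actX \<and> cont_action G Y actY \<and>
           null_action G X actX \<and> minimal_action G X actX \<and>
           effective_action G Y actY \<and> strongly_proximal G Y actY \<and>
           factor_map G X actX Y actY \<pi> \<and>
           point_distal G X actX \<pi> \<and> \<not> open_extension X Y \<pi> \<and>
           unique_RIM G X actX Y actY \<pi>"
proof -
  interpret F: free_grp G S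
    using assms by (simp add: free_grp_def free_grp_axioms_def)
  obtain a b where ab: "a \<in> S" "b \<in> S" "a \<noteq> b" using F.two_generators assms(4) by blast
  obtain \<sigma> :: "'g \<Rightarrow> int" where \<sigma>: "\<sigma> a = 1"
    "\<And>g h. \<lbrakk>g \<in> carrier G; h \<in> carrier G\<rbrakk> \<Longrightarrow> \<sigma> (g \<otimes>\<^bsub>G\<^esub> h) = \<sigma> g + \<sigma> h"
    using F.ex_exponent_sum[OF ab(1)] by blast
  interpret free_grp2 G S a b \<sigma>
    by unfold_locales (use assms ab \<sigma> in auto)
  show ?thesis
    using compact_X XS_nonempty compact_Y cont_X cont_Y null_X minimal_X effective_Y
      strongly_proximal_Y prj_factor point_distal_X not_open unique_RIM_X
    by blast
qed

end
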